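(* Let $q$ be an odd prime power, $G=\mathrm{GL}(2,\mathbb F_q)$ and $C\le G$ the Cartan subgroup. For all indecomposable characters $\nu_0\in\widehat{\mathbb F_{q^2}^*}$ (viewed as one-dimensional representations of $C$) we have the decomposition $$\mathrm{Ind}_C^G\nu_0\sim\left(\bigoplus_{\substack{\psi\in\widehat{\mathbb F_q^*}:\\ \psi^2=\nu_0^\sharp}}\widehat\chi^1_\psi\right)\oplus\left(\bigoplus_{\substack{\{\psi_1,\psi_2\}\subseteq\widehat{\mathbb F_q^*}:\\ \psi_1\ne\psi_2,\ \psi_1\psi_2=\nu_0^\sharp}}\widehat\chi_{\psi_1,\psi_2}\right)\oplus\left(\bigoplus_{\substack{\{\nu,\overline\nu\}:\ \nu\in\widehat{\mathbb F_{q^2}^*}\text{ indecomposable},\\ \nu^\sharp=\nu_0^\sharp,\ \nu\neq\nu_0,\overline{\nu_0}}}\rho_\nu\right),$$ where in the last sum each unordered pair $\{\nu,\overline\nu\}$ contributes once.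
   Context: $\eta$ is a generator of $\mathbb F_q^*$, $\mathbb F_{q^2}=\mathbb F_q(i)$ with $i^2=\eta$, and $\overline{\alpha+i\beta}=\alpha-i\beta$. $C=\left\{\begin{pmatrix} a & \eta b \\ b & a \end{pmatrix}:(a,b)\ne(0,0)\right\}\cong\mathbb F_{q^2}^*$ via $\begin{pmatrix} a & \eta b \\ b & a \end{pmatrix}\mapsto a+ib$. $\widehat{\mathbb F_q^*}$, $\widehat{\mathbb F_{q^2}^*}$ are the groups of characters of the multiplicative groups. For $\nu\in\widehat{\mathbb F_{q^2}^*}$: $\nu^\sharp=\nu|_{\mathbb F_q^*}$ and $\overline\nu(w)=\nu(\overline w)$. $\nu$ is decomposable if $\nu(w)=\psi(w\overline w)$ for some $\psi\in\widehat{\mathbb F_q^*}$, otherwise indecomposable. Parabolic representations: $B$ is the group of upper triangular matrices, $\chi_{\psi_1,\psi_2}\begin{pmatrix} \alpha & \beta \\ 0 & \delta \end{pmatrix}=\psi_1(\alpha)\psi_2(\delta)$, $\widehat\chi_{\psi_1,\psi_2}=\mathrm{Ind}_B^G\chi_{\psi_1,\psi_2}$ (irreducible if $\psi_1\ne\psi_2$); $\widehat\chi_{\psi,\psi}=\widehat\chi^0_\psi\oplus\widehat\chi^1_\psi$ with $\widehat\chi^0_\psi(g)=\psi(\det g)$ and $\widehat\chi^1_\psi$ irreducible of dimension $q$. Cuspidal representations: let $\nu$ be indecomposable and $\chi$ a fixed nontrivial additive character of $\mathbb F_q$; $j(x)=\frac1q\sum_{w\in\mathbb F_{q^2}^*,\,w\overline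 w=x}\chi(w+\overline w)\nu(w)$ for $x\in\mathbb F_q^*$. $\rho_\nu$ acts on functions $f:\mathbb F_q^*\to\mathbb C$ by $[\rho_\nu(g)f](y)=\nu(\delta)\chi(\delta^{-1}\beta y^{-1})f(\delta\alpha^{-1}y)$ if $g=\begin{pmatrix} \alpha & \beta \\ 0 & \delta \end{pmatrix}$, and $[\rho_\nu(g)f](y)=-\sum_{x\in\mathbb F_q^*}\nu(-\gamma x)\chi(\alpha\gamma^{-1}y^{-1}+\gamma^{-1}\delta x^{-1})j(\gamma^{-2}y^{-1}x^{-1}\det g)f(x)$ if $g=\begin{pmatrix} \alpha & \beta \\ \gamma & \delta \end{pmatrix}$, $\gamma\ne0$. It is irreducible of dimension $q-1$, and $\rho_\nu\sim\rho_\mu$ iff $\mu\in\{\nu,\overline\nu\}$. *)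

theory Defs
  imports
    "HOL-Analysis.Determinants"
    "HOL-Algebra.Generated_Groups"
    "HOL-Algebra.Algebraic_Closure_Type"
    "HOL-Algebra.Multiplicative_Group"
    "HOL-Library.Function_Algebras"
    "HOL-Library.Product_Plus"
begin

unbundle no Formal_Power_Series.fps_syntax

section \<open>Complex representations of groups\<close>

text \<open>A representation lives on a subspace \<open>vspace V\<close> of an ambient complex vector space,
  given by an additive type \<open>'v\<close> together with the scalar multiplication \<open>scal V\<close>.\<close>

record ('g, 'v) rep =
  vspace :: "'v set"
  scal :: "complex \<Rightarrow> 'v \<Rightarrow> 'v"
  act :: "'g \<Rightarrow> 'v \<Rightarrow> 'v"

locale group_rep = G: group G + V: vector_space "scal V"
  for G :: "('g, 'm) monoid_scheme" (structure)
    and V :: "('g, 'v::ab_group_add, 'n) rep_scheme" +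
  assumes subspace: "V.subspace (vspace V)"
    and act_closed: "g \<in> carrier G \<Longrightarrow> v \<in> vspace V \<Longrightarrow> act V g v \<in> vspace V"
    and act_add: "g \<in> carrier G \<Longrightarrow> v \<in> vspace V \<Longrightarrow> w \<in> vspace V \<Longrightarrow>
      act V g (v + w) = act V g v + act V g w"
    and act_scal: "g \<in> carrier G \<Longrightarrow> v \<in> vspace V \<Longrightarrow>
      act V g (scal V c v) = scal V c (act V g v)"
    and act_one: "v \<in> vspace V \<Longrightarrow> act V \<one> v = v"
    and act_mult: "g \<in> carrier G \<Longrightarrow> h \<in> carrier G \<Longrightarrow> v \<in> vspace V \<Longrightarrow>
      act V (g \<otimes> h) v = act V g (act V h v)"

definition intertwining_iso ::
  "('g, 'm) monoid_scheme \<Rightarrow> ('g, 'v::ab_group_add) rep \<Rightarrow> ('g, 'w::ab_group_add) rep \<Rightarrow>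
    ('v \<Rightarrow> 'w) \<Rightarrow> bool" where
  "intertwining_iso G V W T \<longleftrightarrow>
     bij_betw T (vspace V) (vspace W) \<and>
     (\<forall>v\<in>vspace V. \<forall>w\<in>vspace V. T (v + w) = T v + T w) \<and>
     (\<forall>c. \<forall>v\<in>vspace V. T (scal V c v) = scal W c (T v)) \<and>
     (\<forall>g\<in>carrier G. \<forall>v\<in>vspace V. T (act V g v) = act W g (T v))"

definition rep_equiv ::
  "('g, 'm) monoid_scheme \<Rightarrow> ('g, 'v::ab_group_add) rep \<Rightarrow> ('g, 'w::ab_group_add) rep \<Rightarrow> bool" where
  "rep_equiv G V W \<longleftrightarrow> group_rep G V \<and> group_rep G W \<and> (\<exists>T. intertwining_iso G V W T)"

definition rep_sum ::
  "('g, 'v) rep \<Rightarrow> ('g, 'w) rep \<Rightarrow> ('g, 'v \<times> 'w) rep" (infixr "\<oplus>\<^sub>R" 65) where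
  "V \<oplus>\<^sub>R W = \<lparr> vspace = vspace V \<times> vspace W,
     scal = (\<lambda>c (v, w). (scal V c v, scal W c w)),
     act = (\<lambda>g (v, w). (act V g v, act W g w)) \<rparr>"

definition direct_sum :: "'i set \<Rightarrow> ('i \<Rightarrow> ('g, 'v::zero) rep) \<Rightarrow> ('g, 'i \<Rightarrow> 'v) rep" where
  "direct_sum I V = \<lparr>
     vspace = {f. (\<forall>i\<in>I. f i \<in> vspace (V i)) \<and> (\<forall>i. i \<notin> I \<longrightarrow> f i = 0) \<and> finite {i. f i \<noteq> 0}},
     scal = (\<lambda>c f i. scal (V i) c (f i)),
     act = (\<lambda>g f i. if i \<in> I then act (V i) g (f i) else 0) \<rparr>"

text \<open>The representation of \<open>G\<close> induced from a representation \<open>V\<close> of a subgroup \<open>H\<close>, on the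
  functions \<open>F : G \<rightarrow> V\<close> with \<open>F (x h) = h\<^sup>-\<^sup>1 F (x)\<close>, with \<open>(g F) (x) = F (g\<^sup>-\<^sup>1 x)\<close>.
  Functions on \<open>G\<close> are extended by \<open>0\<close> outside the carrier.\<close>

definition ind_rep ::
  "('g, 'm) monoid_scheme \<Rightarrow> 'g set \<Rightarrow> ('g, 'v::zero) rep \<Rightarrow> ('g, 'g \<Rightarrow> 'v) rep" where
  "ind_rep G H V = \<lparr>
     vspace = {F. (\<forall>x\<in>carrier G. F x \<in> vspace V) \<and> (\<forall>x. x \<notin> carrier G \<longrightarrow> F x = 0) \<and>
       (\<forall>x\<in>carrier G. \<forall>h\<in>H. F (x \<otimes>\<^bsub>G\<^esub> h) = act V (inv\<^bsub>G\<^esub> h) (F x))},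
     scal = (\<lambda>c F x. scal V c (F x)),
     act = (\<lambda>g F x. if x \<in> carrier G then F (inv\<^bsub>G\<^esub> g \<otimes>\<^bsub>G\<^esub> x) else 0) \<rparr>"

definition char_rep :: "('g \<Rightarrow> complex) \<Rightarrow> ('g, complex) rep" where
  "char_rep \<theta> = \<lparr> vspace = UNIV, scal = (*), act = (\<lambda>g z. \<theta> g * z) \<rparr>"

text \<open>Characters are extended by \<open>0\<close> outside the carrier, so that equality of characters is
  equality of functions.\<close>

definition characters :: "('g, 'm) monoid_scheme \<Rightarrow> ('g \<Rightarrow> complex) set" where
  "characters G = {\<theta>. (\<forall>x\<in>carrier G. \<theta> x \<noteq> 0) \<and>
     (\<forall>x\<in>carrier G. \<forall>y\<in>carrier G. \<theta> (x \<otimes>\<^bsub>G\<^esub> y) = \<theta> x * \<theta> y) \<and>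
     (\<forall>x. x \<notin> carrier G \<longrightarrow> \<theta> x = 0)}"


section \<open>The field \<open>F\<^sub>q\<close> and its quadratic extension\<close>

text \<open>The type \<open>'a\<close> is \<open>F\<^sub>q\<close>. Its quadratic extension consists of the pairs \<open>(a, b)\<close>,
  standing for \<open>a + i b\<close> with \<open>i\<^sup>2 = \<eta>\<close>; \<open>F\<^sub>q\<close> sits in it as \<open>(a, 0)\<close>.\<close>

abbreviation mult_grp :: "('a, 'm) ring_scheme \<Rightarrow> 'a monoid" where
  "mult_grp \<equiv> Multiplicative_Group.mult_of"

abbreviation Fq :: "'a::field ring" where
  "Fq \<equiv> ring_of_type_algebra"

definition Fq2 :: "'a::field \<Rightarrow> ('a \<times> 'a) ring" where
  "Fq2 \<eta> = \<lparr> carrier = UNIV,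
     mult = (\<lambda>(a, b) (c, d). (a * c + \<eta> * b * d, a * d + b * c)), one = (1, 0),
     zero = (0, 0), add = (+) \<rparr>"

definition conjg :: "'a::field \<times> 'a \<Rightarrow> 'a \<times> 'a" where
  "conjg w = (fst w, - snd w)"

text \<open>The elements \<open>w \<cdot> conjg w\<close> and \<open>w + conjg w\<close> have second component \<open>0\<close>.\<close>

definition nrm :: "'a::field \<Rightarrow> 'a \<times> 'a \<Rightarrow> 'a" where
  "nrm \<eta> w = fst (w \<otimes>\<^bsub>Fq2 \<eta>\<^esub> conjg w)"

definition trc :: "'a::field \<Rightarrow> 'a \<times> 'a \<Rightarrow> 'a" where
  "trc \<eta> w = fst (w \<oplus>\<^bsub>Fq2 \<eta>\<^esub> conjg w)"

definition sharp :: "('a::field \<times> 'a \<Rightarrow> complex) \<Rightarrow> 'a \<Rightarrow> complex" where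
  "sharp \<nu> = (\<lambda>x. \<nu> (x, 0))"

definition bar :: "('a::field \<times> 'a \<Rightarrow> complex) \<Rightarrow> 'a \<times> 'a \<Rightarrow> complex" where
  "bar \<nu> = (\<lambda>w. \<nu> (conjg w))"

definition decomposable :: "'a::field \<Rightarrow> ('a \<times> 'a \<Rightarrow> complex) \<Rightarrow> bool" where
  "decomposable \<eta> \<nu> \<longleftrightarrow>
     (\<exists>\<psi>\<in>characters (mult_grp Fq). \<forall>w\<in>carrier (mult_grp (Fq2 \<eta>)). \<nu> w = \<psi> (nrm \<eta> w))"

definition indecomposables :: "'a::field \<Rightarrow> ('a \<times> 'a \<Rightarrow> complex) set" where
  "indecomposables \<eta> = {\<nu> \<in> characters (mult_grp (Fq2 \<eta>)). \<not> decomposable \<eta> \<nu>}"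


section \<open>\<open>GL(2, F\<^sub>q)\<close> and its representations\<close>

definition GL2 :: "('a::field^2^2) monoid" where
  "GL2 = \<lparr> carrier = {g. invertible g}, mult = (**), one = mat 1 \<rparr>"

definition borel :: "('a::field^2^2) set" where
  "borel = {g \<in> carrier GL2. g $ 2 $ 1 = 0}"

definition cartan :: "'a::field \<Rightarrow> ('a^2^2) set" where
  "cartan \<eta> = {vector [vector [a, \<eta> * b], vector [b, a]] | a b. (a, b) \<noteq> (0, 0)}"

definition cartan_char :: "('a::field \<times> 'a \<Rightarrow> complex) \<Rightarrow> 'a^2^2 \<Rightarrow> complex" where
  "cartan_char \<nu> g = \<nu> (g $ 1 $ 1, g $ 2 $ 1)"

definition borel_char :: "('a::field \<Rightarrow> complex) \<Rightarrow> ('a \<Rightarrow> complex) \<Rightarrow> 'a^2^2 \<Rightarrow> complex" where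
  "borel_char \<psi>1 \<psi>2 g = \<psi>1 (g $ 1 $ 1) * \<psi>2 (g $ 2 $ 2)"

definition chi_hat ::
  "('a::field \<Rightarrow> complex) \<Rightarrow> ('a \<Rightarrow> complex) \<Rightarrow> ('a^2^2, 'a^2^2 \<Rightarrow> complex) rep" where
  "chi_hat \<psi>1 \<psi>2 = ind_rep GL2 borel (char_rep (borel_char \<psi>1 \<psi>2))"

definition chi_hat0 :: "('a::field \<Rightarrow> complex) \<Rightarrow> ('a^2^2, complex) rep" where
  "chi_hat0 \<psi> = char_rep (\<lambda>g. \<psi> (det g))"

text \<open>The copy of \<open>chi_hat0 \<psi>\<close> inside \<open>chi_hat \<psi> \<psi>\<close> is the line spanned by
  \<open>x \<mapsto> \<psi> (det x)\<^sup>-\<^sup>1\<close>, whose complex conjugate is \<open>x \<mapsto> \<psi> (det x)\<close>. The complementary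
  summand \<open>chi_hat1 \<psi>\<close> is its orthogonal complement; see \<open>chi_hat_decomposition\<close> below.\<close>

definition chi_hat1 :: "('a::{field,finite} \<Rightarrow> complex) \<Rightarrow> ('a^2^2, 'a^2^2 \<Rightarrow> complex) rep" where
  "chi_hat1 \<psi> = (chi_hat \<psi> \<psi>)\<lparr> vspace :=
     {F \<in> vspace (chi_hat \<psi> \<psi>). (\<Sum>x\<in>carrier GL2. \<psi> (det x) * F x) = 0} \<rparr>"

definition cusp_j ::
  "'a::{field,finite} \<Rightarrow> ('a \<Rightarrow> complex) \<Rightarrow> ('a \<times> 'a \<Rightarrow> complex) \<Rightarrow> 'a \<Rightarrow> complex" where
  "cusp_j \<eta> \<xi> \<nu> x = 1 / of_nat CARD('a) *
     (\<Sum>w\<in>{w \<in> carrier (mult_grp (Fq2 \<eta>)). nrm \<eta> w = x}. \<xi> (trc \<eta> w) * \<nu> w)"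

text \<open>\<open>\<xi>\<close> is an additive character of \<open>F\<^sub>q\<close>.
Functions on the multiplicative group of \<open>F\<^sub>q\<close> are extended by \<open>0\<close> at \<open>0\<close>.\<close>

definition cusp_rep ::
  "'a::{field,finite} \<Rightarrow> ('a \<Rightarrow> complex) \<Rightarrow> ('a \<times> 'a \<Rightarrow> complex) \<Rightarrow>
    ('a^2^2, 'a \<Rightarrow> complex) rep" where
  "cusp_rep \<eta> \<xi> \<nu> = \<lparr>
     vspace = {f. f 0 = 0},
     scal = (\<lambda>c f y. c * f y),
     act = (\<lambda>g f y.
       let \<alpha> = g $ 1 $ 1; \<beta> = g $ 1 $ 2; \<gamma> = g $ 2 $ 1; \<delta> = g $ 2 $ 2 in
       if y = 0 then 0
       else if \<gamma> = 0 then
         \<nu> (\<delta>, 0) * \<xi> (inverse \<delta> * \<beta> * inverse y) * f (\<delta> * inverse \<alpha> * y)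
       else
         - (\<Sum>x\<in>UNIV - {0}. \<nu> (- \<gamma> * x, 0) *
              \<xi> (\<alpha> * inverse \<gamma> * inverse y + inverse \<gamma> * \<delta> * inverse x) *
              cusp_j \<eta> \<xi> \<nu> (inverse (\<gamma>\<^sup>2) * inverse y * inverse x * det g) * f x)) \<rparr>"

text \<open>Up to equivalence, \<open>chi_hat \<psi>1 \<psi>2\<close> and \<open>cusp_rep \<eta> \<xi> \<nu>\<close> depend only on the unordered
  pairs \<open>{\<psi>1, \<psi>2}\<close> and \<open>{\<nu>, bar \<nu>}\<close>. The direct sums are indexed by these pairs; in the
  theorem, \<open>p\<close> and \<open>r\<close> choose an ordering, respectively a representative, of each pair.\<close>

definition principal_pairs :: "('a::field \<times> 'a \<Rightarrow> complex) \<Rightarrow> ('a \<Rightarrow> complex) set set" where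
  "principal_pairs \<nu>0 = {{\<psi>1, \<psi>2} | \<psi>1 \<psi>2.
     \<psi>1 \<in> characters (mult_grp Fq) \<and> \<psi>2 \<in> characters (mult_grp Fq) \<and>
     \<psi>1 \<noteq> \<psi>2 \<and> (\<lambda>x. \<psi>1 x * \<psi>2 x) = sharp \<nu>0}"

definition cuspidal_pairs ::
  "'a::field \<Rightarrow> ('a \<times> 'a \<Rightarrow> complex) \<Rightarrow> ('a \<times> 'a \<Rightarrow> complex) set set" where
  "cuspidal_pairs \<eta> \<nu>0 = {{\<nu>, bar \<nu>} | \<nu>.
     \<nu> \<in> indecomposables \<eta> \<and> sharp \<nu> = sharp \<nu>0 \<and> \<nu> \<noteq> \<nu>0 \<and> \<nu> \<noteq> bar \<nu>0}"


section \<open>The decomposition of \<open>chi_hat \<psi> \<psi>\<close>\<close>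

lemma group_rep_char_rep:
  assumes "group G" and "\<And>g. g \<in> carrier G \<Longrightarrow> \<theta> g \<noteq> 0"
    and "\<And>g h. g \<in> carrier G \<Longrightarrow> h \<in> carrier G \<Longrightarrow> \<theta> (g \<otimes>\<^bsub>G\<^esub> h) = \<theta> g * \<theta> h"
  shows "group_rep G (char_rep \<theta>)"
proof -
  interpret G: group G by fact
  interpret V: vector_space "scal (char_rep \<theta> :: ('a, complex) rep)"
    by unfold_locales (auto simp: char_rep_def algebra_simps)
  have "\<theta> \<one>\<^bsub>G\<^esub> = 1"
    using assms(2)[of "\<one>\<^bsub>G\<^esub>"] assms(3)[of "\<one>\<^bsub>G\<^esub>" "\<one>\<^bsub>G\<^esub>"] by simp
  then show ?thesis
    by unfold_locales (auto simp: char_rep_def assms V.subspace_def algebra_simps)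
qed

lemma group_rep_rep_sum:
  assumes "group_rep G V" and "group_rep G W"
  shows "group_rep G (V \<oplus>\<^sub>R W)"
proof -
  interpret V: group_rep G V by fact
  interpret W: group_rep G W by fact
  interpret S: vector_space "scal (V \<oplus>\<^sub>R W)"
    by unfold_locales
      (auto simp: rep_sum_def V.V.scale_right_distrib V.V.scale_left_distrib
        W.V.scale_right_distrib W.V.scale_left_distrib)
  have "S.subspace (vspace (V \<oplus>\<^sub>R W))"
    using V.subspace W.subspace
    unfolding S.subspace_def V.V.subspace_def W.V.subspace_def
    by (auto simp: rep_sum_def zero_prod_def)
  then show ?thesis
    by unfold_locales
      (auto simp: rep_sum_def V.act_closed W.act_closed V.act_add W.act_add V.act_scal
        W.act_scal V.act_one W.act_one V.act_mult W.act_mult)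
qed

lemma group_rep_ind_rep:
  assumes "group G" and "subgroup H G" and "group_rep (G\<lparr>carrier := H\<rparr>) V"
  shows "group_rep G (ind_rep G H V)"
proof -
  interpret G: group G by fact
  interpret H: subgroup H G by fact
  interpret V: group_rep "G\<lparr>carrier := H\<rparr>" V by fact
  interpret S: vector_space "scal (ind_rep G H V)"
    by unfold_locales
      (auto simp: ind_rep_def fun_eq_iff V.V.scale_right_distrib V.V.scale_left_distrib)
  have V0: "0 \<in> vspace V"
    using V.subspace by (simp add: V.V.subspace_def)
  have act0: "act V h 0 = 0" if "h \<in> H" for h
    using V.act_add[of h 0 0] that V0 by simp
  have sub: "S.subspace (vspace (ind_rep G H V))"
    using V.subspace unfolding S.subspace_def V.V.subspace_def
    by (auto simp: ind_rep_def act0 V.act_add V.act_scal)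
  have closed: "act (ind_rep G H V) g F \<in> vspace (ind_rep G H V)"
    if "g \<in> carrier G" "F \<in> vspace (ind_rep G H V)" for g F
    using that H.subset by (auto simp: ind_rep_def G.m_assoc[symmetric] subset_iff)
  show ?thesis
    by unfold_locales
      (use sub closed in \<open>auto simp: ind_rep_def fun_eq_iff G.inv_mult_group G.m_assoc\<close>)
qed

lemma group_GL2: "group (GL2 :: ('a::field^2^2) monoid)"
proof (rule groupI)
  fix x :: "'a^2^2" assume "x \<in> carrier GL2"
  then obtain y where "x ** y = mat 1" "y ** x = mat 1"
    by (auto simp: GL2_def invertible_def)
  then show "\<exists>y\<in>carrier GL2. y \<otimes>\<^bsub>GL2\<^esub> x = \<one>\<^bsub>GL2\<^esub>"
    by (intro bexI[of _ y]) (auto simp: GL2_def invertible_def)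
qed (auto simp: GL2_def matrix_mul_assoc invertible_det_nz det_mul det_I)

lemma carrier_GL2: "g \<in> carrier GL2 \<longleftrightarrow> det g \<noteq> 0"
  by (simp add: GL2_def invertible_det_nz)

lemma mult_GL2: "g \<otimes>\<^bsub>GL2\<^esub> h = g ** h"
  by (simp add: GL2_def)

lemma det_inv_GL2:
  assumes "g \<in> carrier GL2" shows "det (inv\<^bsub>GL2\<^esub> g) = inverse (det g)"
proof -
  interpret group GL2 by (rule group_GL2)
  have "g ** (inv\<^bsub>GL2\<^esub> g) = mat 1"
    using r_inv[OF assms] by (simp add: GL2_def)
  then have "det g * det (inv\<^bsub>GL2\<^esub> g) = 1"
    by (metis det_mul det_I)
  then show ?thesis by (metis inverse_unique)
qed

lemma subgroup_borel: "subgroup (borel :: ('a::field^2^2) set) GL2"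
proof -
  interpret group GL2 by (rule group_GL2)
  have "(inv\<^bsub>GL2\<^esub> g) $ 2 $ 1 = 0" if "g \<in> borel" for g :: "'a^2^2"
  proof -
    have g: "g \<in> carrier GL2" "g $ 2 $ 1 = 0" using that by (auto simp: borel_def)
    then have nz: "g $ 1 $ 1 \<noteq> 0"
      by (auto simp: carrier_GL2 det_2)
    have "(inv\<^bsub>GL2\<^esub> g ** g) $ 2 $ 1 = 0"
      using l_inv[OF g(1)] by (simp add: GL2_def mat_def)
    then show ?thesis using g(2) nz by (simp add: matrix_matrix_mult_def sum_2)
  qed
  moreover have "g ** h \<in> borel" if "g \<in> borel" "h \<in> borel" for g h :: "'a^2^2"
    using that m_closed[of g h]
    by (auto simp: borel_def mult_GL2 matrix_matrix_mult_def sum_2)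
  moreover have "mat 1 \<in> (borel :: ('a^2^2) set)"
    by (simp add: borel_def carrier_GL2 det_I) (simp add: mat_def)
  ultimately show ?thesis
    by (intro subgroupI) (auto simp: borel_def mult_GL2)
qed

lemma charactersD:
  assumes "\<psi> \<in> characters (mult_grp (Fq :: 'a::field ring))"
  shows "x \<noteq> 0 \<Longrightarrow> \<psi> x \<noteq> 0" and "x \<noteq> 0 \<Longrightarrow> y \<noteq> 0 \<Longrightarrow> \<psi> (x * y) = \<psi> x * \<psi> y"
    and "\<psi> 1 = 1" and "x \<noteq> 0 \<Longrightarrow> \<psi> (inverse x) = inverse (\<psi> x)" and "\<psi> 0 = 0"
proof -
  show 1: "x \<noteq> 0 \<Longrightarrow> \<psi> x \<noteq> 0" for x
    using assms by (auto simp: characters_def ring_of_type_algebra_def)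
  show 2: "x \<noteq> 0 \<Longrightarrow> y \<noteq> 0 \<Longrightarrow> \<psi> (x * y) = \<psi> x * \<psi> y" for x y
    using assms by (auto simp: characters_def ring_of_type_algebra_def)
  show 3: "\<psi> 1 = 1"
    using 1[of 1] 2[of 1 1] by simp
  show "\<psi> (inverse x) = inverse (\<psi> x)" if "x \<noteq> 0"
    using 2[of x "inverse x"] 3 that by (simp add: inverse_unique)
  show "\<psi> 0 = 0"
    using assms by (auto simp: characters_def ring_of_type_algebra_def)
qed

lemma group_rep_chi_hat:
  assumes "\<psi>1 \<in> characters (mult_grp (Fq :: 'a::field ring))" and "\<psi>2 \<in> characters (mult_grp Fq)"
  shows "group_rep GL2 (chi_hat \<psi>1 \<psi>2)"
  unfolding chi_hat_def
proof (intro group_rep_ind_rep group_rep_char_rep group_GL2 subgroup_borel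
    subgroup.subgroup_is_group)
  have nz: "g $ 1 $ 1 \<noteq> 0 \<and> g $ 2 $ 2 \<noteq> 0" if "g \<in> borel" for g :: "'a^2^2"
    using that by (auto simp: borel_def carrier_GL2 det_2)
  fix g h :: "'a^2^2"
  assume g: "g \<in> carrier (GL2\<lparr>carrier := borel\<rparr>)"
  then show "borel_char \<psi>1 \<psi>2 g \<noteq> 0"
    using nz[of g] charactersD(1)[OF assms(1)] charactersD(1)[OF assms(2)]
    by (auto simp: borel_char_def)
  assume h: "h \<in> carrier (GL2\<lparr>carrier := borel\<rparr>)"
  have "(g ** h) $ 1 $ 1 = g $ 1 $ 1 * h $ 1 $ 1" "(g ** h) $ 2 $ 2 = g $ 2 $ 2 * h $ 2 $ 2"
    using g h by (auto simp: matrix_matrix_mult_def sum_2 borel_def)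
  then show "borel_char \<psi>1 \<psi>2 (g \<otimes>\<^bsub>GL2\<lparr>carrier := borel\<rparr>\<^esub> h) =
      borel_char \<psi>1 \<psi>2 g * borel_char \<psi>1 \<psi>2 h"
    using nz[of g] nz[of h] g h charactersD(2)[OF assms(1)] charactersD(2)[OF assms(2)]
    by (auto simp: borel_char_def mult_GL2)
qed

lemma chi_hat_decomposition:
  fixes \<psi> :: "'a::{field,finite} \<Rightarrow> complex"
  assumes \<psi>: "\<psi> \<in> characters (mult_grp Fq)"
  shows "rep_equiv GL2 (chi_hat \<psi> \<psi>) (chi_hat0 \<psi> \<oplus>\<^sub>R chi_hat1 \<psi>)"
proof -
  let ?G = "carrier (GL2 :: ('a^2^2) monoid)"
  let ?V = "chi_hat \<psi> \<psi>"
  note ch = charactersD[OF \<psi>]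
  interpret G: group "GL2 :: ('a^2^2) monoid" by (rule group_GL2)
  interpret V: group_rep GL2 ?V by (rule group_rep_chi_hat[OF \<psi> \<psi>])
  define S where "S F = (\<Sum>x\<in>?G. \<psi> (det x) * F x)" for F
  have S_add: "S (F + F') = S F + S F'" for F F'
    by (simp add: S_def sum.distrib algebra_simps)
  have scal: "scal ?V c F = (\<lambda>x. c * F x)" for c F
    by (simp add: chi_hat_def ind_rep_def char_rep_def)
  have S_scal: "S (\<lambda>x. c * F x) = c * S F" for c F
    by (simp add: S_def sum_distrib_left algebra_simps)
  have act: "act ?V g F = (\<lambda>x. if x \<in> ?G then F (inv\<^bsub>GL2\<^esub> g ** x) else 0)" for g F
    by (simp add: chi_hat_def ind_rep_def mult_GL2 cong: if_cong)
  have dm: "\<psi> (det (g ** x)) = \<psi> (det g) * \<psi> (det x)" if "g \<in> ?G" "x \<in> ?G" for g x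
    using that ch(2) by (simp add: det_mul carrier_GL2)
  have S_act: "S (act ?V g F) = \<psi> (det g) * S F" if g: "g \<in> ?G" for g F
  proof -
    have "S (act ?V g F) = (\<Sum>x\<in>?G. \<psi> (det x) * F (inv\<^bsub>GL2\<^esub> g ** x))"
      by (simp add: S_def act)
    also have "\<dots> = (\<Sum>x\<in>?G. \<psi> (det (g ** x)) * F x)"
    proof (rule sum.reindex_bij_witness[of _ "\<lambda>x. g ** x" "\<lambda>x. inv\<^bsub>GL2\<^esub> g ** x"])
      show "g ** (inv\<^bsub>GL2\<^esub> g ** x) = x" if "x \<in> ?G" for x
        using that g G.m_assoc[of g "inv\<^bsub>GL2\<^esub> g" x] by (simp add: mult_GL2[symmetric])
      then show "\<psi> (det (g ** (inv\<^bsub>GL2\<^esub> g ** x))) * F (inv\<^bsub>GL2\<^esub> g ** x) =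
          \<psi> (det x) * F (inv\<^bsub>GL2\<^esub> g ** x)" if "x \<in> ?G" for x
        using that by simp
      show "inv\<^bsub>GL2\<^esub> g ** (g ** x) = x" if "x \<in> ?G" for x
        using that g G.m_assoc[of "inv\<^bsub>GL2\<^esub> g" g x] by (simp add: mult_GL2[symmetric])
    qed (use g in \<open>simp_all add: mult_GL2[symmetric]\<close>)
    also have "\<dots> = \<psi> (det g) * S F"
      using g by (simp add: S_def dm sum_distrib_left mult.assoc)
    finally show ?thesis .
  qed
  define E where "E = (\<lambda>x::'a^2^2. if x \<in> ?G then inverse (\<psi> (det x)) else 0)"
  have inv_borel: "inv\<^bsub>GL2\<^esub> h \<in> borel" if "h \<in> borel" for h :: "'a^2^2"
    using subgroup.m_inv_closed[OF subgroup_borel that] .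
  have E: "E \<in> vspace ?V"
  proof -
    have "E (x ** h) = borel_char \<psi> \<psi> (inv\<^bsub>GL2\<^esub> h) * E x" if x: "x \<in> ?G" and h: "h \<in> borel" for x h
    proof -
      have hG: "h \<in> ?G" and xh: "x ** h \<in> ?G"
        using h x G.m_closed[of x h] by (auto simp: borel_def mult_GL2)
      have i: "inv\<^bsub>GL2\<^esub> h \<in> ?G" "(inv\<^bsub>GL2\<^esub> h) $ 2 $ 1 = 0"
        using inv_borel[OF h] by (auto simp: borel_def)
      then have "borel_char \<psi> \<psi> (inv\<^bsub>GL2\<^esub> h) = \<psi> (det (inv\<^bsub>GL2\<^esub> h))"
        using ch(2) by (simp add: borel_char_def det_2 carrier_GL2)
      also have "\<dots> = inverse (\<psi> (det h))"
        using hG ch(4) by (simp add: det_inv_GL2) (simp add: carrier_GL2)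
      finally show ?thesis
        using x xh hG by (simp add: E_def dm)
    qed
    then show ?thesis
      by (auto simp: chi_hat_def ind_rep_def char_rep_def mult_GL2) (simp add: E_def)
  qed
  have act_E: "act ?V g E = scal ?V (\<psi> (det g)) E" if g: "g \<in> ?G" for g
  proof -
    have "inverse (\<psi> (det (inv\<^bsub>GL2\<^esub> g ** x))) = \<psi> (det g) * inverse (\<psi> (det x))"
      if "x \<in> ?G" for x
      using that g ch(4)[of "det g"] by (simp add: dm det_inv_GL2) (simp add: carrier_GL2)
    moreover have "inv\<^bsub>GL2\<^esub> g ** x \<in> ?G" if "x \<in> ?G" for x
      using that g by (simp add: mult_GL2[symmetric])
    ultimately show ?thesis
      by (auto simp: act scal E_def fun_eq_iff)
  qed
  define n where "n = (of_nat (card ?G) :: complex)"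
  have n: "n \<noteq> 0"
    using G.one_closed by (auto simp: n_def)
  have SE: "S E = n"
    using ch(1) by (simp add: S_def E_def n_def carrier_GL2)
  define T where "T F = (S F / n, F - scal ?V (S F / n) E)" for F
  have sub: "F - scal ?V c E \<in> vspace ?V" "F + scal ?V c E \<in> vspace ?V" if "F \<in> vspace ?V" for F c
    using that E V.subspace V.V.subspace_diff V.V.subspace_add V.V.subspace_scale by metis+
  have S_sub: "S (F - scal ?V c E) = S F - c * n" "S (F + scal ?V c E) = S F + c * n" for F c
    using S_add[of "F - scal ?V c E" "scal ?V c E"] by (simp_all add: S_add scal S_scal SE)
  have v1: "vspace (chi_hat1 \<psi>) = {F \<in> vspace ?V. S F = 0}"
    and s1: "scal (chi_hat1 \<psi>) = scal ?V" and a1: "act (chi_hat1 \<psi>) = act ?V"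
    by (simp_all add: chi_hat1_def S_def)
  have r1: "group_rep GL2 (chi_hat1 \<psi>)"
  proof -
    interpret W: vector_space "scal (chi_hat1 \<psi>)"
      unfolding s1 by (rule V.V.vector_space_axioms)
    have "S 0 = 0" by (simp add: S_def)
    then have "V.V.subspace (vspace (chi_hat1 \<psi>))"
      using V.subspace by (auto simp: v1 V.V.subspace_def S_add) (simp add: scal S_scal)
    then show ?thesis
      by unfold_locales
        (auto simp: s1 a1 v1 V.act_closed V.act_add V.act_scal V.act_one V.act_mult S_act)
  qed
  have r0: "group_rep GL2 (chi_hat0 \<psi>)"
    unfolding chi_hat0_def
    by (rule group_rep_char_rep[OF group_GL2])
      (use ch(1) in \<open>auto simp: mult_GL2 dm\<close>, simp add: carrier_GL2)
  have "intertwining_iso GL2 ?V (chi_hat0 \<psi> \<oplus>\<^sub>R chi_hat1 \<psi>) T"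
    unfolding intertwining_iso_def
  proof (intro conjI ballI allI)
    show "bij_betw T (vspace ?V) (vspace (chi_hat0 \<psi> \<oplus>\<^sub>R chi_hat1 \<psi>))"
      by (rule bij_betw_byWitness[where f' = "\<lambda>(c, F). F + scal ?V c E"])
        (use n sub in \<open>auto simp: T_def S_sub rep_sum_def chi_hat0_def char_rep_def v1\<close>)
    show "T (v + w) = T v + T w" for v w
      by (simp add: T_def S_add add_divide_distrib V.V.scale_left_distrib algebra_simps)
    show "T (scal ?V c v) = scal (chi_hat0 \<psi> \<oplus>\<^sub>R chi_hat1 \<psi>) c (T v)" for c v
      by (simp add: T_def rep_sum_def s1 chi_hat0_def char_rep_def)
        (simp add: scal S_scal fun_eq_iff algebra_simps)
    show "T (act ?V g v) = act (chi_hat0 \<psi> \<oplus>\<^sub>R chi_hat1 \<psi>) g (T v)"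
      if "g \<in> ?G" "v \<in> vspace ?V" for g v
    proof -
      have "act ?V g v = act ?V g (v - scal ?V (S v / n) E) + act ?V g (scal ?V (S v / n) E)"
        using V.act_add[of g "v - scal ?V (S v / n) E" "scal ?V (S v / n) E"] that sub(1) E
          V.subspace V.V.subspace_scale by (metis diff_add_cancel)
      also have "act ?V g (scal ?V (S v / n) E) = scal ?V (\<psi> (det g) * S v / n) E"
        using that E by (simp add: V.act_scal act_E mult.commute)
      finally have "act ?V g (v - scal ?V (S v / n) E) =
          act ?V g v - scal ?V (\<psi> (det g) * S v / n) E"
        by (simp only: add_diff_cancel)
      then show ?thesis
        using that by (simp add: T_def rep_sum_def a1 chi_hat0_def char_rep_def S_act)
    qed
  qed
  then show ?thesis
    unfolding rep_equiv_def
    using V.group_rep_axioms group_rep_rep_sum[OF r0 r1] by blast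
qed

end

theory Submission
  imports Defs
begin

text \<open>For every summand \<open>W\<close> on the right there is an injective intertwining map from \<open>W\<close> into the
  representation induced from \<open>C\<close>. For a parabolic \<open>W\<close> it comes from the functional
  \<open>F \<mapsto> \<Sum>c\<in>C. \<nu>0 c * F c\<close>, and composing with the adjoint gives a nonzero scalar. For a cuspidal \<open>W\<close>
  the trace of the projection onto the \<open>\<nu>0\<close>-isotypic part of \<open>W\<close> restricted to \<open>C\<close> is nonzero, since the
  character of \<open>\<rho>\<^sub>\<nu>\<close> is \<open>- \<nu> - bar \<nu>\<close> on the non-scalar elements of \<open>C\<close>. The sum over the non-scalar
  matrices of given determinant and trace acts on each summand by a scalar, and these scalars tell
  the summands apart, so the images are linearly independent. Finally the dimensions agree: with \<open>s\<close>
  square roots \<open>\<psi>\<close> of the restriction of \<open>\<nu>0\<close> there are \<open>(q - 1 - s) / 2\<close> pairs of either kind, and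
  \<open>s q + (q - 1 - s) / 2 * (q + 1) + (q - 1 - s) / 2 * (q - 1) = q (q - 1)\<close>.

  That the formulas for \<open>\<rho>\<^sub>\<nu>\<close> define a representation comes down to a convolution identity for \<open>j\<close>.\<close>

section \<open>Intertwining maps\<close>

text \<open>A summand enters the final argument only through the properties collected in
  \<open>constituent\<close>: it is a representation, it embeds, class sums act on it by scalars,
  and it contains an independent set of the expected size. Independence of the images bounds the
  dimensions from one side, so the other side asks only for lower bounds on the numbers of pairs and
  a spanning set of size q (q - 1) of the induced space. The nontrivial unipotents, the class of
  determinant 1 and trace 2, already tell the three kinds apart: the scalar is 0 on
  \<open>chi_hat1\<close>, q - 1 on \<open>chi_hat\<close> with distinct characters, and negative on
  \<open>cusp_rep\<close>. Within a kind, the classes with eigenvalues a and 1 recover \<psi> or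
  \<psi>1 + \<psi>2, the nonscalar elements of C recover \<nu> + \<open>bar\<close> \<nu>, and
  orthogonality of characters recovers the pair from the sum. The delicate embedding is that of
  \<open>chi_hat1\<close>. For \<psi>1 = \<psi>2 a bi-equivariant kernel is no longer concentrated
  on the Borel subgroup; its value on the big cell could cancel the one at the identity, and the
  indecomposability of \<nu>0 rules this out.\<close>

definition intertwiner ::
  "('g, 'm) monoid_scheme \<Rightarrow> ('g, 'v::ab_group_add, 'n) rep_scheme \<Rightarrow>
    ('g, 'w::ab_group_add, 'o) rep_scheme \<Rightarrow> ('v \<Rightarrow> 'w) \<Rightarrow> bool" where
  "intertwiner G V W T \<longleftrightarrow>
     (\<forall>v\<in>vspace V. T v \<in> vspace W) \<and>
     (\<forall>v\<in>vspace V. \<forall>w\<in>vspace V. T (v + w) = T v + T w) \<and>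
     (\<forall>c. \<forall>v\<in>vspace V. T (scal V c v) = scal W c (T v)) \<and>
     (\<forall>g\<in>carrier G. \<forall>v\<in>vspace V. T (act V g v) = act W g (T v))"

lemma intertwinerD:
  assumes "intertwiner G V W T"
  shows "v \<in> vspace V \<Longrightarrow> T v \<in> vspace W"
    and "v \<in> vspace V \<Longrightarrow> w \<in> vspace V \<Longrightarrow> T (v + w) = T v + T w"
    and "v \<in> vspace V \<Longrightarrow> T (scal V c v) = scal W c (T v)"
    and "g \<in> carrier G \<Longrightarrow> v \<in> vspace V \<Longrightarrow> T (act V g v) = act W g (T v)"
  using assms by (auto simp: intertwiner_def)

context group_rep
begin

lemma zero_in: "0 \<in> vspace V"
  using subspace by (simp add: V.subspace_def)

lemma add_in: "v \<in> vspace V \<Longrightarrow> w \<in> vspace V \<Longrightarrow> v + w \<in> vspace V"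
  using subspace by (simp add: V.subspace_def)

lemma scal_in: "v \<in> vspace V \<Longrightarrow> scal V c v \<in> vspace V"
  using subspace by (simp add: V.subspace_def)

lemma sum_in: "(\<And>i. i \<in> S \<Longrightarrow> v i \<in> vspace V) \<Longrightarrow> sum v S \<in> vspace V"
  using subspace by (rule V.subspace_sum)

lemma act_zero: "g \<in> carrier G \<Longrightarrow> act V g 0 = 0"
  using act_add[of g 0 0] zero_in by simp

lemma intertwiner_zero:
  assumes "intertwiner G V W T" shows "T 0 = 0"
  using intertwinerD(2)[OF assms, of 0 0] zero_in by simp

lemma intertwiner_sum:
  assumes T: "intertwiner G V W T" and v: "\<And>i. i \<in> S \<Longrightarrow> v i \<in> vspace V"
  shows "T (sum v S) = (\<Sum>i\<in>S. T (v i))"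
  using v
proof (induction S rule: infinite_finite_induct)
  case (insert x S)
  then show ?case
    using intertwinerD(2)[OF T, of "v x" "sum v S"] sum_in[of S v] by simp
qed (auto simp: intertwiner_zero[OF T])

lemma act_sum:
  assumes "g \<in> carrier G" "\<And>i. i \<in> S \<Longrightarrow> v i \<in> vspace V"
  shows "act V g (sum v S) = (\<Sum>i\<in>S. act V g (v i))"
  using assms(2)
proof (induction S rule: infinite_finite_induct)
  case (insert x S)
  then show ?case
    using act_add[OF assms(1), of "v x" "sum v S"] sum_in[of S v] by simp
qed (auto simp: act_zero assms(1))

end

lemma rep_equiv_sym:
  assumes "rep_equiv G V W" shows "rep_equiv G W V"
proof -
  obtain T where V: "group_rep G V" and W: "group_rep G W" and T: "intertwining_iso G V W T"
    using assms by (auto simp: rep_equiv_def)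
  interpret V: group_rep G V by fact
  define S where "S = the_inv_into (vspace V) T"
  have bij: "bij_betw T (vspace V) (vspace W)"
    and add: "\<And>v w. v \<in> vspace V \<Longrightarrow> w \<in> vspace V \<Longrightarrow> T (v + w) = T v + T w"
    and scal: "\<And>c v. v \<in> vspace V \<Longrightarrow> T (scal V c v) = scal W c (T v)"
    and act: "\<And>g v. g \<in> carrier G \<Longrightarrow> v \<in> vspace V \<Longrightarrow> T (act V g v) = act W g (T v)"
    using T by (auto simp: intertwining_iso_def)
  have ST: "S (T v) = v" if "v \<in> vspace V" for v
    using that bij by (simp add: S_def bij_betw_def the_inv_into_f_f)
  have ex: "\<exists>v\<in>vspace V. w = T v" if "w \<in> vspace W" for w
    using that bij by (auto simp: bij_betw_def)
  have "intertwining_iso G W V S"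
    unfolding intertwining_iso_def
  proof (intro conjI ballI allI)
    show "bij_betw S (vspace W) (vspace V)"
      unfolding S_def by (rule bij_betw_the_inv_into[OF bij])
    show "S (v + w) = S v + S w" if vw: "v \<in> vspace W" "w \<in> vspace W" for v w
    proof -
      obtain v' w' where "v' \<in> vspace V" "w' \<in> vspace V" "v = T v'" "w = T w'"
        using ex[OF vw(1)] ex[OF vw(2)] by blast
      then show ?thesis by (simp add: add[symmetric] ST V.add_in)
    qed
    show "S (scal W c w) = scal V c (S w)" if "w \<in> vspace W" for c w
      using ex[OF that] by (auto simp: scal[symmetric] ST V.scal_in)
    show "S (act W g w) = act V g (S w)" if "g \<in> carrier G" "w \<in> vspace W" for g w
      using ex[OF that(2)] that(1) by (auto simp: act[symmetric] ST V.act_closed)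
  qed
  then show ?thesis using V W by (auto simp: rep_equiv_def)
qed

lemma rep_equiv_of_intertwiner:
  assumes V: "group_rep G V" and W: "group_rep G W" and T: "intertwiner G V W T"
    and ker: "\<And>v. v \<in> vspace V \<Longrightarrow> T v = 0 \<Longrightarrow> v = 0"
    and surj: "vspace W \<subseteq> T ` vspace V"
  shows "rep_equiv G V W"
proof -
  interpret V: group_rep G V by fact
  note D = intertwinerD[OF T]
  have "inj_on T (vspace V)"
  proof (rule inj_onI)
    fix v w assume vw: "v \<in> vspace V" "w \<in> vspace V" "T v = T w"
    have m: "- w \<in> vspace V" using V.scal_in[OF vw(2), of "-1"] by simp
    have "T w + T (- w) = 0"
      using D(2)[OF vw(2) m] V.intertwiner_zero[OF T] by simp
    then have "T (v + - w) = 0" using D(2)[OF vw(1) m] vw(3) by simp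
    then show "v = w" using ker[OF V.add_in[OF vw(1) m]] by simp
  qed
  then have "bij_betw T (vspace V) (vspace W)"
    using surj D(1) by (auto simp: bij_betw_def)
  then show ?thesis
    using assms(1,2) D by (auto simp: rep_equiv_def intertwining_iso_def)
qed

text \<open>The assumption \<open>vs\<close> ranges over all indices because
  \<open>direct_sum\<close> scales every coordinate, also those outside \<open>I\<close>, and
  \<open>group_rep\<close> asks for a vector space on the whole ambient type.\<close>

lemma group_rep_direct_sum:
  assumes G: "group G" and V: "\<And>i. i \<in> I \<Longrightarrow> group_rep G (V i)"
    and vs: "\<And>i. vector_space (scal (V i))"
  shows "group_rep G (direct_sum I V)"
proof -
  interpret G: group G by fact
  let ?D = "direct_sum I V"
  interpret S: vector_space "scal ?D"
    by unfold_locales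
      (auto simp: direct_sum_def fun_eq_iff vector_space.vector_space_assms[OF vs])
  have scal0: "scal (V i) c 0 = 0" for i c
    using vector_space.vector_space_assms(1)[OF vs, of i c 0 0] by simp
  have sub: "S.subspace (vspace ?D)"
    unfolding S.subspace_def
  proof (intro conjI ballI allI)
    show "0 \<in> vspace ?D"
      using group_rep.zero_in[OF V] by (auto simp: direct_sum_def)
    show "x + y \<in> vspace ?D" if "x \<in> vspace ?D" "y \<in> vspace ?D" for x y
    proof -
      have "finite ({i. x i \<noteq> 0} \<union> {i. y i \<noteq> 0})" using that by (auto simp: direct_sum_def)
      then have "finite {i. x i + y i \<noteq> 0}" by (rule rev_finite_subset) auto
      then show ?thesis using that group_rep.add_in[OF V] by (auto simp: direct_sum_def)
    qed
    show "scal ?D c x \<in> vspace ?D" if "x \<in> vspace ?D" for c x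
    proof -
      have "finite {i. x i \<noteq> 0}" using that by (auto simp: direct_sum_def)
      then have "finite {i. scal (V i) c (x i) \<noteq> 0}"
        by (rule rev_finite_subset) (auto simp: scal0)
      then show ?thesis using that group_rep.scal_in[OF V]
        by (auto simp: direct_sum_def scal0)
    qed
  qed
  have closed: "act ?D g x \<in> vspace ?D" if "g \<in> carrier G" "x \<in> vspace ?D" for g x
  proof -
    have "finite {i. x i \<noteq> 0}" using that by (auto simp: direct_sum_def)
    then have "finite {i. i \<in> I \<and> act (V i) g (x i) \<noteq> 0}"
      by (rule rev_finite_subset) (use that(1) group_rep.act_zero[OF V] in auto)
    moreover have "{i. (i \<in> I \<longrightarrow> act (V i) g (x i) \<noteq> 0) \<and> i \<in> I} = {i. i \<in> I \<and> act (V i) g (x i) \<noteq> 0}"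
      by auto
    ultimately show ?thesis using that group_rep.act_closed[OF V]
      by (auto simp: direct_sum_def cong: conj_cong)
  qed
  show ?thesis
    by unfold_locales
      (use sub closed in \<open>auto simp: direct_sum_def fun_eq_iff scal0
        group_rep.act_add[OF V] group_rep.act_scal[OF V] group_rep.act_one[OF V]
        group_rep.act_mult[OF V]\<close>)
qed

lemma intertwiner_direct_sum:
  assumes W: "group_rep G W" and fin: "finite I"
    and T: "\<And>i. i \<in> I \<Longrightarrow> intertwiner G (V i) W (T i)"
  shows "intertwiner G (direct_sum I V) W (\<lambda>f. \<Sum>i\<in>I. T i (f i))"
proof -
  interpret W: group_rep G W by fact
  note D = intertwinerD[OF T]
  show ?thesis
    unfolding intertwiner_def
  proof (intro conjI ballI allI)
    show "(\<Sum>i\<in>I. T i (f i)) \<in> vspace W" if "f \<in> vspace (direct_sum I V)" for f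
      using that D(1) by (intro W.sum_in) (auto simp: direct_sum_def)
    show "(\<Sum>i\<in>I. T i ((f + h) i)) = (\<Sum>i\<in>I. T i (f i)) + (\<Sum>i\<in>I. T i (h i))"
      if "f \<in> vspace (direct_sum I V)" "h \<in> vspace (direct_sum I V)" for f h
      using that D(2) by (auto simp: direct_sum_def sum.distrib[symmetric] intro!: sum.cong)
    show "(\<Sum>i\<in>I. T i (scal (direct_sum I V) c f i)) = scal W c (\<Sum>i\<in>I. T i (f i))"
      if "f \<in> vspace (direct_sum I V)" for c f
      using that D(3) by (auto simp: direct_sum_def W.V.scale_sum_right intro!: sum.cong)
    show "(\<Sum>i\<in>I. T i (act (direct_sum I V) g f i)) = act W g (\<Sum>i\<in>I. T i (f i))"
      if "g \<in> carrier G" "f \<in> vspace (direct_sum I V)" for g f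
      using that D(1,4) by (subst W.act_sum) (auto simp: direct_sum_def intro!: sum.cong)
  qed
qed

lemma intertwiner_rep_sum:
  assumes W: "group_rep G W" and S: "intertwiner G V W S" and T: "intertwiner G V' W T"
  shows "intertwiner G (V \<oplus>\<^sub>R V') W (\<lambda>(v, v'). S v + T v')"
proof -
  interpret W: group_rep G W by fact
  show ?thesis
    unfolding intertwiner_def
    using intertwinerD[OF S] intertwinerD[OF T]
    by (auto simp: rep_sum_def W.add_in W.V.scale_right_distrib W.act_add algebra_simps)
qed

text \<open>One direction of Frobenius reciprocity.\<close>

definition frob :: "('g, 'm) monoid_scheme \<Rightarrow> ('g, 'v) rep \<Rightarrow> ('v \<Rightarrow> complex) \<Rightarrow> 'v \<Rightarrow> 'g \<Rightarrow> complex" where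
  "frob G V l v = (\<lambda>x. if x \<in> carrier G then l (act V (inv\<^bsub>G\<^esub> x) v) else 0)"

text \<open>With F (x) = l (x^-1 v), the equivariance of \<open>l\<close> under h^-1 is the
  transformation law F (x h) = \<theta> (h^-1) F (x), and g acts on F by replacing v with g
  v.\<close>

lemma intertwiner_frob:
  assumes V: "group_rep G V" and H: "subgroup H G"
    and add: "\<And>v w. v \<in> vspace V \<Longrightarrow> w \<in> vspace V \<Longrightarrow> l (v + w) = l v + l w"
    and scal: "\<And>c v. v \<in> vspace V \<Longrightarrow> l (scal V c v) = c * l v"
    and equi: "\<And>h v. h \<in> H \<Longrightarrow> v \<in> vspace V \<Longrightarrow> l (act V h v) = \<theta> h * l v"
  shows "intertwiner G V (ind_rep G H (char_rep \<theta>)) (frob G V l)"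
proof -
  interpret V: group_rep G V by fact
  interpret H: subgroup H G by fact
  show ?thesis
    unfolding intertwiner_def
    by (auto simp: frob_def ind_rep_def char_rep_def fun_eq_iff add scal V.act_add V.act_scal
      V.act_closed V.G.inv_mult_group V.act_mult equi)
qed

section \<open>Class sums\<close>

definition conj_invariant :: "('g, 'm) monoid_scheme \<Rightarrow> ('g \<Rightarrow> complex) \<Rightarrow> bool" where
  "conj_invariant G f \<longleftrightarrow> (\<forall>g\<in>carrier G. \<forall>h\<in>carrier G. f (h \<otimes>\<^bsub>G\<^esub> g \<otimes>\<^bsub>G\<^esub> inv\<^bsub>G\<^esub> h) = f g)"

definition class_sum ::
  "('g, 'm) monoid_scheme \<Rightarrow> ('g, 'v::comm_monoid_add, 'n) rep_scheme \<Rightarrow> ('g \<Rightarrow> complex) \<Rightarrow> 'v \<Rightarrow> 'v" where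
  "class_sum G V f v = (\<Sum>g\<in>carrier G. scal V (f g) (act V g v))"

context group_rep
begin

lemma class_sum_in: "v \<in> vspace V \<Longrightarrow> class_sum G V f v \<in> vspace V"
  by (auto simp: class_sum_def intro!: sum_in scal_in act_closed)

lemma class_sum_add:
  "v \<in> vspace V \<Longrightarrow> w \<in> vspace V \<Longrightarrow>
    class_sum G V f (v + w) = class_sum G V f v + class_sum G V f w"
  by (simp add: class_sum_def act_add V.scale_right_distrib sum.distrib)

lemma class_sum_scal:
  "v \<in> vspace V \<Longrightarrow> class_sum G V f (scal V c v) = scal V c (class_sum G V f v)"
  by (simp add: class_sum_def act_scal V.scale_sum_right mult.commute)

lemma class_sum_sum:
  assumes "\<And>i. i \<in> S \<Longrightarrow> v i \<in> vspace V"
  shows "class_sum G V f (sum v S) = (\<Sum>i\<in>S. class_sum G V f (v i))"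
  using assms
proof (induction S rule: infinite_finite_induct)
  case (insert x S)
  then show ?case
    using class_sum_add[of "v x" "sum v S"] sum_in[of S v] by simp
qed (auto simp: class_sum_def act_zero)

text \<open>A conjugation invariant function is a central element of the group algebra: h g = (h g
  h^-1) h, and g may be replaced by h g h^-1 in the sum.\<close>

lemma class_sum_act:
  assumes f: "conj_invariant G f" and h: "h \<in> carrier G" and v: "v \<in> vspace V"
  shows "class_sum G V f (act V h v) = act V h (class_sum G V f v)"
proof -
  have "act V h (class_sum G V f v) = (\<Sum>g\<in>carrier G. scal V (f g) (act V (h \<otimes> g) v))"
    using h v by (simp add: class_sum_def act_sum scal_in act_closed act_scal act_mult)
  also have "\<dots> = (\<Sum>g\<in>carrier G. scal V (f g) (act V (g \<otimes> h) v))"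
    by (rule sum.reindex_bij_witness[of _ "\<lambda>g. inv h \<otimes> g \<otimes> h" "\<lambda>g. h \<otimes> g \<otimes> inv h"])
      (use h f in \<open>auto simp: G.m_assoc[symmetric] conj_invariant_def\<close>,
       use h f in \<open>auto simp: G.m_assoc conj_invariant_def\<close>)
  also have "\<dots> = class_sum G V f (act V h v)"
    using h v by (simp add: class_sum_def act_mult)
  finally show ?thesis by simp
qed

lemma intertwiner_class_sum:
  assumes T: "intertwiner G V W T" and v: "v \<in> vspace V"
  shows "T (class_sum G V f v) = class_sum G W f (T v)"
  using v by (auto simp: class_sum_def intertwiner_sum[OF T] intertwinerD[OF T] act_closed scal_in)

end

text \<open>Subtracting an eigenvalue of one summand kills that summand, which gives an induction on the
  number of summands.\<close>

lemma (in group_rep) eigenspaces_independent: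
  assumes "finite S" and "\<And>i. i \<in> S \<Longrightarrow> a i \<in> vspace V"
    and "\<And>i z. i \<in> S \<Longrightarrow> class_sum G V (f z) (a i) = scal V (\<omega> i z) (a i)"
    and "\<And>i j. i \<in> S \<Longrightarrow> j \<in> S \<Longrightarrow> i \<noteq> j \<Longrightarrow> \<exists>z. \<omega> i z \<noteq> \<omega> j z"
    and "(\<Sum>i\<in>S. a i) = 0" and "i \<in> S"
  shows "a i = 0"
  using assms
proof (induction S arbitrary: a i rule: finite_induct)
  case (insert k S)
  have zero: "a j = 0" if j: "j \<in> S" for j
  proof -
    obtain z where z: "\<omega> j z \<noteq> \<omega> k z"
      using insert.prems(3)[of j k] j insert.hyps by auto
    define b where "b i = scal V (\<omega> i z - \<omega> k z) (a i)" for i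
    have "0 = class_sum G V (f z) (\<Sum>i\<in>insert k S. a i)"
      using insert.prems(4) by (simp add: class_sum_def act_zero)
    also have "\<dots> = (\<Sum>i\<in>insert k S. scal V (\<omega> i z) (a i))"
      using insert.prems(1,2) by (subst class_sum_sum) (auto intro!: sum.cong)
    also have "\<dots> = (\<Sum>i\<in>insert k S. scal V (\<omega> i z) (a i)) - scal V (\<omega> k z) (\<Sum>i\<in>insert k S. a i)"
      using insert.prems(4) by simp
    also have "\<dots> = (\<Sum>i\<in>insert k S. b i)"
      by (simp only: b_def V.scale_sum_right V.scale_left_diff_distrib sum_subtractf)
    also have "\<dots> = (\<Sum>i\<in>S. b i)"
      using insert.hyps by (simp add: b_def)
    finally have s: "(\<Sum>i\<in>S. b i) = 0" by simp
    have "b j = 0"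
      by (rule insert.IH[OF _ _ _ s j])
        (use insert.prems in \<open>auto simp: b_def scal_in class_sum_scal mult.commute\<close>)
    then show ?thesis using z by (simp add: b_def V.scale_eq_0_iff)
  qed
  moreover have "a k = 0" using insert.prems(4) insert.hyps zero by simp
  ultimately show ?case using insert.prems(5) by auto
qed simp

section \<open>Linear independence\<close>

interpretation fun_space: vector_space "\<lambda>(c::complex) (F::'b \<Rightarrow> complex) x. c * F x"
  by unfold_locales (auto simp: fun_eq_iff algebra_simps)

lemma sum_fun_apply: "(\<Sum>i\<in>S. F i) x = (\<Sum>i\<in>S. F i x)" for F :: "'i \<Rightarrow> 'b \<Rightarrow> complex"
  by (induction S rule: infinite_finite_induct) auto

text \<open>Evaluating a linear relation at \<open>x k\<close> isolates the coefficient of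
  \<open>m k\<close>. All bases below are functions with essentially disjoint supports, so this is
  the only independence test they need.\<close>

lemma independent_of_points:
  assumes fin: "finite K" and diag: "\<And>k. k \<in> K \<Longrightarrow> m k (x k) \<noteq> (0::complex)"
    and off: "\<And>k l. k \<in> K \<Longrightarrow> l \<in> K \<Longrightarrow> k \<noteq> l \<Longrightarrow> m k (x l) = 0"
  shows "fun_space.independent (m ` K)" and "card (m ` K) = card K"
proof -
  have inj: "inj_on m K"
    using diag off by (intro inj_onI) metis
  then show "card (m ` K) = card K" by (rule card_image)
  show "fun_space.independent (m ` K)"
  proof (rule fun_space.independent_if_scalars_zero)
    show "finite (m ` K)" using fin by simp
    fix f v assume "(\<Sum>v\<in>m ` K. (\<lambda>x. f v * v x)) = 0" and v: "v \<in> m ` K"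
    then have s: "(\<Sum>k\<in>K. (\<lambda>x. f (m k) * m k x)) = 0"
      by (simp add: sum.reindex[OF inj])
    obtain k where k: "k \<in> K" "v = m k" using v by auto
    have "0 = (\<Sum>l\<in>K. (\<lambda>x. f (m l) * m l x)) (x k)" using s by simp
    also have "\<dots> = (\<Sum>l\<in>K. f (m l) * m l (x k))"
      by (induction K rule: infinite_finite_induct) auto
    also have "\<dots> = (\<Sum>l\<in>K. if l = k then f (m k) * m k (x k) else 0)"
      using off k by (intro sum.cong) auto
    also have "\<dots> = f v * m k (x k)" using fin k by simp
    finally show "f v = 0" using diag[OF k(1)] by simp
  qed
qed

lemma (in vector_space) independent_Union_subspaces:
  assumes fin: "finite S" and A: "\<And>i. i \<in> S \<Longrightarrow> subspace (A i)"
    and indep: "\<And>a i. (\<And>i. i \<in> S \<Longrightarrow> a i \<in> A i) \<Longrightarrow> (\<Sum>i\<in>S. a i) = 0 \<Longrightarrow> i \<in> S \<Longrightarrow> a i = 0"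
    and B: "\<And>i. i \<in> S \<Longrightarrow> B i \<subseteq> A i" "\<And>i. i \<in> S \<Longrightarrow> finite (B i)"
      "\<And>i. i \<in> S \<Longrightarrow> independent (B i)"
  shows "independent (\<Union>i\<in>S. B i)" and "card (\<Union>i\<in>S. B i) = (\<Sum>i\<in>S. card (B i))"
proof -
  have disj: "B i \<inter> B j = {}" if ij: "i \<in> S" "j \<in> S" "i \<noteq> j" for i j
  proof (rule ccontr)
    assume "B i \<inter> B j \<noteq> {}"
    then obtain b where b: "b \<in> B i" "b \<in> B j" by auto
    \<comment> \<open>A common element b would give the relation b + (- b) = 0 between two different
      subspaces.\<close>
    define a where "a k = (if k = i then b else if k = j then - b else 0)" for k
    have "a i = 0"
    proof (rule indep)
      show "a k \<in> A k" if "k \<in> S" for k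
        using that ij B(1) b A[OF that] by (auto simp: a_def subspace_0 intro!: subspace_neg)
      have "(\<Sum>k\<in>S. a k) = (\<Sum>k\<in>{i, j}. a k)"
        using ij fin by (intro sum.mono_neutral_right) (auto simp: a_def)
      then show "(\<Sum>k\<in>S. a k) = 0" using ij by (simp add: a_def)
    qed (rule ij)
    then have "b = 0" by (simp add: a_def)
    then show False using b(1) B(3)[OF ij(1)] dependent_zero by auto
  qed
  then show "card (\<Union>i\<in>S. B i) = (\<Sum>i\<in>S. card (B i))"
    using fin B(2) by (intro card_UN_disjoint) auto
  show "independent (\<Union>i\<in>S. B i)"
  proof (rule independent_if_scalars_zero)
    show "finite (\<Union>i\<in>S. B i)" using fin B(2) by auto
    fix f v assume s: "(\<Sum>v\<in>(\<Union>i\<in>S. B i). f v *s v) = 0" and v: "v \<in> (\<Union>i\<in>S. B i)"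
    obtain i where i: "i \<in> S" "v \<in> B i" using v by auto
    have "(\<Sum>i\<in>S. \<Sum>v\<in>B i. f v *s v) = 0"
      using s disj fin B(2) by (subst (asm) sum.UNION_disjoint) auto
    then have "(\<Sum>v\<in>B i. f v *s v) = 0"
      by (rule indep[rotated]) (use i A B(1) in \<open>auto intro!: subspace_sum subspace_scale\<close>)
    then show "f v = 0" using independentD[OF B(3)[OF i(1)] B(2)[OF i(1)]] i(2) by auto
  qed
qed

lemma (in group_rep) independent_image:
  assumes W: "group_rep G W" and T: "intertwiner G V W T"
    and ker: "\<And>v. v \<in> vspace V \<Longrightarrow> T v = 0 \<Longrightarrow> v = 0"
    and B: "B \<subseteq> vspace V" "finite B" "V.independent B"
  shows "\<not> module.dependent (scal W) (T ` B)" and "card (T ` B) = card B"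
proof -
  interpret W: group_rep G W by fact
  have lin: "T (\<Sum>v\<in>B. scal V (f v) v) = (\<Sum>v\<in>B. scal W (f v) (T v))" for f
    using B(1) by (subst intertwiner_sum[OF T]) (auto intro!: scal_in sum.cong intertwinerD(3)[OF T])
  have z: "f v = 0" if "(\<Sum>v\<in>B. scal W (f v) (T v)) = 0" "v \<in> B" for f v
  proof -
    have "(\<Sum>v\<in>B. scal V (f v) v) = 0"
      using that(1) lin B(1) by (intro ker sum_in scal_in) auto
    then show ?thesis using V.independentD[OF B(3,2)] that(2) by auto
  qed
  have inj: "inj_on T B"
  proof (rule inj_onI, rule ccontr)
    fix v w assume vw: "v \<in> B" "w \<in> B" "T v = T w" "v \<noteq> w"
    define f where "f u = (if u = v then 1 else if u = w then - 1 else (0::complex))" for u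
    have "(\<Sum>u\<in>B. scal W (f u) (T u)) = (\<Sum>u\<in>{v, w}. scal W (f u) (T u))"
      using vw B(2) by (intro sum.mono_neutral_right) (auto simp: f_def)
    then have "(\<Sum>u\<in>B. scal W (f u) (T u)) = 0" using vw by (simp add: f_def)
    from z[OF this vw(1)] show False by (simp add: f_def)
  qed
  then show "card (T ` B) = card B" by (rule card_image)
  show "W.V.independent (T ` B)"
    using B(2) z[of "\<lambda>v. _ (T v)"]
    by (intro W.V.independent_if_scalars_zero) (auto simp: sum.reindex[OF inj])
qed

section \<open>Characters of finite groups\<close>

lemma (in group) sum_character_eq_0:
  assumes mult: "\<And>x y. x \<in> carrier G \<Longrightarrow> y \<in> carrier G \<Longrightarrow> \<theta> (x \<otimes> y) = \<theta> x * \<theta> y"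
    and h: "h \<in> carrier G" "\<theta> h \<noteq> (1::complex)"
  shows "(\<Sum>x\<in>carrier G. \<theta> x) = 0"
proof -
  have "(\<Sum>x\<in>carrier G. \<theta> x) = (\<Sum>x\<in>carrier G. \<theta> (h \<otimes> x))"
    by (rule sum.reindex_bij_witness[of _ "\<lambda>x. h \<otimes> x" "\<lambda>x. inv h \<otimes> x"])
      (use h in \<open>auto simp: m_assoc[symmetric]\<close>)
  also have "\<dots> = \<theta> h * (\<Sum>x\<in>carrier G. \<theta> x)"
    using h by (simp add: mult sum_distrib_left)
  finally show ?thesis using h(2) by (metis mult_cancel_right1 mult.commute)
qed

lemma charactersD_group:
  assumes "\<theta> \<in> characters G" "group G"
  shows "x \<in> carrier G \<Longrightarrow> \<theta> x \<noteq> 0"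
    and "x \<in> carrier G \<Longrightarrow> y \<in> carrier G \<Longrightarrow> \<theta> (x \<otimes>\<^bsub>G\<^esub> y) = \<theta> x * \<theta> y"
    and "\<theta> \<one>\<^bsub>G\<^esub> = 1" and "x \<notin> carrier G \<Longrightarrow> \<theta> x = 0"
    and "x \<in> carrier G \<Longrightarrow> \<theta> (inv\<^bsub>G\<^esub> x) = inverse (\<theta> x)"
    and "x \<in> carrier G \<Longrightarrow> \<theta> (x [^]\<^bsub>G\<^esub> (n::nat)) = \<theta> x ^ n"
proof -
  interpret group G by fact
  show nz: "x \<in> carrier G \<Longrightarrow> \<theta> x \<noteq> 0" for x
    using assms(1) by (auto simp: characters_def)
  show mult: "x \<in> carrier G \<Longrightarrow> y \<in> carrier G \<Longrightarrow> \<theta> (x \<otimes>\<^bsub>G\<^esub> y) = \<theta> x * \<theta> y" for x y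
    using assms(1) by (auto simp: characters_def)
  show "x \<notin> carrier G \<Longrightarrow> \<theta> x = 0"
    using assms(1) by (auto simp: characters_def)
  show one: "\<theta> \<one>\<^bsub>G\<^esub> = 1"
    using nz[of "\<one>\<^bsub>G\<^esub>"] mult[of "\<one>\<^bsub>G\<^esub>" "\<one>\<^bsub>G\<^esub>"] by simp
  show "\<theta> (inv\<^bsub>G\<^esub> x) = inverse (\<theta> x)" if "x \<in> carrier G"
    using mult[of x "inv\<^bsub>G\<^esub> x"] that one by (simp add: inverse_unique)
  show "\<theta> (x [^]\<^bsub>G\<^esub> (n::nat)) = \<theta> x ^ n" if "x \<in> carrier G"
    using that by (induction n) (auto simp: one mult)
qed

lemma character_eqI:
  assumes "\<theta> \<in> characters G" "\<theta>' \<in> characters G"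
    and "\<And>x. x \<in> carrier G \<Longrightarrow> \<theta> x = \<theta>' x"
  shows "\<theta> = \<theta>'"
  using assms by (auto simp: characters_def fun_eq_iff) metis

lemma (in group) sum_characters_div:
  assumes "\<theta> \<in> characters G" "\<theta>' \<in> characters G"
  shows "(\<Sum>x\<in>carrier G. \<theta> x / \<theta>' x) = (if \<theta> = \<theta>' then of_nat (Coset.order G) else 0)"
proof (cases "\<theta> = \<theta>'")
  case True
  then show ?thesis using charactersD_group(1)[OF assms(1) is_group]
    by (simp add: Coset.order_def)
next
  case False
  then obtain h where h: "h \<in> carrier G" "\<theta> h \<noteq> \<theta>' h"
    using character_eqI[OF assms] by blast
  have "(\<Sum>x\<in>carrier G. \<theta> x / \<theta>' x) = 0"
    by (rule sum_character_eq_0[of "\<lambda>x. \<theta> x / \<theta>' x" h])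
      (use h charactersD_group[OF assms(1) is_group] charactersD_group[OF assms(2) is_group] in auto)
  with False show ?thesis by simp
qed

text \<open>Dividing both sides by one of the characters and summing counts how often it occurs, in
  units of the group order.\<close>

lemma (in group) two_characters_sum_eq:
  assumes fin: "finite (carrier G)" and chars: "\<alpha> \<in> characters G" "\<beta> \<in> characters G"
      "\<gamma> \<in> characters G" "\<delta> \<in> characters G"
    and eq: "\<And>x. x \<in> carrier G \<Longrightarrow> \<alpha> x + \<beta> x = \<gamma> x + \<delta> x"
  shows "{\<alpha>, \<beta>} = {\<gamma>, \<delta>}"
proof -
  have n: "Coset.order G > 0" using fin by (simp add: order_gt_0_iff_finite)
  have mem: "\<gamma>' \<in> {\<alpha>', \<beta>'}"
    if c: "\<alpha>' \<in> characters G" "\<beta>' \<in> characters G" "\<gamma>' \<in> characters G" "\<delta>' \<in> characters G"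
      and e: "\<And>x. x \<in> carrier G \<Longrightarrow> \<alpha>' x + \<beta>' x = \<gamma>' x + \<delta>' x" for \<alpha>' \<beta>' \<gamma>' \<delta>'
  proof (rule ccontr)
    assume "\<gamma>' \<notin> {\<alpha>', \<beta>'}"
    \<comment> \<open>By orthogonality the left side contributes nothing, while \<gamma>' itself
      contributes the group order on the right and \<delta>' cannot cancel it.\<close>
    then have "0 = (\<Sum>x\<in>carrier G. \<alpha>' x / \<gamma>' x) + (\<Sum>x\<in>carrier G. \<beta>' x / \<gamma>' x)"
      unfolding sum_characters_div[OF c(1,3)] sum_characters_div[OF c(2,3)] by auto
    also have "\<dots> = (\<Sum>x\<in>carrier G. \<gamma>' x / \<gamma>' x) + (\<Sum>x\<in>carrier G. \<delta>' x / \<gamma>' x)"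
      unfolding sum.distrib[symmetric] add_divide_distrib[symmetric] using e by simp
    also have "\<dots> = of_nat (Coset.order G + (if \<delta>' = \<gamma>' then Coset.order G else 0))"
      unfolding sum_characters_div[OF c(3,3)] sum_characters_div[OF c(4,3)] by simp
    finally show False using n by (simp del: of_nat_add)
  qed
  have "\<gamma> \<in> {\<alpha>, \<beta>}" by (rule mem[OF chars(1,2,3,4) eq])
  moreover have "\<delta> \<in> {\<alpha>, \<beta>}"
    by (rule mem[OF chars(1,2,4,3)]) (metis eq add.commute)
  moreover have "\<alpha> \<in> {\<gamma>, \<delta>}" by (rule mem[OF chars(3,4,1,2)]) (simp add: eq)
  moreover have "\<beta> \<in> {\<gamma>, \<delta>}"
    by (rule mem[OF chars(3,4,2,1)]) (metis eq add.commute)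
  ultimately show ?thesis by auto
qed

lemma (in group) ord_generator:
  assumes fin: "finite (carrier G)" and g: "g \<in> carrier G"
    and gen: "\<And>x. x \<in> carrier G \<Longrightarrow> \<exists>k::nat. x = g [^] k"
  shows "ord g = Coset.order G"
proof -
  have "carrier G \<subseteq> generate G {g}"
    using gen generate_pow_nat[OF g] ord_ge_1[OF fin g] by fastforce
  then have "generate G {g} = carrier G"
    using generate_incl[of "{g}"] g by auto
  then show ?thesis using generate_pow_card[OF g] by (simp add: Coset.order_def)
qed

text \<open>The value at g^k has to be \<zeta>^k. This is well defined since exponents of the same
  element differ by a multiple of the order of g, which is the group order, and \<zeta> is a root of
  unity of that order.\<close>

lemma (in group) cyclic_character_exists:
  assumes fin: "finite (carrier G)" and g: "g \<in> carrier G"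
    and gen: "\<And>x. x \<in> carrier G \<Longrightarrow> \<exists>k::nat. x = g [^] k" and \<zeta>: "\<zeta> ^ Coset.order G = (1::complex)"
  shows "\<exists>\<theta>\<in>characters G. \<theta> g = \<zeta>"
proof -
  note ord = ord_generator[OF fin g gen]
  have n: "Coset.order G > 0" using fin by (simp add: order_gt_0_iff_finite)
  have \<zeta>0: "\<zeta> \<noteq> 0" using \<zeta> n by (auto simp: power_0_left)
  have wd: "\<zeta> ^ k = \<zeta> ^ l" if eq: "g [^] k = g [^] l" for k l :: nat
  proof -
    have le: "\<zeta> ^ (k + d) = \<zeta> ^ k" if kd: "g [^] k = g [^] (k + d)" for k d :: nat
    proof -
      have "g [^] k = g [^] k \<otimes> g [^] d" by (simp only: nat_pow_mult[OF g]) (rule kd)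
      then have "g [^] d = \<one>" using g l_cancel_one'[of "g [^] k" "g [^] d"] by simp
      then obtain m where "d = Coset.order G * m" using pow_eq_id[OF g, of d] ord by (auto simp: dvd_def)
      then have "\<zeta> ^ d = 1" by (simp only: power_mult \<zeta> power_one)
      then show ?thesis by (simp only: power_add mult_1_right)
    qed
    show ?thesis
    proof (cases "k \<le> l")
      case True
      then obtain d where d: "l = k + d" by (auto simp: le_iff_add)
      from le[OF eq[unfolded d]] show ?thesis unfolding d by (rule sym)
    next
      case False
      then obtain d where d: "k = l + d" by (metis nat_le_linear le_iff_add)
      from le[OF eq[symmetric, unfolded d]] show ?thesis unfolding d .
    qed
  qed
  define \<theta> where "\<theta> x = (if x \<in> carrier G then \<zeta> ^ (SOME k::nat. x = g [^] k) else 0)" for x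
  have \<theta>: "\<theta> (g [^] k) = \<zeta> ^ k" for k :: nat
  proof -
    have "g [^] k = g [^] (SOME l::nat. g [^] k = g [^] l)" by (rule someI) simp
    from wd[OF this] show ?thesis using g by (simp add: \<theta>_def)
  qed
  have "\<theta> (x \<otimes> y) = \<theta> x * \<theta> y" if xy: "x \<in> carrier G" "y \<in> carrier G" for x y
  proof -
    obtain k l :: nat where "x = g [^] k" "y = g [^] l" using gen xy by metis
    then show ?thesis using g by (simp add: nat_pow_mult \<theta> power_add)
  qed
  then have "\<theta> \<in> characters G" using \<zeta>0 by (auto simp: characters_def \<theta>_def)
  moreover have "\<theta> g = \<zeta>" using \<theta>[of 1] g by simp
  ultimately show ?thesis by blast
qed

section \<open>The quadratic extension\<close>

declare Multiplicative_Group.mult_of_simps [simp del]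

lemma mult_grp_Fq:
  "carrier (mult_grp (Fq :: 'a::field ring)) = UNIV - {0}"
  "x \<otimes>\<^bsub>mult_grp (Fq :: 'a::field ring)\<^esub> y = x * y"
  "\<one>\<^bsub>mult_grp (Fq :: 'a::field ring)\<^esub> = 1"
  by (auto simp: ring_of_type_algebra_def Multiplicative_Group.mult_of_simps)

lemma group_mult_Fq: "group (mult_grp (Fq :: 'a::field ring))"
  using field.field_mult_group[OF field_from_type_algebra] .

lemma pow_mult_Fq: "x [^]\<^bsub>mult_grp (Fq :: 'a::field ring)\<^esub> (n::nat) = x ^ n"
  by (induction n) (simp_all add: nat_pow_def mult_grp_Fq mult.commute)

lemma conjg_conjg [simp]: "conjg (conjg w) = w"
  by (simp add: conjg_def)

lemma conjg_simp [simp]: "conjg (a, b) = (a, - b)"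
  by (simp add: conjg_def)

lemma card_ge_2: "CARD('a::{field,finite}) \<ge> 2"
proof -
  have "card {0, 1 :: 'a} \<le> CARD('a)" by (rule card_mono) auto
  then show ?thesis by simp
qed

locale quad_ext =
  fixes \<eta> :: "'a::{field,finite}"
  assumes odd_card: "odd CARD('a)" and \<eta>_nz: "\<eta> \<noteq> 0"
    and gen: "generate (mult_grp Fq) {\<eta>} = carrier (mult_grp Fq)"
begin

abbreviation qm :: "'a \<times> 'a \<Rightarrow> 'a \<times> 'a \<Rightarrow> 'a \<times> 'a" (infixl "\<star>" 70) where
  "w \<star> v \<equiv> w \<otimes>\<^bsub>Fq2 \<eta>\<^esub> v"

abbreviation "Lx \<equiv> mult_grp (Fq2 \<eta>)"

definition qinv :: "'a \<times> 'a \<Rightarrow> 'a \<times> 'a" where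
  "qinv w = (fst w / nrm \<eta> w, - snd w / nrm \<eta> w)"

lemma qm_simp [simp]: "(a, b) \<star> (c, d) = (a * c + \<eta> * b * d, a * d + b * c)"
  by (simp add: Fq2_def)

lemma nrm_simp: "nrm \<eta> (a, b) = a\<^sup>2 - \<eta> * b\<^sup>2"
  by (simp add: nrm_def power2_eq_square)

lemma trc_simp: "trc \<eta> (a, b) = 2 * a"
  by (simp add: trc_def Fq2_def)

text \<open>The order of the additive group annihilates 1, and it is odd, so 2 = 0 would give 1 =
  0.\<close>

lemma two_nz: "(2::'a) \<noteq> 0"
proof
  assume "(2::'a) = 0"
  interpret A: Group.group "add_monoid (Fq :: 'a ring)"
    using abelian_group.a_group[OF ring.is_abelian_group[OF ring_from_type_algebra]] .
  have "(1::'a) [^]\<^bsub>add_monoid (Fq :: 'a ring)\<^esub> Coset.order (add_monoid (Fq :: 'a ring)) = 0"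
    using A.pow_order_eq_1[of 1] by (simp add: ring_of_type_algebra_def)
  moreover have "(1::'a) [^]\<^bsub>add_monoid (Fq :: 'a ring)\<^esub> n = of_nat n" for n :: nat
    by (induction n) (simp_all add: nat_pow_def ring_of_type_algebra_def add.commute)
  ultimately have "of_nat CARD('a) = (0::'a)"
    by (simp add: Coset.order_def ring_of_type_algebra_def)
  moreover obtain k where "CARD('a) = 2 * k + 1" using odd_card by (elim oddE)
  ultimately show False using \<open>(2::'a) = 0\<close> by simp
qed

text \<open>If \<eta> = c^2, then \<eta>^((q - 1) / 2) = c^(q - 1) = 1, whereas a generator has
  order q - 1.\<close>

lemma nonsquare: "c\<^sup>2 \<noteq> \<eta>"
proof
  assume c: "c\<^sup>2 = \<eta>"
  interpret F: Group.group "mult_grp (Fq :: 'a ring)" by (rule group_mult_Fq)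
  have c0: "c \<noteq> 0" using c \<eta>_nz by auto
  obtain k where k: "CARD('a) = 2 * k + 1" using odd_card by (elim oddE)
  have "F.ord \<eta> = 2 * k"
    using F.generate_pow_card[of \<eta>] \<eta>_nz gen k by (simp add: mult_grp_Fq card_Diff_singleton)
  moreover have "\<eta> ^ k = 1"
  proof -
    have "c ^ (2 * k) = 1"
      using F.pow_order_eq_1[of c] c0 k
      by (simp add: mult_grp_Fq pow_mult_Fq Coset.order_def card_Diff_singleton)
    then show ?thesis using c by (simp add: power_mult)
  qed
  then have "F.ord \<eta> dvd k"
    using F.pow_eq_id[of \<eta> k] \<eta>_nz by (simp add: mult_grp_Fq pow_mult_Fq)
  moreover have "k > 0" using k card_ge_2[where 'a='a] by auto
  ultimately show False by (auto dest: dvd_imp_le)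
qed

lemma nrm_eq_0: "nrm \<eta> w = 0 \<longleftrightarrow> w = (0, 0)"
proof (cases w)
  case (Pair a b)
  show ?thesis
  proof
    assume "nrm \<eta> w = 0"
    then have e: "a\<^sup>2 = \<eta> * b\<^sup>2" by (simp add: Pair nrm_simp)
    have "b = 0"
    proof (rule ccontr)
      assume "b \<noteq> 0"
      then have "(a / b)\<^sup>2 = \<eta>" using e by (simp add: power_divide)
      then show False using nonsquare by blast
    qed
    then show "w = (0, 0)" using e Pair by simp
  qed (simp add: nrm_simp)
qed

lemma qm_assoc: "u \<star> v \<star> w = u \<star> (v \<star> w)"
  by (cases u; cases v; cases w) (simp add: algebra_simps)

lemma qm_comm: "u \<star> v = v \<star> u"
  by (cases u; cases v) (simp add: algebra_simps)

lemma qm_one [simp]: "(1, 0) \<star> w = w" "w \<star> (1, 0) = w"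
  by (cases w; simp)+

lemma nrm_mult: "nrm \<eta> (u \<star> v) = nrm \<eta> u * nrm \<eta> v"
  by (cases u; cases v) (simp add: nrm_simp power2_eq_square algebra_simps)

lemma nrm_conjg: "nrm \<eta> (conjg w) = nrm \<eta> w"
  by (cases w) (simp add: nrm_simp)

lemma trc_conjg: "trc \<eta> (conjg w) = trc \<eta> w"
  by (cases w) (simp add: trc_simp)

lemma conjg_mult: "conjg (u \<star> v) = conjg u \<star> conjg v"
  by (cases u; cases v) simp

lemma qm_conjg: "w \<star> conjg w = (nrm \<eta> w, 0)"
  by (cases w) (simp add: nrm_simp power2_eq_square)

lemma qm_qinv: "w \<noteq> (0, 0) \<Longrightarrow> w \<star> qinv w = (1, 0)"
proof (cases w)
  case (Pair a b)
  assume "w \<noteq> (0, 0)"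
  then have n: "nrm \<eta> w \<noteq> 0" by (simp add: nrm_eq_0)
  have "w \<star> qinv w = ((a * a - \<eta> * b * b) / nrm \<eta> w, 0)"
    by (simp add: Pair qinv_def diff_divide_distrib)
  also have "a * a - \<eta> * b * b = nrm \<eta> w" by (simp add: Pair nrm_simp power2_eq_square)
  finally show ?thesis using n by simp
qed

lemma qm_eq_0: "u \<star> v = (0, 0) \<longleftrightarrow> u = (0, 0) \<or> v = (0, 0)"
  using nrm_mult[of u v] nrm_eq_0[of u] nrm_eq_0[of v] nrm_eq_0[of "u \<star> v"] by auto

lemma conjg_eq_0: "conjg w = (0, 0) \<longleftrightarrow> w = (0, 0)"
  by (cases w) simp

lemma qinv_eq_0: "w \<noteq> (0, 0) \<Longrightarrow> qinv w \<noteq> (0, 0)"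
  using qm_qinv[of w] qm_eq_0[of w "qinv w"] by auto

lemma nrm_qinv: "w \<noteq> (0, 0) \<Longrightarrow> nrm \<eta> (qinv w) = inverse (nrm \<eta> w)"
  using nrm_mult[of w "qinv w"] by (simp add: qm_qinv nrm_simp inverse_unique)

lemma field_Fq2: "field (Fq2 \<eta>)"
proof (rule cring.cring_fieldI)
  have inv: "\<exists>y. y \<star> x = (1, 0)" if "x \<noteq> (0, 0)" for x
    using qm_qinv[OF that] qm_comm by metis
  show "cring (Fq2 \<eta>)"
  proof (rule cringI)
    show "abelian_group (Fq2 \<eta>)"
    proof (rule abelian_groupI)
      show "\<exists>y\<in>carrier (Fq2 \<eta>). y \<oplus>\<^bsub>Fq2 \<eta>\<^esub> x = \<zero>\<^bsub>Fq2 \<eta>\<^esub>" if "x \<in> carrier (Fq2 \<eta>)" for x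
        by (intro bexI[of _ "- x"]) (auto simp: Fq2_def zero_prod_def[symmetric])
    qed (auto simp: Fq2_def algebra_simps zero_prod_def)
    show "Group.comm_monoid (Fq2 \<eta>)"
    proof (rule comm_monoidI)
      show "x \<star> y \<star> z = x \<star> (y \<star> z)" for x y z by (rule qm_assoc)
      show "x \<star> y = y \<star> x" for x y by (rule qm_comm)
    qed (auto simp: Fq2_def)
    show "(x \<oplus>\<^bsub>Fq2 \<eta>\<^esub> y) \<star> z = x \<star> z \<oplus>\<^bsub>Fq2 \<eta>\<^esub> y \<star> z" for x y z
      by (cases x; cases y; cases z) (simp add: Fq2_def algebra_simps)
  qed
  show "Units (Fq2 \<eta>) = carrier (Fq2 \<eta>) - {\<zero>\<^bsub>Fq2 \<eta>\<^esub>}"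
  proof -
    have one: "\<one>\<^bsub>Fq2 \<eta>\<^esub> = (1, 0)" and zero: "\<zero>\<^bsub>Fq2 \<eta>\<^esub> = (0, 0)" and c: "carrier (Fq2 \<eta>) = UNIV"
      by (simp_all add: Fq2_def)
    show ?thesis
      unfolding Units_def one zero c
      using inv qm_comm by (auto simp del: qm_simp) (metis qm_eq_0 prod.inject zero_neq_one)+
  qed
qed

lemma group_Lx: "group Lx"
  using field.field_mult_group[OF field_Fq2] .

sublocale L: Group.group Lx by (rule group_Lx)

lemma carrier_Lx: "carrier Lx = UNIV - {(0, 0)}" and one_Lx: "\<one>\<^bsub>Lx\<^esub> = (1, 0)"
  and mult_Lx: "u \<otimes>\<^bsub>Lx\<^esub> v = u \<star> v"
  by (auto simp: Fq2_def Multiplicative_Group.mult_of_simps)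

lemma order_Lx: "Coset.order Lx = (CARD('a) - 1) * (CARD('a) + 1)"
proof -
  have "Coset.order Lx = CARD('a) * CARD('a) - 1"
    by (simp add: Coset.order_def carrier_Lx card_Diff_singleton)
  then show ?thesis by (simp add: algebra_simps)
qed

lemma pow_Lx: "(x, 0) [^]\<^bsub>Lx\<^esub> (n::nat) = (x ^ n, 0)"
  by (induction n) (simp_all add: nat_pow_def one_Lx mult_Lx mult.commute)

lemma inv_Lx: "w \<noteq> (0, 0) \<Longrightarrow> inv\<^bsub>Lx\<^esub> w = qinv w"
  using qm_qinv[of w] qinv_eq_0[of w] qm_comm[of w "qinv w"]
  by (intro L.inv_equality) (simp_all add: carrier_Lx one_Lx mult_Lx)

text \<open>The conic \<open>a\<^sup>2 - \<eta> b\<^sup>2 = 1\<close> is parametrised by the slopes of the lines through \<open>(1, 0)\<close>.\<close>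

lemma card_norm_one: "card {t. nrm \<eta> t = 1} = CARD('a) + 1"
proof -
  let ?K = "{t. nrm \<eta> t = 1}"
  \<comment> \<open>The parameter m is \<eta> times the slope, and \<open>f m\<close> is the second
    intersection with the conic; its denominator never vanishes because \<eta> is not a square. The
    vertical line is the tangent at (1, 0), which is why exactly this point is left out.\<close>
  define f where "f m = ((m\<^sup>2 + \<eta>) / (m\<^sup>2 - \<eta>), 2 * m / (m\<^sup>2 - \<eta>))" for m
  define h where "h t = \<eta> * snd t / (fst t - 1)" for t :: "'a \<times> 'a"
  have d: "m\<^sup>2 - \<eta> \<noteq> 0" for m using nonsquare[of m] by simp
  have "bij_betw f UNIV (?K - {(1, 0)})"
  proof (rule bij_betw_byWitness[where f' = h])
    show "\<forall>m\<in>UNIV. h (f m) = m"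
    proof
      fix m
      have "fst (f m) - 1 = 2 * \<eta> / (m\<^sup>2 - \<eta>)"
        using d[of m] by (simp add: f_def field_simps)
      then show "h (f m) = m"
        using d[of m] two_nz \<eta>_nz by (simp add: h_def f_def)
    qed
    show "f ` UNIV \<subseteq> ?K - {(1, 0)}"
    proof -
      have "nrm \<eta> (f m) = 1" for m
      proof -
        have "nrm \<eta> (f m) = ((m\<^sup>2 + \<eta>)\<^sup>2 - \<eta> * (2 * m)\<^sup>2) / (m\<^sup>2 - \<eta>)\<^sup>2"
          by (simp add: f_def nrm_simp power_divide diff_divide_distrib)
        also have "(m\<^sup>2 + \<eta>)\<^sup>2 - \<eta> * (2 * m)\<^sup>2 = (m\<^sup>2 - \<eta>)\<^sup>2"
          by (simp add: power2_eq_square algebra_simps)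
        finally show ?thesis using d[of m] by simp
      qed
      moreover have "f m \<noteq> (1, 0)" for m
      proof
        assume "f m = (1, 0)"
        then have e: "m\<^sup>2 + \<eta> = m\<^sup>2 - \<eta>" using d[of m] by (simp add: f_def)
        have "2 * \<eta> = (m\<^sup>2 + \<eta>) - (m\<^sup>2 - \<eta>)" by simp
        also have "\<dots> = 0" unfolding e by (rule diff_self)
        finally have "2 * \<eta> = 0" .
        then show False using two_nz \<eta>_nz by simp
      qed
      ultimately show ?thesis by (simp add: image_subset_iff)
    qed
    have x1: "fst t \<noteq> 1" if "t \<in> ?K - {(1, 0)}" for t
      using that \<eta>_nz by (cases t) (auto simp: nrm_simp)
    show "\<forall>t\<in>?K - {(1, 0)}. f (h t) = t"
    proof
      fix t assume t: "t \<in> ?K - {(1, 0)}"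
      obtain x y where xy: "t = (x, y)" by (cases t)
      have x: "x - 1 \<noteq> 0" using x1[OF t] xy by simp
      have e: "\<eta> * y\<^sup>2 = (x - 1) * (x + 1)"
        using t xy by (simp add: nrm_simp power2_eq_square algebra_simps)
      have "(h t)\<^sup>2 = \<eta> * (\<eta> * y\<^sup>2) / (x - 1)\<^sup>2"
        by (simp add: h_def xy power_divide power_mult_distrib power2_eq_square)
      also have "\<dots> = \<eta> * (x + 1) / (x - 1)"
        unfolding e using x by (simp add: power2_eq_square)
      finally have s: "(h t)\<^sup>2 = \<eta> * (x + 1) / (x - 1)" .
      have "(h t)\<^sup>2 - \<eta> = 2 * \<eta> / (x - 1)" "(h t)\<^sup>2 + \<eta> = 2 * \<eta> * x / (x - 1)"
        unfolding s using x by (simp_all add: field_simps)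
      then show "f (h t) = t"
        using x two_nz \<eta>_nz by (simp add: f_def xy) (simp add: h_def)
    qed
    show "h ` (?K - {(1, 0)}) \<subseteq> UNIV" by simp
  qed
  then have "card (?K - {(1, 0)}) = CARD('a)" by (simp add: bij_betw_same_card)
  moreover have "(1, 0) \<in> ?K" by (simp add: nrm_simp)
  ultimately show ?thesis
    by (metis Suc_eq_plus1 card.remove finite)
qed

lemma bij_norm_fibre:
  assumes "w \<noteq> (0, 0)"
  shows "bij_betw (\<lambda>t. t \<star> w) {t. nrm \<eta> t = x} {u. nrm \<eta> u = x * nrm \<eta> w}"
proof (rule bij_betw_byWitness[where f' = "\<lambda>u. u \<star> qinv w"])
  have n: "nrm \<eta> w \<noteq> 0" using assms nrm_eq_0 by simp
  show "\<forall>t\<in>{t. nrm \<eta> t = x}. t \<star> w \<star> qinv w = t"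
    using assms by (simp add: qm_assoc qm_qinv)
  show "\<forall>u\<in>{u. nrm \<eta> u = x * nrm \<eta> w}. u \<star> qinv w \<star> w = u"
    using assms by (simp add: qm_assoc qm_qinv qm_comm[of "qinv w"])
  show "(\<lambda>u. u \<star> qinv w) ` {u. nrm \<eta> u = x * nrm \<eta> w} \<subseteq> {t. nrm \<eta> t = x}"
    using assms n by (auto simp: nrm_mult nrm_qinv)
qed (auto simp: nrm_mult)

text \<open>A nonempty fibre over a nonzero value is a translate of the norm one group, so every
  fibre has at most q + 1 elements. The q - 1 fibres together exhaust (q - 1) (q + 1) elements,
  hence none can be smaller, and in particular none is empty.\<close>

lemma norm_fibre:
  assumes "x \<noteq> 0"
  shows card_norm_fibre: "card {w. nrm \<eta> w = x} = CARD('a) + 1" and norm_surj: "\<exists>w. nrm \<eta> w = x"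
proof -
  let ?q = "CARD('a)"
  have le: "card {w. nrm \<eta> w = y} \<le> ?q + 1" for y
  proof (cases "y \<noteq> 0 \<and> (\<exists>w. nrm \<eta> w = y)")
    case True
    then obtain w where w: "nrm \<eta> w = y" "w \<noteq> (0, 0)" using nrm_eq_0 by auto
    show ?thesis
      using bij_betw_same_card[OF bij_norm_fibre[OF w(2), of 1]] w(1) card_norm_one by simp
  next
    case False
    then have "{w. nrm \<eta> w = y} \<subseteq> {(0, 0)}" using nrm_eq_0 by auto
    then have "card {w. nrm \<eta> w = y} \<le> card {(0::'a, 0::'a)}" by (intro card_mono) auto
    then show ?thesis by simp
  qed
  have "(\<Sum>y\<in>UNIV - {0}. card {w. nrm \<eta> w = y}) = card (\<Union>y\<in>UNIV - {0}. {w. nrm \<eta> w = y})"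
    by (rule card_UN_disjoint[symmetric]) auto
  also have "(\<Union>y\<in>UNIV - {0}. {w. nrm \<eta> w = y}) = UNIV - {(0, 0)}"
    using nrm_eq_0 by auto
  also have "card \<dots> = (?q - 1) * (?q + 1)"
    using order_Lx by (simp only: Coset.order_def carrier_Lx)
  finally have s: "(\<Sum>y\<in>UNIV - {0}. card {w. nrm \<eta> w = y}) = (?q - 1) * (?q + 1)" .
  show c: "card {w. nrm \<eta> w = x} = ?q + 1"
  proof (rule ccontr)
    assume "card {w. nrm \<eta> w = x} \<noteq> ?q + 1"
    then have "card {w. nrm \<eta> w = x} < ?q + 1" using le[of x] by simp
    then have "(\<Sum>y\<in>UNIV - {0}. card {w. nrm \<eta> w = y}) < (\<Sum>y\<in>UNIV - {0::'a}. ?q + 1)"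
      using assms le by (intro sum_strict_mono_ex1) auto
    then show False using s by (simp add: card_Diff_singleton)
  qed
  then have "{w. nrm \<eta> w = x} \<noteq> {}" by (metis card.empty add_is_0 zero_neq_one)
  then show "\<exists>w. nrm \<eta> w = x" by blast
qed

section \<open>Characters of the quadratic extension and indecomposability\<close>

lemma charL:
  assumes "\<nu> \<in> characters Lx"
  shows "w \<noteq> (0, 0) \<Longrightarrow> \<nu> w \<noteq> 0" and "\<nu> (0, 0) = 0" and "\<nu> (1, 0) = 1"
    and "\<nu> (u \<star> v) = \<nu> u * \<nu> v"
    and "w \<noteq> (0, 0) \<Longrightarrow> \<nu> (qinv w) = inverse (\<nu> w)"
proof -
  note c = charactersD_group[OF assms group_Lx]
  note [simp del] = qm_simp
  show "w \<noteq> (0, 0) \<Longrightarrow> \<nu> w \<noteq> 0" using c(1)[of w] by (simp add: carrier_Lx)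
  show z: "\<nu> (0, 0) = 0" using c(4)[of "(0, 0)"] by (simp add: carrier_Lx)
  show "\<nu> (1, 0) = 1" using c(3) by (simp add: one_Lx)
  show "\<nu> (u \<star> v) = \<nu> u * \<nu> v"
    using c(2)[of u v] z qm_eq_0[of u v]
    by (cases "u = (0, 0) \<or> v = (0, 0)") (auto simp: carrier_Lx mult_Lx)
  show "w \<noteq> (0, 0) \<Longrightarrow> \<nu> (qinv w) = inverse (\<nu> w)"
    using c(5)[of w] by (simp add: carrier_Lx inv_Lx)
qed

lemma bar_character:
  assumes "\<nu> \<in> characters Lx" shows "bar \<nu> \<in> characters Lx"
  unfolding characters_def
proof (safe)
  note c = charL[OF assms]
  show False if "x \<in> carrier Lx" "bar \<nu> x = 0" for x
    using that c(1)[of "conjg x"] conjg_eq_0[of x] by (auto simp: bar_def carrier_Lx)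
  show "bar \<nu> (x \<otimes>\<^bsub>Lx\<^esub> y) = bar \<nu> x * bar \<nu> y" for x y
    by (simp add: bar_def mult_Lx conjg_mult c(4))
  show "bar \<nu> x = 0" if "x \<notin> carrier Lx" for x
    using that c(2) by (auto simp: bar_def carrier_Lx)
qed

lemma bar_bar [simp]: "bar (bar \<nu>) = \<nu>"
  by (simp add: bar_def)

lemma bar_indecomposable:
  assumes "\<nu> \<in> indecomposables \<eta>" shows "bar \<nu> \<in> indecomposables \<eta>"
proof -
  have "decomposable \<eta> \<nu>" if dec: "decomposable \<eta> (bar \<nu>)"
  proof -
    obtain \<psi> where \<psi>: "\<psi> \<in> characters (mult_grp Fq)"
      "\<And>w. w \<in> carrier Lx \<Longrightarrow> bar \<nu> w = \<psi> (nrm \<eta> w)"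
      using dec unfolding decomposable_def by blast
    have "\<nu> w = \<psi> (nrm \<eta> w)" if "w \<in> carrier Lx" for w
      using \<psi>(2)[of "conjg w"] that conjg_eq_0[of w] by (simp add: carrier_Lx bar_def nrm_conjg)
    then show ?thesis using \<psi>(1) by (auto simp: decomposable_def)
  qed
  then show ?thesis using assms bar_character by (auto simp: indecomposables_def)
qed

lemma sharp_bar: "sharp (bar \<nu>) = sharp \<nu>"
  by (simp add: sharp_def bar_def)

text \<open>Since the norm is surjective, a character that is trivial on its kernel factors through it.\<close>

lemma indecomposable_norm_one:
  assumes "\<nu> \<in> indecomposables \<eta>"
  shows "\<exists>t. nrm \<eta> t = 1 \<and> \<nu> t \<noteq> 1"
proof (rule ccontr)
  assume "\<not> ?thesis"
  then have triv: "\<nu> t = 1" if "nrm \<eta> t = 1" for t using that by blast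
  have \<nu>: "\<nu> \<in> characters Lx" and nd: "\<not> decomposable \<eta> \<nu>"
    using assms by (auto simp: indecomposables_def)
  note c = charL[OF \<nu>]
  have same: "\<nu> u = \<nu> w" if "nrm \<eta> u = nrm \<eta> w" "w \<noteq> (0, 0)" for u w
  proof -
    have "nrm \<eta> w \<noteq> 0" using that(2) nrm_eq_0 by simp
    then have "nrm \<eta> (u \<star> qinv w) = 1" using that by (simp add: nrm_mult nrm_qinv)
    from triv[OF this] have "\<nu> u * inverse (\<nu> w) = 1" using c(5)[OF that(2)] by (simp add: c(4))
    then show ?thesis using c(1)[OF that(2)] by (simp add: field_simps)
  qed
  \<comment> \<open>A section of the norm; by \<open>same\<close> the value of \<nu> does not depend
    on it. Since only (0, 0) has norm 0, the resulting \<psi> vanishes at 0, as the convention for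
    characters demands.\<close>
  define s where "s x = (SOME w. nrm \<eta> w = x)" for x
  define \<psi> where "\<psi> x = \<nu> (s x)" for x
  have s: "nrm \<eta> (s x) = x" for x
  proof -
    have "\<exists>w. nrm \<eta> w = x"
      using norm_surj[of x] nrm_eq_0[of "(0, 0)"] by (cases "x = 0") auto
    then show ?thesis unfolding s_def by (rule someI_ex)
  qed
  then have s0: "s x = (0, 0) \<longleftrightarrow> x = 0" for x
    using nrm_eq_0[of "s x"] by simp
  have "\<psi> (x * y) = \<psi> x * \<psi> y" if "x \<noteq> 0" "y \<noteq> 0" for x y
  proof -
    have "\<nu> (s (x * y)) = \<nu> (s x \<star> s y)"
      by (rule same) (simp_all add: that s0 s nrm_mult qm_eq_0)
    then show ?thesis by (simp add: \<psi>_def c(4))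
  qed
  moreover have "\<psi> 0 = 0" "x \<noteq> 0 \<Longrightarrow> \<psi> x \<noteq> 0" for x
    using s0[of 0] s0[of x] c(1)[of "s x"] c(2) by (simp_all add: \<psi>_def)
  ultimately have "\<psi> \<in> characters (mult_grp Fq)"
    by (simp add: characters_def mult_grp_Fq)
  moreover have "\<nu> w = \<psi> (nrm \<eta> w)" if "w \<noteq> (0, 0)" for w
    unfolding \<psi>_def by (rule same[symmetric]) (simp_all add: s that)
  ultimately have "decomposable \<eta> \<nu>"
    unfolding decomposable_def carrier_Lx by blast
  then show False using nd by blast
qed

text \<open>Multiplication by a norm one t with \<nu> t different from 1 permutes the fibre and
  multiplies the sum by \<nu> t. This vanishing is how indecomposability enters the theory of the
  cuspidal representations.\<close>

lemma sum_norm_fibre: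
  assumes "\<nu> \<in> indecomposables \<eta>"
  shows "(\<Sum>t | nrm \<eta> t = x. \<nu> t) = 0"
proof (cases "x = 0")
  case True
  have "\<nu> \<in> characters Lx" using assms by (auto simp: indecomposables_def)
  from charL(2)[OF this] show ?thesis by (simp add: True nrm_eq_0)
next
  case False
  obtain t where t: "nrm \<eta> t = 1" "\<nu> t \<noteq> 1" using indecomposable_norm_one[OF assms] by auto
  have t0: "t \<noteq> (0, 0)" using t nrm_eq_0[of t] by auto
  have \<nu>: "\<nu> \<in> characters Lx" using assms by (auto simp: indecomposables_def)
  have "(\<Sum>u | nrm \<eta> u = x. \<nu> u) * \<nu> t = (\<Sum>u | nrm \<eta> u = x. \<nu> (u \<star> t))"
    by (simp only: charL(4)[OF \<nu>] sum_distrib_right)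
  also have "\<dots> = (\<Sum>u | nrm \<eta> u = x * nrm \<eta> t. \<nu> u)"
    by (rule sum.reindex_bij_betw[OF bij_norm_fibre[OF t0]])
  also have "\<dots> = (\<Sum>u | nrm \<eta> u = x. \<nu> u) * 1"
    by (simp only: t(1) mult_1_right)
  finally show ?thesis using t(2) unfolding mult_cancel_left by blast
qed

end

section \<open>Two by two matrices\<close>

definition m2 :: "'a::field \<Rightarrow> 'a \<Rightarrow> 'a \<Rightarrow> 'a \<Rightarrow> 'a^2^2" where
  "m2 a b c d = vector [vector [a, b], vector [c, d]]"

lemma m2_nth [simp]:
  "m2 a b c d $ 1 $ 1 = a" "m2 a b c d $ 1 $ 2 = b"
  "m2 a b c d $ 2 $ 1 = c" "m2 a b c d $ 2 $ 2 = d"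
  by (simp_all add: m2_def)

lemma m2_eta: "m2 (g $ 1 $ 1) (g $ 1 $ 2) (g $ 2 $ 1) (g $ 2 $ 2) = g"
  by (simp add: vec_eq_iff forall_2)

lemma m2_cases: obtains a b c d where "g = m2 a b c d"
  by (metis m2_eta)

lemma m2_eq_iff [simp]: "m2 a b c d = m2 a' b' c' d' \<longleftrightarrow> a = a' \<and> b = b' \<and> c = c' \<and> d = d'"
  by (auto simp: vec_eq_iff forall_2)

lemma m2_mult [simp]:
  "m2 a b c d ** m2 a' b' c' d' = m2 (a * a' + b * c') (a * b' + b * d') (c * a' + d * c') (c * b' + d * d')"
  by (simp add: vec_eq_iff forall_2 matrix_matrix_mult_def sum_2)

lemma det_m2 [simp]: "det (m2 a b c d) = a * d - b * c"
  by (simp add: det_2)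

lemma trace_m2 [simp]: "trace (m2 a b c d) = a + d"
  by (simp add: trace_def sum_2)

lemma mat_m2: "mat z = m2 z 0 0 z"
  by (simp add: vec_eq_iff forall_2 mat_def)

interpretation GL2: Group.group "GL2 :: ('a::field^2^2) monoid"
  by (rule group_GL2)

lemma one_GL2: "\<one>\<^bsub>GL2\<^esub> = mat 1"
  by (simp add: GL2_def)

lemma inv_m2:
  assumes "a * d - b * c \<noteq> 0"
  shows "inv\<^bsub>GL2\<^esub> (m2 a b c d) = m2 (d / (a * d - b * c)) (- b / (a * d - b * c))
    (- c / (a * d - b * c)) (a / (a * d - b * c))"
  using assms
  by (intro GL2.inv_equality)
    (auto simp: carrier_GL2 mult_GL2 one_GL2 mat_m2 diff_divide_distrib[symmetric] mult.commute
      divide_simps)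

text \<open>A nonscalar 2 by 2 matrix is conjugate to the companion matrix of its characteristic
  polynomial, so for nonzero d this is the indicator of a single conjugacy class. Excluding the
  scalars separates, for instance, the nontrivial unipotents from the identity.\<close>

definition cls :: "'a::field \<Rightarrow> 'a \<Rightarrow> 'a^2^2 \<Rightarrow> complex" where
  "cls d t g = (if det g = d \<and> trace g = t \<and> (\<forall>z. g \<noteq> mat z) then 1 else 0)"

lemma conj_invariant_cls: "conj_invariant GL2 (cls d t)"
proof -
  have "cls d t (h ** g ** inv\<^bsub>GL2\<^esub> h) = cls d t g"
    if gh: "g \<in> carrier GL2" "h \<in> carrier GL2" for g h :: "'a^2^2"
  proof -
    let ?k = "inv\<^bsub>GL2\<^esub> h"
    have kh: "?k ** h = mat 1" "h ** ?k = mat 1"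
      using GL2.l_inv[OF gh(2)] GL2.r_inv[OF gh(2)] by (simp_all add: mult_GL2 one_GL2)
    have "det (h ** g ** ?k) = det g * (det h * det ?k)" by (simp add: det_mul)
    also have "det h * det ?k = 1" using kh(2) by (metis det_mul det_I)
    finally have d: "det (h ** g ** ?k) = det g" by simp
    have t: "trace (h ** g ** ?k) = trace g"
      by (subst trace_mul_sym) (simp add: matrix_mul_assoc kh)
    have comm: "a ** mat z = mat z ** a" for a :: "'a^2^2" and z
      by (rule m2_cases[of a]) (simp add: mat_m2 mult.commute)
    have "h ** g ** ?k = mat z \<longleftrightarrow> g = mat z" for z
    proof
      assume e: "h ** g ** ?k = mat z"
      have "g = (?k ** h) ** g ** (?k ** h)" by (simp add: kh)
      also have "\<dots> = ?k ** (h ** g ** ?k) ** h" by (simp add: matrix_mul_assoc)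
      also have "\<dots> = mat z" unfolding e
        by (simp only: comm[of ?k] matrix_mul_assoc[symmetric] kh matrix_mul_rid)
      finally show "g = mat z" .
    next
      assume "g = mat z"
      then show "h ** g ** ?k = mat z"
        by (simp only: comm[of h] matrix_mul_assoc[symmetric] kh matrix_mul_rid)
    qed
    then show ?thesis by (simp add: cls_def d t)
  qed
  then show ?thesis by (simp add: conj_invariant_def mult_GL2)
qed

section \<open>The cuspidal representations\<close>

locale add_char = quad_ext +
  fixes \<xi> :: "'a \<Rightarrow> complex"
  assumes \<xi>: "\<xi> \<in> characters (add_monoid Fq)" and \<xi>_nontriv: "\<exists>x. \<xi> x \<noteq> 1"
begin

section \<open>Sums of the additive character over the field and its quadratic extension\<close>

lemma group_add_Fq: "Group.group (add_monoid (Fq :: 'a ring))"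
  using abelian_group.a_group[OF ring.is_abelian_group[OF ring_from_type_algebra]] .

lemma xi_add: "\<xi> (x + y) = \<xi> x * \<xi> y" and xi_0 [simp]: "\<xi> 0 = 1"
  using charactersD_group(2)[OF \<xi> group_add_Fq, of x y] charactersD_group(3)[OF \<xi> group_add_Fq]
  by (simp_all add: ring_of_type_algebra_def)

lemma xi_nz: "\<xi> x \<noteq> 0"
  using xi_add[of x "- x"] by auto

lemma sum_xi: "(\<Sum>x\<in>UNIV. \<xi> (c * x)) = (if c = 0 then of_nat CARD('a) else 0)"
proof (cases "c = 0")
  case False
  obtain h where "\<xi> h \<noteq> 1" using \<xi>_nontriv by auto
  then have "\<xi> (c * (h / c)) \<noteq> 1" using False by simp
  then have "(\<Sum>x\<in>carrier (add_monoid (Fq :: 'a ring)). \<xi> (c * x)) = 0"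
    by (intro group.sum_character_eq_0[OF group_add_Fq, where h = "h / c"])
      (simp_all add: ring_of_type_algebra_def distrib_left xi_add)
  then show ?thesis using False by (simp add: ring_of_type_algebra_def)
qed simp

lemma sum_xi_nz: "(\<Sum>x\<in>UNIV - {0}. \<xi> (c * x)) = (if c = 0 then of_nat CARD('a) else 0) - 1"
  using sum_xi[of c] by (simp add: sum_diff1)

lemma sum_xi_inverse: "(\<Sum>x\<in>UNIV - {0}. \<xi> (c * inverse x)) = (if c = 0 then of_nat CARD('a) else 0) - 1"
proof -
  have "(\<Sum>x\<in>UNIV - {0}. \<xi> (c * inverse x)) = (\<Sum>x\<in>UNIV - {0}. \<xi> (c * x))"
    by (rule sum.reindex_bij_witness[of _ inverse inverse]) auto
  then show ?thesis by (simp add: sum_xi_nz)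
qed

text \<open>Orthogonality for the additive characters of the quadratic extension; the trace form is
  nondegenerate because 2 and \<eta> are nonzero.\<close>

lemma sum_xi_trc:
  "(\<Sum>u\<in>UNIV. \<xi> (trc \<eta> (t \<star> u))) = (if t = (0, 0) then (of_nat CARD('a))\<^sup>2 else 0)"
proof -
  obtain a b where t: "t = (a, b)" by (cases t)
  have "(\<Sum>u\<in>UNIV. \<xi> (trc \<eta> (t \<star> u))) =
      (\<Sum>u\<in>UNIV \<times> UNIV. \<xi> (2 * a * fst u) * \<xi> (2 * \<eta> * b * snd u))"
    by (rule sum.cong) (auto simp: t trc_simp xi_add[symmetric] algebra_simps)
  also have "\<dots> = (\<Sum>x\<in>UNIV. \<Sum>y\<in>UNIV. \<xi> (2 * a * x) * \<xi> (2 * \<eta> * b * y))"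
    by (simp add: sum.cartesian_product split_def)
  also have "\<dots> = (\<Sum>x\<in>UNIV. \<xi> (2 * a * x)) * (\<Sum>y\<in>UNIV. \<xi> (2 * \<eta> * b * y))"
    by (simp only: sum_product)
  also have "\<dots> = (if t = (0, 0) then (of_nat CARD('a))\<^sup>2 else 0)"
    unfolding sum_xi using two_nz \<eta>_nz by (auto simp: t power2_eq_square)
  finally show ?thesis .
qed

lemma sum_by_norm: "(\<Sum>u\<in>UNIV - {(0, 0)}. h u) = (\<Sum>x\<in>UNIV - {0}. \<Sum>u | nrm \<eta> u = x. h u)"
proof -
  have "(\<Sum>x\<in>UNIV - {0}. sum h {u \<in> UNIV - {(0, 0)}. nrm \<eta> u = x}) = sum h (UNIV - {(0, 0)})"
    by (rule sum.group) (auto simp: nrm_eq_0)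
  moreover have "{u \<in> UNIV - {(0, 0)}. nrm \<eta> u = x} = {u. nrm \<eta> u = x}" if "x \<noteq> 0" for x
    using that nrm_eq_0 by auto
  ultimately show ?thesis by simp
qed

text \<open>The norm takes every nonzero value q + 1 times and the value 0 once, which gives 1 - (q
  + 1).\<close>

lemma sum_xi_nrm:
  assumes "c \<noteq> 0" shows "(\<Sum>u\<in>UNIV. \<xi> (c * nrm \<eta> u)) = - of_nat CARD('a)"
proof -
  have "(\<Sum>u\<in>UNIV. \<xi> (c * nrm \<eta> u)) = 1 + (\<Sum>u\<in>UNIV - {(0, 0)}. \<xi> (c * nrm \<eta> u))"
    by (subst sum.remove[of _ "(0, 0)"]) (auto simp: nrm_simp)
  also have "(\<Sum>u\<in>UNIV - {(0, 0)}. \<xi> (c * nrm \<eta> u)) =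
      (\<Sum>x\<in>UNIV - {0}. \<Sum>u | nrm \<eta> u = x. \<xi> (c * x))"
    unfolding sum_by_norm by (intro sum.cong) auto
  also have "\<dots> = of_nat (CARD('a) + 1) * (\<Sum>x\<in>UNIV - {0}. \<xi> (c * x))"
    unfolding sum_distrib_left by (intro sum.cong) (auto simp: card_norm_fibre)
  also have "\<dots> = - of_nat (CARD('a) + 1)" using assms by (simp add: sum_xi_nz)
  finally show ?thesis by simp
qed

lemma nrm_add: "nrm \<eta> (u + v) = nrm \<eta> u + nrm \<eta> v + trc \<eta> (conjg v \<star> u)"
  by (cases u; cases v) (simp add: nrm_simp trc_simp power2_eq_square algebra_simps)

text \<open>Completing the square reduces a nonzero \<open>c\<close> to the sum over norms.\<close>

lemma sum_xi_quadratic: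
  "(\<Sum>u\<in>UNIV. \<xi> (c * nrm \<eta> u + trc \<eta> (m \<star> u))) =
    (if c = 0 then (if m = (0, 0) then (of_nat CARD('a))\<^sup>2 else 0)
     else - of_nat CARD('a) * \<xi> (- nrm \<eta> m / c))"
proof (cases "c = 0")
  case True
  then show ?thesis by (simp add: sum_xi_trc)
next
  case False
  \<comment> \<open>This is \<open>conjg m\<close> divided by c, the shift that completes the
    square.\<close>
  define v where "v = (fst m / c, - snd m / c)"
  have sq: "c * nrm \<eta> u + trc \<eta> (m \<star> u) = c * nrm \<eta> (u + v) + (- nrm \<eta> m / c)" for u
  proof -
    have "c * nrm \<eta> v = nrm \<eta> m / c" "c * trc \<eta> (conjg v \<star> u) = trc \<eta> (m \<star> u)"
      using False
      by (cases m; cases u; simp add: v_def nrm_simp trc_simp power2_eq_square field_simps)+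
    then show ?thesis by (simp add: nrm_add distrib_left)
  qed
  have "(\<Sum>u\<in>UNIV. \<xi> (c * nrm \<eta> u + trc \<eta> (m \<star> u))) =
      (\<Sum>u\<in>UNIV. \<xi> (c * nrm \<eta> (u + v))) * \<xi> (- nrm \<eta> m / c)"
    unfolding sq by (simp only: xi_add sum_distrib_right)
  also have "(\<Sum>u\<in>UNIV. \<xi> (c * nrm \<eta> (u + v))) = (\<Sum>u\<in>UNIV. \<xi> (c * nrm \<eta> u))"
    by (rule sum.reindex_bij_witness[of _ "\<lambda>u. u - v" "\<lambda>u. u + v"]) auto
  finally show ?thesis using False by (simp add: sum_xi_nrm)
qed

end

section \<open>The function \<open>j\<close> and its convolution identity\<close>

locale cuspidal = add_char +
  fixes \<nu> :: "'a \<times> 'a \<Rightarrow> complex"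
  assumes \<nu>: "\<nu> \<in> indecomposables \<eta>"
begin

lemma \<nu>_char: "\<nu> \<in> characters Lx"
  using \<nu> by (simp add: indecomposables_def)

lemmas nu = charL[OF \<nu>_char]

lemma nu_real_mult: "\<nu> (x * y, 0) = \<nu> (x, 0) * \<nu> (y, 0)"
  using nu(4)[of "(x, 0)" "(y, 0)"] by simp

lemma nu_real_nz: "x \<noteq> 0 \<Longrightarrow> \<nu> (x, 0) \<noteq> 0"
  using nu(1) by simp

abbreviation "j \<equiv> cusp_j \<eta> \<xi> \<nu>"

lemma j_eq:
  assumes "x \<noteq> 0" shows "of_nat CARD('a) * j x = (\<Sum>w | nrm \<eta> w = x. \<xi> (trc \<eta> w) * \<nu> w)"
proof -
  have "{w \<in> carrier Lx. nrm \<eta> w = x} = {w. nrm \<eta> w = x}"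
    using assms nrm_eq_0 by (auto simp: carrier_Lx)
  then show ?thesis by (simp add: cusp_j_def)
qed

text \<open>Substitute w = t c with c in the base field, which multiplies the norm by c^2. It
  recognises \<open>j\<close> in sums over a norm fibre whose trace carries a factor.\<close>

lemma j_scaled:
  assumes "c \<noteq> 0" "x \<noteq> 0"
  shows "(\<Sum>t | nrm \<eta> t = x. \<nu> t * \<xi> (c * trc \<eta> t)) * \<nu> (c, 0) = of_nat CARD('a) * j (x * c\<^sup>2)"
proof -
  have tr: "trc \<eta> (t \<star> (c, 0)) = c * trc \<eta> t" for t by (cases t) (simp add: trc_simp)
  have n: "x * c\<^sup>2 = x * nrm \<eta> (c, 0)" by (simp add: nrm_simp)
  have "of_nat CARD('a) * j (x * c\<^sup>2) = (\<Sum>w | nrm \<eta> w = x * nrm \<eta> (c, 0). \<xi> (trc \<eta> w) * \<nu> w)"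
    unfolding n[symmetric] using assms by (simp add: j_eq)
  also have "\<dots> = (\<Sum>t | nrm \<eta> t = x. \<xi> (trc \<eta> (t \<star> (c, 0))) * \<nu> (t \<star> (c, 0)))"
    by (rule sum.reindex_bij_betw[OF bij_norm_fibre, symmetric]) (use assms in simp)
  finally show ?thesis unfolding tr nu(4) sum_distrib_right by (simp only: mult_ac)
qed

text \<open>The convolution identity behind the homomorphism property. For \<open>N u = B v\<close> the elements of
  norm \<open>A v\<close> are the \<open>t \<cdot> conjg u\<close> with \<open>N t = A / B\<close>; this decouples the double sum over
  \<open>t\<close> and \<open>u\<close>.\<close>

lemma j_convolution:
  assumes A: "A \<noteq> 0" and B: "B \<noteq> 0"
  shows "(\<Sum>v\<in>UNIV - {0}. \<nu> (- inverse v, 0) * \<xi> (s * v) * j (A * v) * j (B * v)) =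
    (if s = 0 then (if A = B then \<nu> (B, 0) else 0)
     else - \<nu> (s, 0) * \<xi> (- (A + B) / s) * j (A * B / s\<^sup>2))"
proof -
  let ?q = "of_nat CARD('a) :: complex"
  have q0: "?q \<noteq> 0" by simp
  define S where "S = (\<Sum>v\<in>UNIV - {0}. \<nu> (- inverse v, 0) * \<xi> (s * v) * j (A * v) * j (B * v))"
  define E where "E t u = \<xi> (s / B * nrm \<eta> u + trc \<eta> ((conjg t + (1, 0)) \<star> u))" for t u
  define F where "F u = (\<Sum>t | nrm \<eta> t = A / B. \<nu> t * E t u)" for u
  have step: "\<nu> (- inverse v, 0) * \<xi> (s * v) * (?q * j (A * v)) * (?q * j (B * v)) =
      (\<Sum>u | nrm \<eta> u = B * v. \<nu> (- B, 0) * F u)" if v: "v \<noteq> 0" for v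
  proof -
    define W where "W = (\<Sum>w | nrm \<eta> w = A * v. \<xi> (trc \<eta> w) * \<nu> w)"
    have jA: "?q * j (A * v) = W" and jB: "?q * j (B * v) = (\<Sum>u | nrm \<eta> u = B * v. \<xi> (trc \<eta> u) * \<nu> u)"
      using A B v by (simp_all add: j_eq W_def)
    have "\<nu> (- inverse v, 0) * \<xi> (s * v) * (?q * j (A * v)) * (?q * j (B * v)) =
        (\<Sum>u | nrm \<eta> u = B * v. \<nu> (- inverse v, 0) * \<xi> (s * v) * (\<xi> (trc \<eta> u) * \<nu> u) * W)"
      unfolding jA jB sum_distrib_left by (simp only: mult_ac)
    also have "\<dots> = (\<Sum>u | nrm \<eta> u = B * v. \<nu> (- B, 0) * F u)"
    proof (rule sum.cong[OF refl])
      fix u assume "u \<in> {u. nrm \<eta> u = B * v}"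
      then have u: "nrm \<eta> u = B * v" by simp
      then have cu: "conjg u \<noteq> (0, 0)" using B v nrm_eq_0[of u] by (auto simp: conjg_eq_0)
      have e: "A * v = A / B * nrm \<eta> (conjg u)" using B by (simp add: nrm_conjg u)
      have "\<nu> (- inverse v, 0) * \<xi> (s * v) * (\<xi> (trc \<eta> u) * \<nu> u) * W =
        \<nu> (- inverse v, 0) * \<xi> (s * v) * (\<xi> (trc \<eta> u) * \<nu> u) *
          (\<Sum>t | nrm \<eta> t = A / B. \<xi> (trc \<eta> (t \<star> conjg u)) * \<nu> (t \<star> conjg u))"
        unfolding W_def e by (subst sum.reindex_bij_betw[OF bij_norm_fibre[OF cu], symmetric]) (rule refl)
      also have "\<dots> = (\<Sum>t | nrm \<eta> t = A / B. \<nu> (- B, 0) * (\<nu> t * E t u))"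
        unfolding sum_distrib_left
      proof (rule sum.cong[OF refl])
        fix t
        \<comment> \<open>Since u times \<open>conjg u\<close> is B v, the dependence on v cancels
          and a constant prefactor remains.\<close>
        have "\<nu> (- inverse v, 0) * (\<nu> u * \<nu> (conjg u)) = \<nu> (- inverse v * (B * v), 0)"
          by (simp only: nu(4)[symmetric] qm_conjg u) (simp only: nu(4) nu_real_mult)
        moreover have "- inverse v * (B * v) = - B" using v by simp
        ultimately have 1: "\<nu> (- inverse v, 0) * (\<nu> u * \<nu> (conjg u)) = \<nu> (- B, 0)" by (simp only:)
        have 2: "\<xi> (s * v) * \<xi> (trc \<eta> u) * \<xi> (trc \<eta> (t \<star> conjg u)) = E t u"
        proof -
          have "s * v = s / B * nrm \<eta> u" using B by (simp add: u)
          moreover have "trc \<eta> u + trc \<eta> (t \<star> conjg u) = trc \<eta> ((conjg t + (1, 0)) \<star> u)"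
            by (cases t; cases u) (simp add: trc_simp algebra_simps)
          ultimately have "s * v + trc \<eta> u + trc \<eta> (t \<star> conjg u) =
              s / B * nrm \<eta> u + trc \<eta> ((conjg t + (1, 0)) \<star> u)"
            by (simp only: add.assoc)
          then show ?thesis by (simp only: E_def xi_add[symmetric])
        qed
        have "\<nu> (- inverse v, 0) * \<xi> (s * v) * (\<xi> (trc \<eta> u) * \<nu> u) *
            (\<xi> (trc \<eta> (t \<star> conjg u)) * \<nu> (t \<star> conjg u)) =
          (\<nu> (- inverse v, 0) * (\<nu> u * \<nu> (conjg u))) *
            (\<nu> t * (\<xi> (s * v) * \<xi> (trc \<eta> u) * \<xi> (trc \<eta> (t \<star> conjg u))))"
          by (simp only: nu(4) mult_ac)
        also have "\<dots> = \<nu> (- B, 0) * (\<nu> t * E t u)" by (simp only: 1 2)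
        finally show "\<nu> (- inverse v, 0) * \<xi> (s * v) * (\<xi> (trc \<eta> u) * \<nu> u) *
            (\<xi> (trc \<eta> (t \<star> conjg u)) * \<nu> (t \<star> conjg u)) = \<nu> (- B, 0) * (\<nu> t * E t u)" .
      qed
      finally show "\<nu> (- inverse v, 0) * \<xi> (s * v) * (\<xi> (trc \<eta> u) * \<nu> u) * W = \<nu> (- B, 0) * F u"
        by (simp only: F_def sum_distrib_left)
    qed
    finally show ?thesis .
  qed
  have "?q\<^sup>2 * S = (\<Sum>v\<in>UNIV - {0}. \<Sum>u | nrm \<eta> u = B * v. \<nu> (- B, 0) * F u)"
    unfolding S_def sum_distrib_left using step
    by (intro sum.cong) (auto simp: power2_eq_square mult_ac)
  also have "\<dots> = (\<Sum>x\<in>UNIV - {0}. \<Sum>u | nrm \<eta> u = x. \<nu> (- B, 0) * F u)"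
    by (rule sum.reindex_bij_witness[of _ "\<lambda>x. x / B" "\<lambda>v. B * v"]) (use B in auto)
  also have "\<dots> = \<nu> (- B, 0) * (\<Sum>u\<in>UNIV - {(0, 0)}. F u)"
    unfolding sum_by_norm by (simp add: sum_distrib_left)
  \<comment> \<open>The term at u = 0 may be added because it is the sum of \<nu> over a norm fibre,
    which vanishes. The inner sum over u thereby becomes a complete Gaussian sum.\<close>
  also have "(\<Sum>u\<in>UNIV - {(0, 0)}. F u) = (\<Sum>u\<in>UNIV. F u)"
  proof -
    have "F (0, 0) = (\<Sum>t | nrm \<eta> t = A / B. \<nu> t)"
      unfolding F_def
    proof (rule sum.cong[OF refl])
      show "\<nu> t * E t (0, 0) = \<nu> t" for t
        by (cases t) (simp add: E_def nrm_simp trc_simp)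
    qed
    then have "F (0, 0) = 0" by (simp add: sum_norm_fibre[OF \<nu>])
    then show ?thesis by (simp add: sum_diff1)
  qed
  also have "\<dots> = (\<Sum>t | nrm \<eta> t = A / B. \<nu> t * (\<Sum>u\<in>UNIV. E t u))"
    unfolding F_def by (subst sum.swap) (simp add: sum_distrib_left)
  finally have main: "?q\<^sup>2 * S = \<nu> (- B, 0) * (\<Sum>t | nrm \<eta> t = A / B. \<nu> t * (\<Sum>u\<in>UNIV. E t u))" .
  show ?thesis
  proof (cases "s = 0")
    case True
    \<comment> \<open>Without a quadratic term the Gaussian sum detects a vanishing linear
      coefficient, that is t = -1. This t has norm 1, so it occurs in the fibre over A / B only for
      A = B.\<close>
    have c0: "conjg t + (1, 0) = (0, 0) \<longleftrightarrow> t = (- 1, 0)" for t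
      by (cases t) (auto simp: eq_neg_iff_add_eq_0)
    have "(\<Sum>t | nrm \<eta> t = A / B. \<nu> t * (\<Sum>u\<in>UNIV. E t u)) =
        (\<Sum>t | nrm \<eta> t = A / B. if t = (- 1, 0) then \<nu> (- 1, 0) * ?q\<^sup>2 else 0)"
      unfolding E_def sum_xi_quadratic using True by (intro sum.cong) (auto simp: c0)
    also have "\<dots> = (if A = B then \<nu> (- 1, 0) * ?q\<^sup>2 else 0)"
      using B by (simp add: nrm_simp eq_divide_eq)
    finally have "?q\<^sup>2 * S = ?q\<^sup>2 * (if A = B then \<nu> (B, 0) else 0)"
      unfolding main using nu_real_mult[of "- B" "- 1"] by simp
    then have "S = (if A = B then \<nu> (B, 0) else 0)" using q0 by simp
    then show ?thesis using True unfolding S_def by simp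
  next
    case False
    \<comment> \<open>Completing the square with coefficient s / B produces the norm of
      \<open>conjg t\<close> + 1, which is A / B + 1 + \<open>trc\<close> t; c is the resulting
      coefficient of the trace of t. The factor \<nu> (c, 0) is carried along so that
      \<open>j_scaled\<close> applies, and is cancelled at the end.\<close>
    define c where "c = - B / s"
    have c: "c \<noteq> 0" using B False by (simp add: c_def)
    have E: "(\<Sum>u\<in>UNIV. E t u) = - ?q * \<xi> (- (A + B) / s) * \<xi> (c * trc \<eta> t)"
      if "nrm \<eta> t = A / B" for t
    proof -
      have "nrm \<eta> (conjg t + (1, 0)) = A / B + 1 + trc \<eta> t"
        using that by (simp add: nrm_add nrm_conjg trc_conjg) (simp add: nrm_simp)
      then have "- nrm \<eta> (conjg t + (1, 0)) / (s / B) = - (A + B) / s + c * trc \<eta> t"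
        using B False by (simp add: c_def field_simps)
      then show ?thesis
        unfolding E_def sum_xi_quadratic using B False by (simp add: xi_add)
    qed
    define Y where "Y = (\<Sum>t | nrm \<eta> t = A / B. \<nu> t * \<xi> (c * trc \<eta> t))"
    have "(\<Sum>t | nrm \<eta> t = A / B. \<nu> t * (\<Sum>u\<in>UNIV. E t u)) =
        (\<Sum>t | nrm \<eta> t = A / B. - ?q * \<xi> (- (A + B) / s) * (\<nu> t * \<xi> (c * trc \<eta> t)))"
    proof (rule sum.cong[OF refl])
      fix t assume "t \<in> {t. nrm \<eta> t = A / B}"
      then have "nrm \<eta> t = A / B" by simp
      from E[OF this] show "\<nu> t * (\<Sum>u\<in>UNIV. E t u) = - ?q * \<xi> (- (A + B) / s) * (\<nu> t * \<xi> (c * trc \<eta> t))"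
        by (simp only: mult_ac)
    qed
    also have "\<dots> = - ?q * \<xi> (- (A + B) / s) * Y" by (simp only: Y_def sum_distrib_left)
    finally have "?q\<^sup>2 * S * \<nu> (c, 0) = \<nu> (- B, 0) * (- ?q * \<xi> (- (A + B) / s) * (Y * \<nu> (c, 0)))"
      unfolding main by (simp only: mult_ac)
    also have "Y * \<nu> (c, 0) = ?q * j (A / B * c\<^sup>2)"
      unfolding Y_def using c A B by (subst j_scaled) simp_all
    also have "A / B * c\<^sup>2 = A * B / s\<^sup>2"
      using B False by (simp add: c_def field_simps power2_eq_square)
    also have "\<nu> (- B, 0) = \<nu> (s, 0) * \<nu> (c, 0)"
      using False by (simp add: nu_real_mult[symmetric] c_def)
    finally have "?q\<^sup>2 * \<nu> (c, 0) * S =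
        ?q\<^sup>2 * \<nu> (c, 0) * (- \<nu> (s, 0) * \<xi> (- (A + B) / s) * j (A * B / s\<^sup>2))"
      by (simp only: power2_eq_square mult_ac mult_minus_left mult_minus_right)
    then have "S = - \<nu> (s, 0) * \<xi> (- (A + B) / s) * j (A * B / s\<^sup>2)"
      using q0 nu_real_nz[OF c] by (subst (asm) mult_cancel_left) auto
    then show ?thesis using False unfolding S_def by simp
  qed
qed

end

section \<open>The homomorphism property of the cuspidal representations\<close>

context cuspidal
begin

text \<open>The matrix of g in the basis of point masses, with row y and column x, so that the
  homomorphism property becomes a statement about matrix products.\<close>

definition ker :: "'a^2^2 \<Rightarrow> 'a \<Rightarrow> 'a \<Rightarrow> complex" where
  "ker g y x = (let a = g $ 1 $ 1; b = g $ 1 $ 2; c = g $ 2 $ 1; d = g $ 2 $ 2 in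
    if c = 0 then (if x = d * y / a then \<nu> (d, 0) * \<xi> (b / (d * y)) else 0)
    else - (\<nu> (- c * x, 0) * \<xi> (a / (c * y) + d / (c * x)) * j (det g / (c\<^sup>2 * y * x))))"

abbreviation "\<rho> \<equiv> cusp_rep \<eta> \<xi> \<nu>"

lemma cusp_simps: "vspace \<rho> = {f. f 0 = 0}" "scal \<rho> = (\<lambda>c f y. c * f y)"
  by (simp_all add: cusp_rep_def)

lemma act_cusp_0: "act \<rho> g f 0 = 0"
  by (simp add: cusp_rep_def Let_def)

lemma act_ker:
  assumes g: "det g \<noteq> 0" and y: "y \<noteq> 0"
  shows "act \<rho> g f y = (\<Sum>x\<in>UNIV - {0}. ker g y x * f x)"
proof (rule m2_cases[of g])
  fix a b c d assume [simp]: "g = m2 a b c d"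
  show ?thesis
  proof (cases "c = 0")
    case True
    then have nz: "a \<noteq> 0" "d \<noteq> 0" using g by auto
    have "(\<Sum>x\<in>UNIV - {0}. ker g y x * f x) =
        (\<Sum>x\<in>UNIV - {0}. if x = d * y / a then \<nu> (d, 0) * \<xi> (b / (d * y)) * f (d * y / a) else 0)"
      using True by (intro sum.cong) (auto simp: ker_def)
    also have "\<dots> = \<nu> (d, 0) * \<xi> (b / (d * y)) * f (d * y / a)"
      using nz y by simp
    also have "\<dots> = \<nu> (d, 0) * \<xi> (inverse d * b * inverse y) * f (d * inverse a * y)"
      by (simp add: divide_inverse mult_ac)
    finally show ?thesis using True y by (simp add: cusp_rep_def)
  next
    case False
    have e: "a * inverse c * inverse y + inverse c * d * inverse x = a / (c * y) + d / (c * x)"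
      "inverse (c\<^sup>2) * inverse y * inverse x * det g = det g / (c\<^sup>2 * y * x)" for x
      by (simp_all add: divide_inverse mult_ac)
    show ?thesis
      using False y e by (simp add: cusp_rep_def Let_def ker_def sum_negf)
  qed
qed

text \<open>If one factor is upper triangular its matrix is monomial, and the sum over z collapses
  to one term. Otherwise \<open>j\<close> occurs twice and, with v = 1 / z, the sum is the one of
  \<open>j_convolution\<close>; its two cases correspond to whether the product is upper
  triangular.\<close>

lemma ker_mult:
  assumes g: "det g \<noteq> 0" and h: "det h \<noteq> 0" and y: "y \<noteq> 0" and x: "x \<noteq> 0"
  shows "(\<Sum>z\<in>UNIV - {0}. ker g y z * ker h z x) = ker (g ** h) y x"
proof (rule m2_cases[of g], rule m2_cases[of h])
  fix a b c d a' b' c' d' assume gh [simp]: "g = m2 a b c d" "h = m2 a' b' c' d'"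
  define D D' where "D = det g" and "D' = det h"
  have D: "D \<noteq> 0" "D' \<noteq> 0" using g h by (simp_all add: D_def D'_def)
  have DD: "det (g ** h) = D * D'" unfolding D_def D'_def by (rule det_mul)
  show ?thesis
  proof (cases "c = 0")
    case c: True
    then have nz: "a \<noteq> 0" "d \<noteq> 0" using g by auto
    define z0 where "z0 = d * y / a"
    have z0: "z0 \<noteq> 0" using nz y by (simp add: z0_def)
    have "(\<Sum>z\<in>UNIV - {0}. ker g y z * ker h z x) =
        (\<Sum>z\<in>UNIV - {0}. if z = z0 then \<nu> (d, 0) * \<xi> (b / (d * y)) * ker h z0 x else 0)"
      using c by (intro sum.cong) (auto simp: ker_def z0_def)
    also have "\<dots> = \<nu> (d, 0) * \<xi> (b / (d * y)) * ker h z0 x" using z0 by simp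
    also have "\<dots> = ker (g ** h) y x"
    proof (cases "c' = 0")
      case c': True
      then have nz': "a' \<noteq> 0" "d' \<noteq> 0" using h by auto
      have 1: "d' * z0 / a' = d * d' * y / (a * a')" by (simp add: z0_def)
      have 2: "b / (d * y) + b' / (d' * z0) = (a * b' + b * d') / (d * d' * y)"
        using nz nz' y by (simp add: z0_def field_simps)
      show ?thesis
        using c c' by (simp add: ker_def 1 2[symmetric] nu_real_mult xi_add)
    next
      case c': False
      have 1: "b / (d * y) + (a' / (c' * z0) + d' / (c' * x)) =
          (a * a' + b * c') / (d * c' * y) + d * d' / (d * c' * x)"
        using nz c' y x by (simp add: z0_def field_simps)
      have 2: "det h / (c'\<^sup>2 * z0 * x) = det (g ** h) / ((d * c')\<^sup>2 * y * x)"
        unfolding DD D'_def[symmetric] using nz c' y x c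
        by (simp add: D_def z0_def field_simps power2_eq_square)
      have 3: "\<nu> (d, 0) * \<nu> (- c' * x, 0) = \<nu> (- (d * c') * x, 0)"
        by (simp add: nu_real_mult[symmetric] mult_ac)
      have "\<nu> (d, 0) * \<xi> (b / (d * y)) * ker h z0 x = - ((\<nu> (d, 0) * \<nu> (- c' * x, 0)) *
          \<xi> (b / (d * y) + (a' / (c' * z0) + d' / (c' * x))) * j (det h / (c'\<^sup>2 * z0 * x)))"
        using c' by (simp only: ker_def gh m2_nth Let_def if_False xi_add mult_minus_right mult_ac)
      also have "\<dots> = ker (g ** h) y x"
        unfolding 1 2 3 using c c' nz by (simp add: ker_def Let_def)
      finally show ?thesis .
    qed
    finally show ?thesis .
  next
    case c: False
    show ?thesis
    proof (cases "c' = 0")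
      case c': True
      then have nz': "a' \<noteq> 0" "d' \<noteq> 0" using h by auto
      define z0 where "z0 = a' * x / d'"
      have z0: "z0 \<noteq> 0" using nz' x by (simp add: z0_def)
      have z0_iff: "x = d' * z / a' \<longleftrightarrow> z = z0" for z
        using nz' by (auto simp: z0_def)
      have kh: "ker h z x = (if z = z0 then \<nu> (d', 0) * \<xi> (b' / (d' * z0)) else 0)" for z
        unfolding ker_def gh m2_nth Let_def c' z0_iff by simp
      have "(\<Sum>z\<in>UNIV - {0}. ker g y z * ker h z x) =
          (\<Sum>z\<in>UNIV - {0}. if z = z0 then ker g y z0 * (\<nu> (d', 0) * \<xi> (b' / (d' * z0))) else 0)"
        unfolding kh by (intro sum.cong) auto
      also have "\<dots> = ker g y z0 * (\<nu> (d', 0) * \<xi> (b' / (d' * z0)))" using z0 by simp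
      also have "\<dots> = ker (g ** h) y x"
      proof -
        have 1: "(a / (c * y) + d / (c * z0)) + b' / (d' * z0) =
            a * a' / (c * a' * y) + (c * b' + d * d') / (c * a' * x)"
          using nz' c y x by (simp add: z0_def field_simps)
        have 2: "det g / (c\<^sup>2 * y * z0) = det (g ** h) / ((c * a')\<^sup>2 * y * x)"
          unfolding DD D_def[symmetric] using nz' c' c y x
          by (simp add: D'_def z0_def field_simps power2_eq_square)
        have 3: "\<nu> (- c * z0, 0) * \<nu> (d', 0) = \<nu> (- (c * a') * x, 0)"
          using nz' by (simp add: nu_real_mult[symmetric] z0_def mult_ac)
        have "ker g y z0 * (\<nu> (d', 0) * \<xi> (b' / (d' * z0))) = - ((\<nu> (- c * z0, 0) * \<nu> (d', 0)) *
            \<xi> ((a / (c * y) + d / (c * z0)) + b' / (d' * z0)) * j (det g / (c\<^sup>2 * y * z0)))"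
          using c by (simp only: ker_def gh m2_nth Let_def if_False xi_add mult_minus_left mult_minus_right mult_ac)
        also have "\<dots> = ker (g ** h) y x"
          unfolding 1 2 3 using c c' nz' by (simp add: ker_def Let_def)
        finally show ?thesis .
      qed
      finally show ?thesis .
    next
      case c': False
      \<comment> \<open>A / z and B / z are the arguments of \<open>j\<close> in the two kernels,
        and s / z collects the part of the phase that depends on z. The lower left entry of the
        product is c c' s.\<close>
      define A B s where "A = D / (c\<^sup>2 * y)" and "B = D' / (c'\<^sup>2 * x)" and "s = d / c + a' / c'"
      have AB: "A \<noteq> 0" "B \<noteq> 0" using D c c' x y by (simp_all add: A_def B_def)
      define P where "P = \<nu> (c * c' * x, 0) * \<xi> (a / (c * y) + d' / (c' * x))"
      have nu1: "\<nu> (- c * z, 0) * \<nu> (- c' * x, 0) = \<nu> (c * c' * x, 0) * \<nu> (- 1, 0) * \<nu> (- z, 0)" for z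
        by (simp add: nu_real_mult[symmetric] mult_ac)
      have "(\<Sum>z\<in>UNIV - {0}. ker g y z * ker h z x) =
          (\<Sum>z\<in>UNIV - {0}. P * \<nu> (- 1, 0) * (\<nu> (- z, 0) * \<xi> (s * inverse z) * j (A * inverse z) * j (B * inverse z)))"
      proof (rule sum.cong[OF refl])
        fix z :: 'a assume "z \<in> UNIV - {0}"
        then have z: "z \<noteq> 0" by simp
        have 1: "det g / (c\<^sup>2 * y * z) = A * inverse z" "det h / (c'\<^sup>2 * z * x) = B * inverse z"
          unfolding D_def[symmetric] D'_def[symmetric] A_def B_def
          by (simp_all add: divide_inverse mult_ac)
        have 2: "(a / (c * y) + d / (c * z)) + (a' / (c' * z) + d' / (c' * x)) =
            (a / (c * y) + d' / (c' * x)) + s * inverse z"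
          by (simp add: s_def divide_inverse algebra_simps)
        have "ker g y z * ker h z x = (\<nu> (- c * z, 0) * \<nu> (- c' * x, 0)) *
            \<xi> ((a / (c * y) + d / (c * z)) + (a' / (c' * z) + d' / (c' * x))) *
            (j (det g / (c\<^sup>2 * y * z)) * j (det h / (c'\<^sup>2 * z * x)))"
          using c c' by (simp only: ker_def gh m2_nth Let_def if_False xi_add mult_minus_left mult_minus_right minus_minus mult_ac)
        also have "\<dots> = P * \<nu> (- 1, 0) * (\<nu> (- z, 0) * \<xi> (s * inverse z) * j (A * inverse z) * j (B * inverse z))"
          unfolding nu1 1 2 P_def xi_add by (simp only: mult_ac)
        finally show "ker g y z * ker h z x = \<dots>" .
      qed
      also have "\<dots> = P * \<nu> (- 1, 0) * (\<Sum>v\<in>UNIV - {0}. \<nu> (- inverse v, 0) * \<xi> (s * v) * j (A * v) * j (B * v))"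
        unfolding sum_distrib_left
        by (rule sum.reindex_bij_witness[of _ inverse inverse]) auto
      finally have main: "(\<Sum>z\<in>UNIV - {0}. ker g y z * ker h z x) = P * \<nu> (- 1, 0) *
          (if s = 0 then (if A = B then \<nu> (B, 0) else 0)
           else - \<nu> (s, 0) * \<xi> (- (A + B) / s) * j (A * B / s\<^sup>2))"
        unfolding j_convolution[OF AB] .
      have c'': "c * a' + d * c' = c * c' * s" using c c' by (simp add: s_def field_simps)
      show ?thesis
      proof (cases "s = 0")
        case True
        \<comment> \<open>The product is upper triangular. The condition A = B of the convolution
          identity turns out to be the condition that puts (y, x) on the support of its monomial
          matrix.\<close>
        then have e: "d * c' = - (c * a')" using c'' by (simp add: eq_neg_iff_add_eq_0 add.commute)
        then have d: "d = - (c * a') / c'" using c' by (simp add: field_simps)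
        have c3: "c * a' + d * c' = 0" using e by simp
        have d3: "c * b' + d * d' = - c * D' / c'"
          using c' by (simp add: D'_def d field_simps)
        have a3: "a * a' + b * c' = - c' * D / c"
          using c c' by (simp add: D_def d field_simps)
        have "(c * b' + d * d') * y / (a * a' + b * c') = (c\<^sup>2 * D' * y) / (c'\<^sup>2 * D)"
          unfolding a3 d3 using c c' D by (simp add: field_simps power2_eq_square)
        moreover have "A = B \<longleftrightarrow> x = (c\<^sup>2 * D' * y) / (c'\<^sup>2 * D)"
          using c c' D x y by (auto simp: A_def B_def field_simps)
        ultimately have AB_iff: "A = B \<longleftrightarrow> x = (c * b' + d * d') * y / (a * a' + b * c')" by simp
        have "P * \<nu> (- 1, 0) * \<nu> (B, 0) = \<nu> (c * b' + d * d', 0) * \<xi> ((a * b' + b * d') / ((c * b' + d * d') * y))"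
          if "A = B"
        proof -
          have x': "x = (c\<^sup>2 * D' * y) / (c'\<^sup>2 * D)"
            using that c c' D x y by (auto simp: A_def B_def field_simps)
          have "c * c' * x * (- 1 * B) = c * b' + d * d'"
            unfolding d3 B_def using c c' x D by (simp add: field_simps power2_eq_square)
          then have 1: "\<nu> (c * c' * x, 0) * (\<nu> (- 1, 0) * \<nu> (B, 0)) = \<nu> (c * b' + d * d', 0)"
            by (simp only: nu_real_mult[symmetric])
          have xe: "a / (c * y) + d' / (c' * x) = (a * b' + b * d') / ((c * b' + d * d') * y)"
          proof -
            have 1: "d' / (c' * x) = (d' * c' * D) / (c\<^sup>2 * D' * y)"
              unfolding x' using c c' D y by (simp add: field_simps power2_eq_square)
            have 2: "a * D' * c + d' * c' * D = - c' * c * (a * b' + b * d')"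
              using c' by (simp add: D_def D'_def d field_simps)
            have "a / (c * y) + d' / (c' * x) = (a * D' * c + d' * c' * D) / (c\<^sup>2 * D' * y)"
              unfolding 1 using c D y by (simp add: field_simps power2_eq_square)
            also have "\<dots> = (a * b' + b * d') / ((- c * D' / c') * y)"
              unfolding 2 using c c' D y by (simp add: field_simps power2_eq_square)
            finally show ?thesis unfolding d3 .
          qed
          have "P * \<nu> (- 1, 0) * \<nu> (B, 0) = (\<nu> (c * c' * x, 0) * (\<nu> (- 1, 0) * \<nu> (B, 0))) *
              \<xi> (a / (c * y) + d' / (c' * x))"
            unfolding P_def by (simp only: mult_ac)
          then show ?thesis unfolding 1 xe .
        qed
        then show ?thesis
          unfolding main using True AB_iff c3 by (simp add: ker_def Let_def)
      next
        case False
        have c3: "c * a' + d * c' \<noteq> 0" using c c' False unfolding c'' by simp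
        have 1: "P * \<nu> (- 1, 0) * (- \<nu> (s, 0) * \<xi> (- (A + B) / s) * j (A * B / s\<^sup>2)) =
            - ((\<nu> (c * c' * x, 0) * (\<nu> (- 1, 0) * \<nu> (s, 0))) *
              \<xi> ((a / (c * y) + d' / (c' * x)) + (- (A + B) / s)) * j (A * B / s\<^sup>2))"
          unfolding P_def xi_add by (simp only: mult_ac mult_minus_left mult_minus_right)
        have 2: "\<nu> (c * c' * x, 0) * (\<nu> (- 1, 0) * \<nu> (s, 0)) = \<nu> (- (c * a' + d * c') * x, 0)"
          unfolding c'' by (simp add: nu_real_mult[symmetric] mult_ac)
        have 3: "A * B / s\<^sup>2 = det (g ** h) / ((c * a' + d * c')\<^sup>2 * y * x)"
          unfolding DD c'' A_def B_def by (simp add: power2_eq_square)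
        \<comment> \<open>Subtracting A / s and B / s replaces the diagonal entries a and d' of the
          factors by those of the product, and the denominators c and c' by the lower left entry of
          the product.\<close>
        have 4: "(a / (c * y) + d' / (c' * x)) + (- (A + B) / s) =
            (a * a' + b * c') / ((c * a' + d * c') * y) + (c * b' + d * d') / ((c * a' + d * c') * x)"
        proof -
          have p: "a / (c * y) - A / s = (a * a' + b * c') / ((c * c' * s) * y)"
          proof -
            have "a / (c * y) - A / s = (a * (c * c' * s) - D * c') / (c * (c * c' * s) * y)"
              using c c' y False by (simp add: A_def field_simps power2_eq_square)
            also have "a * (c * c' * s) - D * c' = c * (a * a' + b * c')"
              unfolding c''[symmetric] by (simp add: D_def algebra_simps)
            also have "c * (a * a' + b * c') / (c * (c * c' * s) * y) = (a * a' + b * c') / ((c * c' * s) * y)"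
              using c by simp
            finally show ?thesis .
          qed
          have r: "d' / (c' * x) - B / s = (c * b' + d * d') / ((c * c' * s) * x)"
          proof -
            have "d' / (c' * x) - B / s = (d' * (c * c' * s) - D' * c) / (c' * (c * c' * s) * x)"
              using c c' x False by (simp add: B_def field_simps power2_eq_square)
            also have "d' * (c * c' * s) - D' * c = c' * (c * b' + d * d')"
              unfolding c''[symmetric] by (simp add: D'_def algebra_simps)
            also have "c' * (c * b' + d * d') / (c' * (c * c' * s) * x) = (c * b' + d * d') / ((c * c' * s) * x)"
              using c' by simp
            finally show ?thesis .
          qed
          have "(a / (c * y) + d' / (c' * x)) + (- (A + B) / s) = (a / (c * y) - A / s) + (d' / (c' * x) - B / s)"
            by (simp add: add_divide_distrib diff_divide_distrib)
          then show ?thesis unfolding c'' p r .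
        qed
        have "ker (g ** h) y x = - (\<nu> (- (c * a' + d * c') * x, 0) *
            \<xi> ((a * a' + b * c') / ((c * a' + d * c') * y) + (c * b' + d * d') / ((c * a' + d * c') * x)) *
            j (det (g ** h) / ((c * a' + d * c')\<^sup>2 * y * x)))"
          unfolding ker_def gh m2_mult m2_nth Let_def if_not_P[OF c3] by (rule refl)
        then show ?thesis
          unfolding main if_not_P[OF False] 1 unfolding 2 3 4 by (rule sym)
      qed
    qed
  qed
qed

lemma group_rep_cusp: "group_rep GL2 \<rho>"
proof -
  interpret S: vector_space "scal \<rho>"
    unfolding cusp_simps by (rule fun_space.vector_space_axioms)
  have sub: "S.subspace (vspace \<rho>)"
    unfolding S.subspace_def by (auto simp: cusp_simps)
  have act_fun: "act \<rho> g f = (\<lambda>y. if y = 0 then 0 else \<Sum>x\<in>UNIV - {0}. ker g y x * f x)"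
    if "g \<in> carrier GL2" for g f
    using that by (auto simp: fun_eq_iff act_cusp_0 act_ker carrier_GL2)
  have add: "act \<rho> g (v + w) = act \<rho> g v + act \<rho> g w" if "g \<in> carrier GL2" for g v w
  proof
    show "act \<rho> g (v + w) y = (act \<rho> g v + act \<rho> g w) y" for y
      unfolding act_fun[OF that] plus_fun_def distrib_left sum.distrib by simp
  qed
  have scal: "act \<rho> g (scal \<rho> c v) = scal \<rho> c (act \<rho> g v)" if "g \<in> carrier GL2" for g v c
  proof
    have "(\<Sum>x\<in>UNIV - {0}. ker g y x * (c * v x)) = c * (\<Sum>x\<in>UNIV - {0}. ker g y x * v x)" for y
      by (simp only: sum_distrib_left mult.left_commute)
    then show "act \<rho> g (scal \<rho> c v) y = scal \<rho> c (act \<rho> g v) y" for y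
      unfolding act_fun[OF that] cusp_simps by simp
  qed
  have one: "act \<rho> (mat 1) v = v" if "v 0 = 0" for v
    using that by (auto simp: mat_m2 cusp_rep_def Let_def fun_eq_iff nu)
  have mult: "act \<rho> (g ** h) v = act \<rho> g (act \<rho> h v)" if gh: "g \<in> carrier GL2" "h \<in> carrier GL2" for g h v
  proof
    fix y
    show "act \<rho> (g ** h) v y = act \<rho> g (act \<rho> h v) y"
    proof (cases "y = 0")
      case False
      have d: "det g \<noteq> 0" "det h \<noteq> 0" "det (g ** h) \<noteq> 0"
        using gh by (simp_all add: carrier_GL2 det_mul)
      have "act \<rho> g (act \<rho> h v) y = (\<Sum>z\<in>UNIV - {0}. ker g y z * (\<Sum>x\<in>UNIV - {0}. ker h z x * v x))"
        using False d by (simp add: act_ker)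
      also have "\<dots> = (\<Sum>z\<in>UNIV - {0}. \<Sum>x\<in>UNIV - {0}. ker g y z * ker h z x * v x)"
        by (simp only: sum_distrib_left mult.assoc)
      also have "\<dots> = (\<Sum>x\<in>UNIV - {0}. \<Sum>z\<in>UNIV - {0}. ker g y z * ker h z x * v x)"
        by (rule sum.swap)
      also have "\<dots> = (\<Sum>x\<in>UNIV - {0}. ker (g ** h) y x * v x)"
        unfolding sum_distrib_right[symmetric] using d False by (intro sum.cong) (auto simp: ker_mult)
      also have "\<dots> = act \<rho> (g ** h) v y" using False d by (simp add: act_ker)
      finally show ?thesis by simp
    qed (simp add: act_cusp_0)
  qed
  show ?thesis
    by unfold_locales
      (use sub in \<open>auto simp: add scal mult one one_GL2 mult_GL2 act_cusp_0 cusp_simps(1)\<close>)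
qed

end

section \<open>The character of a cuspidal representation and the scalars of class sums\<close>

context cuspidal
begin

definition dl :: "'a \<Rightarrow> 'a \<Rightarrow> complex" where
  "dl y = (\<lambda>z. if z = y then 1 else 0)"

lemma dl_in: "y \<noteq> 0 \<Longrightarrow> dl y \<in> vspace \<rho>"
  by (auto simp: dl_def cusp_simps)

lemma act_dl:
  assumes "det g \<noteq> 0" "y \<noteq> 0" "x \<noteq> 0"
  shows "act \<rho> g (dl x) y = ker g y x"
proof -
  have "(\<Sum>z\<in>UNIV - {0}. ker g y z * dl x z) = (\<Sum>z\<in>UNIV - {0}. if z = x then ker g y x else 0)"
    by (intro sum.cong) (auto simp: dl_def)
  then show ?thesis using assms by (simp add: act_ker)
qed

lemma cusp_expand:
  assumes "f \<in> vspace \<rho>" shows "f = (\<Sum>x\<in>UNIV - {0}. scal \<rho> (f x) (dl x))"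
proof
  fix y
  have "(\<Sum>x\<in>UNIV - {0}. scal \<rho> (f x) (dl x)) y = (\<Sum>x\<in>UNIV - {0}. if x = y then f y else 0)"
    unfolding sum_fun_apply by (intro sum.cong) (auto simp: cusp_simps dl_def)
  also have "\<dots> = f y" using assms by (auto simp: cusp_simps)
  finally show "f y = (\<Sum>x\<in>UNIV - {0}. scal \<rho> (f x) (dl x)) y" by simp
qed

lemma act_unipotent: "y \<noteq> 0 \<Longrightarrow> act \<rho> (m2 1 \<beta> 0 1) f y = \<xi> (\<beta> * inverse y) * f y"
  by (simp add: cusp_rep_def nu)

lemma act_torus: "y \<noteq> 0 \<Longrightarrow> act \<rho> (m2 a 0 0 1) f y = f (inverse a * y)"
  by (simp add: cusp_rep_def nu)

text \<open>Here u is a root of (X - a) (X - d). With r the second component of u, comparing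
  discriminants gives (a - d)^2 = 4 \<eta> r^2, and since \<eta> is not a square both sides vanish.
  The proof states this as the vanishing of a norm.\<close>

lemma norm_trace_split:
  assumes "nrm \<eta> u = a * d" "trc \<eta> u = a + d"
  shows "a = d" "u = (d, 0)"
proof -
  obtain p r where u: "u = (p, r)" by (cases u)
  have p: "2 * p = a + d" and n: "p\<^sup>2 - \<eta> * r\<^sup>2 = a * d"
    using assms by (simp_all add: u trc_simp nrm_simp)
  have "nrm \<eta> (a - d, 2 * r) = (a + d)\<^sup>2 - 4 * (a * d) - 4 * (\<eta> * r\<^sup>2)"
    by (simp add: nrm_simp power2_eq_square algebra_simps)
  also have "\<dots> = 0"
    unfolding p[symmetric] n[symmetric] by (simp add: power2_eq_square algebra_simps)
  finally have "(a - d, 2 * r) = (0, 0)" by (simp only: nrm_eq_0)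
  then have ad: "a = d" and r: "r = 0" using two_nz by auto
  have "2 * p = 2 * d" using p ad by simp
  then have "p = d" using two_nz by simp
  then show "a = d" "u = (d, 0)" using ad r u by auto
qed

lemma trace_cusp_scalar:
  assumes "z \<noteq> 0"
  shows "(\<Sum>y\<in>UNIV - {0}. ker (mat z) y y) = of_nat (CARD('a) - 1) * \<nu> (z, 0)"
proof -
  have "(\<Sum>y\<in>UNIV - {0}. ker (mat z) y y) = (\<Sum>y\<in>UNIV - {0::'a}. \<nu> (z, 0))"
    using assms by (intro sum.cong) (auto simp: mat_m2 ker_def)
  then show ?thesis by (simp add: card_Diff_singleton)
qed

text \<open>The sum on the right runs over the u for which u and \<open>conjg u\<close> are the
  eigenvalues of g. For nonzero c, expanding \<open>j\<close> turns the sum over y into a sum of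
  \<xi> ((t - trc u) / (c y)), which detects \<open>trc\<close> u = t. Because y = 0 is missing, a
  remainder - \<nu> u is left for each u, and these add up to 0 over a norm fibre.\<close>

lemma trace_cusp:
  assumes g: "det g \<noteq> 0" and ns: "\<And>z. g \<noteq> mat z"
  shows "(\<Sum>y\<in>UNIV - {0}. ker g y y) = - (\<Sum>u | nrm \<eta> u = det g \<and> trc \<eta> u = trace g. \<nu> u)"
proof (rule m2_cases[of g])
  fix a b c d assume gm: "g = m2 a b c d"
  let ?q = "of_nat CARD('a) :: complex"
  show ?thesis
  proof (cases "c = 0")
    case c: True
    then have nz: "a \<noteq> 0" "d \<noteq> 0" using g gm by auto
    have tr: "det g = a * d" "trace g = a + d" using c gm by simp_all
    show ?thesis
    proof (cases "a = d")
      case True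
      then have b: "b \<noteq> 0" using ns[of d] c gm by (auto simp: mat_m2)
      have "{u. nrm \<eta> u = a * d \<and> trc \<eta> u = a + d} = {(d, 0)}"
        using norm_trace_split[of _ a d] True
        by (auto simp: nrm_simp trc_simp power2_eq_square)
      moreover have "(\<Sum>y\<in>UNIV - {0}. ker g y y) = (\<Sum>y\<in>UNIV - {0}. \<nu> (d, 0) * \<xi> (b / d * inverse y))"
        using c True nz by (intro sum.cong) (auto simp: gm ker_def divide_inverse mult_ac)
      moreover have "\<dots> = \<nu> (d, 0) * (\<Sum>y\<in>UNIV - {0}. \<xi> (b / d * inverse y))"
        by (simp only: sum_distrib_left)
      moreover have "\<dots> = - \<nu> (d, 0)"
        unfolding sum_xi_inverse using b nz by simp
      ultimately show ?thesis unfolding tr by simp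
    next
      case False
      then have "{u. nrm \<eta> u = a * d \<and> trc \<eta> u = a + d} = {}"
        using norm_trace_split[of _ a d] by auto
      moreover have "(\<Sum>y\<in>UNIV - {0}. ker g y y) = 0"
        using c False nz by (intro sum.neutral) (auto simp: gm ker_def field_simps)
      ultimately show ?thesis unfolding tr by (simp only: sum.empty minus_zero)
    qed
  next
    case c: False
    define D t where "D = det g" and "t = trace g"
    have D: "D \<noteq> 0" using g by (simp add: D_def)
    have t: "t = a + d" by (simp add: t_def gm)
    have kterm: "?q * ker g y y = - (\<Sum>u | nrm \<eta> u = D. \<nu> u * \<xi> ((t - trc \<eta> u) / c * inverse y))"
      if y: "y \<noteq> 0" for y
    proof -
      \<comment> \<open>This choice makes \<nu> (- c y) \<nu> (k) equal to 1 and D k^2 equal to the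
        argument of \<open>j\<close>.\<close>
      define k where "k = - 1 / (c * y)"
      have k: "k \<noteq> 0" using c y by (simp add: k_def)
      have Dk: "D / (c\<^sup>2 * y * y) = D * k\<^sup>2" by (simp add: k_def power2_eq_square)
      have "?q * ker g y y = - (\<nu> (- c * y, 0) * \<xi> (a / (c * y) + d / (c * y)) * (?q * j (D * k\<^sup>2)))"
        using c unfolding Dk[symmetric] by (simp add: ker_def gm D_def)
      also have "\<dots> = - ((\<nu> (- c * y, 0) * \<nu> (k, 0)) * \<xi> (a / (c * y) + d / (c * y)) *
          (\<Sum>u | nrm \<eta> u = D. \<nu> u * \<xi> (k * trc \<eta> u)))"
        unfolding j_scaled[OF k D, symmetric] by (simp only: mult_ac)
      also have "\<nu> (- c * y, 0) * \<nu> (k, 0) = 1"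
        using c y by (simp add: nu_real_mult[symmetric] k_def nu)
      also have "1 * \<xi> (a / (c * y) + d / (c * y)) * (\<Sum>u | nrm \<eta> u = D. \<nu> u * \<xi> (k * trc \<eta> u)) =
          (\<Sum>u | nrm \<eta> u = D. \<nu> u * \<xi> ((t - trc \<eta> u) / c * inverse y))"
        unfolding sum_distrib_left
      proof (rule sum.cong[OF refl])
        fix u
        have "a / (c * y) + d / (c * y) + k * trc \<eta> u = (t - trc \<eta> u) / c * inverse y"
          using c y by (simp add: k_def t field_simps)
        then have "\<xi> ((t - trc \<eta> u) / c * inverse y) = \<xi> (a / (c * y) + d / (c * y)) * \<xi> (k * trc \<eta> u)"
          by (simp only: xi_add[symmetric])
        then show "1 * \<xi> (a / (c * y) + d / (c * y)) * (\<nu> u * \<xi> (k * trc \<eta> u)) =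
            \<nu> u * \<xi> ((t - trc \<eta> u) / c * inverse y)" by (simp only: mult_1_left mult_ac)
      qed
      finally show ?thesis .
    qed
    have "?q * (\<Sum>y\<in>UNIV - {0}. ker g y y) =
        (\<Sum>y\<in>UNIV - {0}. - (\<Sum>u | nrm \<eta> u = D. \<nu> u * \<xi> ((t - trc \<eta> u) / c * inverse y)))"
      unfolding sum_distrib_left by (intro sum.cong) (auto simp: kterm)
    also have "\<dots> = - (\<Sum>u | nrm \<eta> u = D. \<Sum>y\<in>UNIV - {0}. \<nu> u * \<xi> ((t - trc \<eta> u) / c * inverse y))"
      unfolding sum_negf by (subst sum.swap) (rule refl)
    also have "\<dots> = - (\<Sum>u | nrm \<eta> u = D. (if trc \<eta> u = t then ?q * \<nu> u else 0) - \<nu> u)"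
    proof -
      have "(\<Sum>y\<in>UNIV - {0}. \<nu> u * \<xi> ((t - trc \<eta> u) / c * inverse y)) =
          (if trc \<eta> u = t then ?q * \<nu> u else 0) - \<nu> u" for u
        unfolding sum_distrib_left[symmetric] sum_xi_inverse using c by (auto simp: algebra_simps)
      then show ?thesis by simp
    qed
    also have "\<dots> = - (\<Sum>u | nrm \<eta> u = D. if trc \<eta> u = t then ?q * \<nu> u else 0)"
      by (simp add: sum_subtractf sum_norm_fibre[OF \<nu>])
    also have "\<dots> = ?q * - (\<Sum>u | nrm \<eta> u = D \<and> trc \<eta> u = t. \<nu> u)"
      by (simp add: sum.If_cases sum_distrib_left Collect_conj_eq)
    finally show ?thesis unfolding D_def t_def by (subst (asm) mult_cancel_left) simp
  qed
qed

text \<open>Class size times character value, divided by the dimension q - 1.\<close>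

definition omega_cusp :: "'a \<Rightarrow> 'a \<Rightarrow> complex" where
  "omega_cusp d t = - (\<Sum>g\<in>carrier GL2. cls d t g) / of_nat (CARD('a) - 1) *
     (\<Sum>u | nrm \<eta> u = d \<and> trc \<eta> u = t. \<nu> u)"

text \<open>A class sum commutes with the unipotent matrices, so it is diagonal in the basis of point
  masses; it commutes with the torus, so its diagonal entries agree and can be read off the trace.\<close>

lemma class_sum_cusp:
  assumes f: "f \<in> vspace \<rho>"
  shows "class_sum GL2 \<rho> (cls d t) f = scal \<rho> (omega_cusp d t) f"
proof -
  interpret R: group_rep GL2 \<rho> by (rule group_rep_cusp)
  define Z where "Z = class_sum GL2 \<rho> (cls d t)"
  have Z_in: "Z v \<in> vspace \<rho>" if "v \<in> vspace \<rho>" for v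
    unfolding Z_def by (rule R.class_sum_in[OF that])
  have Z_act: "Z (act \<rho> h v) = act \<rho> h (Z v)" if "h \<in> carrier GL2" "v \<in> vspace \<rho>" for h v
    unfolding Z_def by (rule R.class_sum_act[OF conj_invariant_cls that])
  have Z_scal: "Z (scal \<rho> c v) = scal \<rho> c (Z v)" if "v \<in> vspace \<rho>" for c v
    unfolding Z_def by (rule R.class_sum_scal[OF that])
  have Z0: "Z v 0 = 0" if "v \<in> vspace \<rho>" for v
    using Z_in[OF that] by (simp add: cusp_simps)
  have off: "Z (dl x) y = 0" if xy: "x \<noteq> 0" "y \<noteq> 0" "x \<noteq> y" for x y
  proof -
    obtain h where h: "\<xi> h \<noteq> 1" using \<xi>_nontriv by auto
    \<comment> \<open>Chosen so that \<beta> / x - \<beta> / y = h: the unipotent matrix then has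
      different eigenvalues on the point masses at x and at y.\<close>
    define \<beta> where "\<beta> = h / (inverse x - inverse y)"
    have d: "inverse x - inverse y \<noteq> 0" using xy by simp
    have "\<beta> * inverse x - \<beta> * inverse y = \<beta> * (inverse x - inverse y)"
      by (simp only: right_diff_distrib)
    also have "\<dots> = h"
      by (simp only: \<beta>_def times_divide_eq_left nonzero_mult_div_cancel_right[OF d])
    finally have "\<beta> * inverse x = \<beta> * inverse y + h" by (simp add: diff_eq_eq add.commute)
    then have ne: "\<xi> (\<beta> * inverse x) \<noteq> \<xi> (\<beta> * inverse y)"
      using h xi_nz by (simp add: xi_add)
    have "act \<rho> (m2 1 \<beta> 0 1) (dl x) = scal \<rho> (\<xi> (\<beta> * inverse x)) (dl x)"
    proof
      show "act \<rho> (m2 1 \<beta> 0 1) (dl x) z = scal \<rho> (\<xi> (\<beta> * inverse x)) (dl x) z" for z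
        using xy by (cases "z = 0") (auto simp: act_cusp_0 act_unipotent dl_def cusp_simps)
    qed
    then have "scal \<rho> (\<xi> (\<beta> * inverse x)) (Z (dl x)) = act \<rho> (m2 1 \<beta> 0 1) (Z (dl x))"
      using Z_act[of "m2 1 \<beta> 0 1" "dl x"] Z_scal[of "dl x"] dl_in xy by (simp add: carrier_GL2)
    then have "scal \<rho> (\<xi> (\<beta> * inverse x)) (Z (dl x)) y = act \<rho> (m2 1 \<beta> 0 1) (Z (dl x)) y" by simp
    then show ?thesis using ne xy by (simp add: cusp_simps act_unipotent)
  qed
  define om where "om = Z (dl 1) 1"
  have diag: "Z (dl x) x = om" if x: "x \<noteq> 0" for x
  proof -
    have "act \<rho> (m2 x 0 0 1) (dl 1) = dl x"
    proof
      show "act \<rho> (m2 x 0 0 1) (dl 1) z = dl x z" for z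
        using x by (cases "z = 0") (auto simp: act_cusp_0 act_torus dl_def field_simps)
    qed
    then have "Z (dl x) = act \<rho> (m2 x 0 0 1) (Z (dl 1))"
      using Z_act[of "m2 x 0 0 1" "dl 1"] dl_in x by (simp add: carrier_GL2)
    then show ?thesis using x by (simp add: act_torus om_def)
  qed
  have Z_dl: "Z (dl x) = scal \<rho> (om) (dl x)" if x: "x \<noteq> 0" for x
  proof
    show "Z (dl x) y = scal \<rho> (om) (dl x) y" for y
      using x off[of x y] diag[of x] Z0[OF dl_in[OF x]]
      by (cases "y = 0"; cases "y = x") (auto simp: cusp_simps dl_def)
  qed
  have "Z f = Z (\<Sum>x\<in>UNIV - {0}. scal \<rho> (f x) (dl x))"
    using cusp_expand[OF f] by simp
  also have "\<dots> = (\<Sum>x\<in>UNIV - {0}. Z (scal \<rho> (f x) (dl x)))"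
    unfolding Z_def by (rule R.class_sum_sum) (simp add: R.scal_in dl_in)
  also have "\<dots> = (\<Sum>x\<in>UNIV - {0}. scal \<rho> (om) (scal \<rho> (f x) (dl x)))"
  proof (rule sum.cong[OF refl])
    fix x :: 'a assume "x \<in> UNIV - {0}"
    then have x: "x \<noteq> 0" by simp
    show "Z (scal \<rho> (f x) (dl x)) = scal \<rho> om (scal \<rho> (f x) (dl x))"
      unfolding Z_scal[OF dl_in[OF x]] Z_dl[OF x] by (rule R.V.scale_left_commute)
  qed
  also have "\<dots> = scal \<rho> (om) f"
    unfolding R.V.scale_sum_right[symmetric] cusp_expand[OF f, symmetric] ..
  finally have Zf: "Z f = scal \<rho> (om) f" .
  have "of_nat (CARD('a) - 1) * om = (\<Sum>x\<in>UNIV - {0}. Z (dl x) x)"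
    using diag by (simp add: card_Diff_singleton)
  also have "\<dots> = (\<Sum>x\<in>UNIV - {0}. \<Sum>g\<in>carrier GL2. cls d t g * ker g x x)"
    unfolding Z_def class_sum_def sum_fun_apply
    by (intro sum.cong) (auto simp: cusp_simps act_dl carrier_GL2)
  also have "\<dots> = (\<Sum>g\<in>carrier GL2. cls d t g * (\<Sum>x\<in>UNIV - {0}. ker g x x))"
    by (subst sum.swap) (simp only: sum_distrib_left)
  also have "\<dots> = (\<Sum>g\<in>carrier GL2. cls d t g * - (\<Sum>u | nrm \<eta> u = d \<and> trc \<eta> u = t. \<nu> u))"
    by (intro sum.cong) (auto simp: cls_def carrier_GL2 trace_cusp)
  also have "\<dots> = of_nat (CARD('a) - 1) * omega_cusp d t"
    using card_ge_2[where 'a='a] by (simp add: omega_cusp_def sum_distrib_right sum_negf)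
  finally have "om = omega_cusp d t"
    using card_ge_2[where 'a='a] by (subst (asm) mult_cancel_left) auto
  then show ?thesis using Zf by (simp add: Z_def)
qed

lemma independent_dl:
  shows "fun_space.independent (dl ` (UNIV - {0}))" "card (dl ` (UNIV - {0})) = CARD('a) - 1"
proof -
  have "fun_space.independent (dl ` (UNIV - {0})) \<and> card (dl ` (UNIV - {0})) = card (UNIV - {0::'a})"
    using independent_of_points[of "UNIV - {0}" dl "\<lambda>x. x"] by (auto simp: dl_def)
  then show "fun_space.independent (dl ` (UNIV - {0}))" "card (dl ` (UNIV - {0})) = CARD('a) - 1"
    by (simp_all add: card_Diff_singleton)
qed

end

section \<open>The Cartan subgroup\<close>

context quad_ext
begin

text \<open>The matrix of multiplication by w in the basis 1, i. This is why its determinant and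
  trace are the norm and the trace of w.\<close>

definition cm :: "'a \<times> 'a \<Rightarrow> 'a^2^2" where
  "cm w = m2 (fst w) (\<eta> * snd w) (snd w) (fst w)"

lemma cartan_eq: "cartan \<eta> = cm ` (UNIV - {(0, 0)})"
proof -
  have "cartan \<eta> = {cm (a, b) | a b. (a, b) \<noteq> (0, 0)}"
    by (simp add: cartan_def cm_def m2_def)
  then show ?thesis by auto
qed

lemma cm_mult: "cm u ** cm w = cm (u \<star> w)"
  by (cases u; cases w) (simp add: cm_def algebra_simps)

lemma det_cm: "det (cm w) = nrm \<eta> w"
  by (cases w) (simp add: cm_def nrm_simp power2_eq_square)

lemma trace_cm: "trace (cm w) = trc \<eta> w"
  by (cases w) (simp add: cm_def trc_simp)

lemma cm_GL2: "w \<noteq> (0, 0) \<Longrightarrow> cm w \<in> carrier GL2"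
  by (simp add: carrier_GL2 det_cm nrm_eq_0)

lemma cm_one: "cm (1, 0) = mat 1"
  by (simp add: cm_def mat_m2)

lemma inv_cm: "w \<noteq> (0, 0) \<Longrightarrow> inv\<^bsub>GL2\<^esub> (cm w) = cm (qinv w)"
  by (intro GL2.inv_equality)
    (auto simp: mult_GL2 cm_mult one_GL2 qm_comm[of "qinv w"] qm_qinv cm_one cm_GL2 qinv_eq_0)

lemma cartan_char_cm: "cartan_char \<nu> (cm w) = \<nu> w"
  by (simp add: cartan_char_def cm_def)

lemma subgroup_cartan: "subgroup (cartan \<eta>) GL2"
proof (rule GL2.subgroupI)
  show "cartan \<eta> \<subseteq> carrier GL2" unfolding cartan_eq using cm_GL2 by blast
  have "cm (1, 0) \<in> cartan \<eta>" unfolding cartan_eq by (rule imageI) simp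
  then show "cartan \<eta> \<noteq> {}" by blast
  show "inv\<^bsub>GL2\<^esub> a \<in> cartan \<eta>" if "a \<in> cartan \<eta>" for a
    using that qinv_eq_0 by (auto simp: cartan_eq inv_cm)
  show "a \<otimes>\<^bsub>GL2\<^esub> b \<in> cartan \<eta>" if "a \<in> cartan \<eta>" "b \<in> cartan \<eta>" for a b
    using that qm_eq_0 by (auto simp: cartan_eq mult_GL2 cm_mult simp del: qm_simp)
qed

lemma same_norm_trace:
  assumes "nrm \<eta> u = nrm \<eta> w" "trc \<eta> u = trc \<eta> w"
  shows "u = w \<or> u = conjg w"
proof -
  obtain a b where u: "u = (a, b)" by (cases u)
  obtain c d where w: "w = (c, d)" by (cases w)
  have "a = c" using assms(2) two_nz by (simp add: u w trc_simp)
  then have "b\<^sup>2 = d\<^sup>2" using assms(1) \<eta>_nz by (simp add: u w nrm_simp)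
  then show ?thesis using \<open>a = c\<close> by (auto simp: u w power2_eq_iff)
qed

end

context cuspidal
begin

lemma sum_same_norm_trace:
  assumes w: "snd w \<noteq> 0"
  shows "(\<Sum>u | nrm \<eta> u = nrm \<eta> w \<and> trc \<eta> u = trc \<eta> w. \<nu> u) = \<nu> w + bar \<nu> w"
proof -
  have ne: "w \<noteq> conjg w"
  proof
    assume "w = conjg w"
    from arg_cong[OF this, of snd] have "snd w = - snd w" unfolding conjg_def snd_conv .
    then have "2 * snd w = 0" unfolding eq_neg_iff_add_eq_0 mult_2 .
    then show False using two_nz w by simp
  qed
  have "{u. nrm \<eta> u = nrm \<eta> w \<and> trc \<eta> u = trc \<eta> w} = {w, conjg w}"
    using same_norm_trace[of _ w] by (auto simp: nrm_conjg trc_conjg)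
  then show ?thesis using ne by (simp add: bar_def)
qed

text \<open>One formula for all of C: at a scalar the trace is (q - 1) \<nu> w, which is - 2 \<nu> w
  corrected by (q + 1) \<nu> w.\<close>

lemma trace_cusp_cm:
  assumes w: "w \<noteq> (0, 0)"
  shows "(\<Sum>y\<in>UNIV - {0}. ker (cm w) y y) =
    - (\<nu> w + bar \<nu> w) + (if snd w = 0 then of_nat (CARD('a) + 1) * \<nu> w else 0)"
proof (cases "snd w = 0")
  case True
  then obtain z where z: "w = (z, 0)" "z \<noteq> 0" using w by (cases w) auto
  have "cm w = mat z" by (simp add: cm_def z mat_m2)
  moreover have "of_nat (CARD('a) - 1) = (of_nat CARD('a) - 1 :: complex)"
    using card_ge_2[where 'a='a] by (simp add: of_nat_diff)
  ultimately show ?thesis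
    using trace_cusp_scalar[OF z(2)] z by (simp add: bar_def algebra_simps)
next
  case False
  have ns: "cm w \<noteq> mat z" for z using False by (simp add: cm_def mat_m2)
  then show ?thesis
    using trace_cusp[of "cm w"] w False sum_same_norm_trace[OF False]
    by (simp add: det_cm trace_cm nrm_eq_0)
qed

text \<open>Both \<nu> and \<open>bar\<close> \<nu> are orthogonal to \<nu>0, so only the correction
  at the scalars survives, where \<nu> and \<nu>0 agree. The value is (q - 1) (q + 1), the order of
  C, which means that \<nu>0 occurs exactly once.\<close>

lemma multiplicity_one:
  assumes \<nu>0: "\<nu>0 \<in> characters Lx" and sharp: "sharp \<nu> = sharp \<nu>0"
    and ne: "\<nu> \<noteq> \<nu>0" "bar \<nu> \<noteq> \<nu>0"
  shows "(\<Sum>w\<in>UNIV - {(0, 0)}. inverse (\<nu>0 w) * (\<Sum>y\<in>UNIV - {0}. ker (cm w) y y)) \<noteq> 0"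
proof -
  let ?L = "UNIV - {(0, 0)} :: ('a \<times> 'a) set"
  have "(\<Sum>w\<in>?L. inverse (\<nu>0 w) * (\<Sum>y\<in>UNIV - {0}. ker (cm w) y y)) =
      (\<Sum>w\<in>?L. - (\<nu> w / \<nu>0 w) - bar \<nu> w / \<nu>0 w +
        (if snd w = 0 then of_nat (CARD('a) + 1) * (\<nu> w / \<nu>0 w) else 0))"
    by (intro sum.cong) (auto simp: trace_cusp_cm divide_inverse algebra_simps)
  also have "\<dots> = - (\<Sum>w\<in>?L. \<nu> w / \<nu>0 w) - (\<Sum>w\<in>?L. bar \<nu> w / \<nu>0 w) +
      (\<Sum>w\<in>?L. if snd w = 0 then of_nat (CARD('a) + 1) * (\<nu> w / \<nu>0 w) else 0)"
    by (simp only: sum.distrib sum_subtractf sum_negf)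
  also have "(\<Sum>w\<in>?L. \<nu> w / \<nu>0 w) = 0"
    using L.sum_characters_div[OF \<nu>_char \<nu>0] ne by (simp add: carrier_Lx)
  also have "(\<Sum>w\<in>?L. bar \<nu> w / \<nu>0 w) = 0"
    using L.sum_characters_div[OF bar_character[OF \<nu>_char] \<nu>0] ne by (simp add: carrier_Lx)
  also have "(\<Sum>w\<in>?L. if snd w = 0 then of_nat (CARD('a) + 1) * (\<nu> w / \<nu>0 w) else 0) =
      (\<Sum>w\<in>(\<lambda>z. (z, 0::'a)) ` (UNIV - {0::'a}). of_nat (CARD('a) + 1))"
  proof (rule sum.mono_neutral_cong_right)
    show "(if snd w = 0 then of_nat (CARD('a) + 1) * (\<nu> w / \<nu>0 w) else 0) = of_nat (CARD('a) + 1)"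
      if "w \<in> (\<lambda>z. (z, 0::'a)) ` (UNIV - {0::'a})" for w
      using that fun_cong[OF sharp] charL(1)[OF \<nu>0] by (auto simp: sharp_def)
  qed (auto simp: image_iff)
  also have "\<dots> = of_nat ((CARD('a) - 1) * (CARD('a) + 1))"
  proof -
    have "card ((\<lambda>z. (z, 0::'a)) ` (UNIV - {0::'a})) = CARD('a) - 1"
      by (simp add: card_image inj_on_def card_Diff_singleton)
    then show ?thesis by (simp only: sum_constant of_nat_mult)
  qed
  finally have "(\<Sum>w\<in>?L. inverse (\<nu>0 w) * (\<Sum>y\<in>UNIV - {0}. ker (cm w) y y)) =
      of_nat ((CARD('a) - 1) * (CARD('a) + 1))" by (simp only: minus_zero diff_0_right add_0_left)
  then show ?thesis
    unfolding of_nat_eq_0_iff using card_ge_2[where 'a='a] by (simp only: of_nat_eq_0_iff) simp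
qed

text \<open>A nonzero trace has a nonzero diagonal entry, say at y1. The functional \<open>l\<close>
  is the y1 coordinate of the unnormalised projection to the \<nu>0-isotypic part, so it does not
  vanish on \<open>dl y1\<close>. Any nonzero f generates \<open>dl y1\<close> under the group,
  hence is not annihilated by all translates of \<open>l\<close>.\<close>

lemma cusp_embeds:
  assumes \<nu>0: "\<nu>0 \<in> characters Lx" and sharp: "sharp \<nu> = sharp \<nu>0"
    and ne: "\<nu> \<noteq> \<nu>0" "bar \<nu> \<noteq> \<nu>0"
  shows "\<exists>T. intertwiner GL2 \<rho> (ind_rep GL2 (cartan \<eta>) (char_rep (cartan_char \<nu>0))) T \<and>
    (\<forall>f\<in>vspace \<rho>. T f = 0 \<longrightarrow> f = 0)"
proof -
  interpret R: group_rep GL2 \<rho> by (rule group_rep_cusp)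
  let ?L = "UNIV - {(0, 0)} :: ('a \<times> 'a) set"
  have "(\<Sum>y\<in>UNIV - {0}. \<Sum>w\<in>?L. inverse (\<nu>0 w) * ker (cm w) y y) \<noteq> 0"
    using multiplicity_one[OF assms] by (subst sum.swap) (simp only: sum_distrib_left not_False_eq_True)
  then obtain y1 where y1: "y1 \<noteq> 0" "(\<Sum>w\<in>?L. inverse (\<nu>0 w) * ker (cm w) y1 y1) \<noteq> 0"
    by (auto elim: sum.not_neutral_contains_not_neutral)
  define l where "l f = (\<Sum>w\<in>?L. inverse (\<nu>0 w) * act \<rho> (cm w) f y1)" for f
  have l_dl: "l (dl y1) \<noteq> 0"
  proof -
    have "l (dl y1) = (\<Sum>w\<in>?L. inverse (\<nu>0 w) * ker (cm w) y1 y1)"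
      unfolding l_def using y1(1) by (intro sum.cong) (auto simp: act_dl det_cm nrm_eq_0)
    then show ?thesis using y1(2) by simp
  qed
  have l_add: "l (v + w) = l v + l w" if "v \<in> vspace \<rho>" "w \<in> vspace \<rho>" for v w
    using that by (simp add: l_def R.act_add cm_GL2 distrib_left sum.distrib)
  have l_scal: "l (scal \<rho> c v) = c * l v" if "v \<in> vspace \<rho>" for c v
    unfolding l_def sum_distrib_left
  proof (rule sum.cong[OF refl])
    fix w :: "'a \<times> 'a" assume "w \<in> ?L"
    then have "act \<rho> (cm w) (scal \<rho> c v) y1 = c * act \<rho> (cm w) v y1"
      using R.act_scal[OF cm_GL2 that, of w c] by (simp add: cusp_simps(2))
    then show "inverse (\<nu>0 w) * act \<rho> (cm w) (scal \<rho> c v) y1 = c * (inverse (\<nu>0 w) * act \<rho> (cm w) v y1)"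
      by simp
  qed
  have l_equi: "l (act \<rho> h v) = cartan_char \<nu>0 h * l v" if hv: "h \<in> cartan \<eta>" "v \<in> vspace \<rho>" for h v
  proof -
    obtain u where u: "h = cm u" "u \<noteq> (0, 0)" using hv(1) by (auto simp: cartan_eq)
    have "l (act \<rho> h v) = (\<Sum>w\<in>?L. inverse (\<nu>0 w) * act \<rho> (cm (w \<star> u)) v y1)"
      unfolding l_def u(1) using u(2) hv(2)
      by (intro sum.cong) (auto simp: R.act_mult[symmetric] cm_GL2 mult_GL2 cm_mult simp del: qm_simp)
    also have "\<dots> = (\<Sum>w\<in>?L. \<nu>0 u * (inverse (\<nu>0 w) * act \<rho> (cm w) v y1))"
    proof (rule sum.reindex_bij_witness[of _ "\<lambda>w. w \<star> qinv u" "\<lambda>w. w \<star> u"])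
      show "\<nu>0 u * (inverse (\<nu>0 (w \<star> u)) * act \<rho> (cm (w \<star> u)) v y1) =
          inverse (\<nu>0 w) * act \<rho> (cm (w \<star> u)) v y1" if "w \<in> ?L" for w
        using charL(1)[OF \<nu>0 u(2)] charL(1)[OF \<nu>0, of w] that by (simp add: charL(4)[OF \<nu>0] field_simps)
    qed (use u(2) qinv_eq_0 in \<open>simp_all add: qm_assoc qm_qinv qm_comm[of "qinv u"] qm_eq_0\<close>)
    finally show ?thesis by (simp only: u(1) cartan_char_cm l_def sum_distrib_left)
  qed
  let ?T = "frob GL2 \<rho> l"
  have "f = 0" if f: "f \<in> vspace \<rho>" and T: "?T f = 0" for f
  proof (rule ccontr)
    assume "f \<noteq> 0"
    then obtain y0 where fy0: "f y0 \<noteq> 0" by (auto simp: fun_eq_iff)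
    have y0: "y0 \<noteq> 0" using fy0 f by (auto simp: cusp_simps)
    have l0: "l (act \<rho> g f) = 0" if "g \<in> carrier GL2" for g
      using fun_cong[OF T, of "inv\<^bsub>GL2\<^esub> g"] that by (simp add: frob_def)
    \<comment> \<open>The torus element that moves a nonzero value of f from y0 to y1.\<close>
    define a where "a = y1 / y0"
    define f' where "f' = act \<rho> (m2 a 0 0 1) f"
    have aG: "m2 a 0 0 1 \<in> carrier GL2" and uG: "m2 1 \<beta> 0 1 \<in> carrier GL2" for \<beta>
      using y0 y1(1) by (simp_all add: carrier_GL2 a_def)
    have f': "f' \<in> vspace \<rho>" using R.act_closed[OF aG f] by (simp add: f'_def)
    have f'y1: "f' y1 = f y0" using y0 y1(1) by (simp add: f'_def act_torus a_def)
    have l1: "l (act \<rho> (m2 1 \<beta> 0 1) f') = 0" for \<beta>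
      unfolding f'_def R.act_mult[OF uG aG f, symmetric] by (rule l0[OF GL2.m_closed[OF uG aG]])
    \<comment> \<open>Fourier inversion over the unipotent matrices: on functions they act as
      multiplication by \<xi> (\<beta> / y), so averaging against the conjugate phase at y1 isolates
      the point mass there.\<close>
    have exp: "(\<Sum>\<beta>\<in>UNIV. scal \<rho> (\<xi> (- \<beta> * inverse y1)) (act \<rho> (m2 1 \<beta> 0 1) f')) =
        scal \<rho> (of_nat CARD('a) * f' y1) (dl y1)"
    proof
      fix y
      show "(\<Sum>\<beta>\<in>UNIV. scal \<rho> (\<xi> (- \<beta> * inverse y1)) (act \<rho> (m2 1 \<beta> 0 1) f')) y =
          scal \<rho> (of_nat CARD('a) * f' y1) (dl y1) y"
      proof (cases "y = 0")
        case True
        then show ?thesis using y1(1) by (simp add: sum_fun_apply cusp_simps act_cusp_0 dl_def)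
      next
        case False
        have "(\<Sum>\<beta>\<in>UNIV. scal \<rho> (\<xi> (- \<beta> * inverse y1)) (act \<rho> (m2 1 \<beta> 0 1) f')) y =
            (\<Sum>\<beta>\<in>UNIV. \<xi> ((inverse y - inverse y1) * \<beta>)) * f' y"
          unfolding sum_fun_apply sum_distrib_right using False
          by (intro sum.cong) (auto simp: cusp_simps act_unipotent xi_add[symmetric] algebra_simps)
        also have "\<dots> = scal \<rho> (of_nat CARD('a) * f' y1) (dl y1) y"
          unfolding sum_xi by (auto simp: cusp_simps dl_def)
        finally show ?thesis .
      qed
    qed
    have l_sum: "l (\<Sum>i\<in>S. v i) = (\<Sum>i\<in>S. l (v i))" if "\<And>i. i \<in> S \<Longrightarrow> v i \<in> vspace \<rho>"
      for S :: "'a set" and v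
      using that
    proof (induction S rule: infinite_finite_induct)
      case (insert x S)
      have "l (v x + sum v S) = l (v x) + l (sum v S)"
        using insert.prems by (intro l_add R.sum_in) auto
      moreover have "l (sum v S) = (\<Sum>i\<in>S. l (v i))" using insert.IH insert.prems by blast
      ultimately show ?case by (simp only: sum.insert[OF insert.hyps])
    qed (use l_scal[OF R.zero_in, of 0] in auto)
    have "of_nat CARD('a) * f y0 * l (dl y1) = l (scal \<rho> (of_nat CARD('a) * f' y1) (dl y1))"
      using l_scal[OF dl_in[OF y1(1)]] f'y1 by simp
    also have "\<dots> = (\<Sum>\<beta>\<in>UNIV. l (scal \<rho> (\<xi> (- \<beta> * inverse y1)) (act \<rho> (m2 1 \<beta> 0 1) f')))"
      unfolding exp[symmetric] by (rule l_sum) (simp add: R.scal_in R.act_closed uG f')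
    also have "\<dots> = 0"
      using l_scal[OF R.act_closed[OF uG f']] l1 by simp
    finally show False using fy0 l_dl by simp
  qed
  moreover have "intertwiner GL2 \<rho> (ind_rep GL2 (cartan \<eta>) (char_rep (cartan_char \<nu>0))) ?T"
    by (rule intertwiner_frob[OF group_rep_cusp subgroup_cartan]) (rule l_add l_scal l_equi; assumption)+
  ultimately show ?thesis by blast
qed

end

section \<open>Representations induced from a character\<close>

locale ind_char = Group.group G + H: subgroup H G for G :: "('g, 'm) monoid_scheme" (structure) and H +
  fixes \<theta> :: "'g \<Rightarrow> complex"
  assumes \<theta>_nz: "h \<in> H \<Longrightarrow> \<theta> h \<noteq> 0"
    and \<theta>_mult: "h \<in> H \<Longrightarrow> k \<in> H \<Longrightarrow> \<theta> (h \<otimes> k) = \<theta> h * \<theta> k"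
    and finG: "finite (carrier G)"
begin

abbreviation "I \<equiv> ind_rep G H (char_rep \<theta>)"

lemma HG: "h \<in> H \<Longrightarrow> h \<in> carrier G"
  using H.subset by auto

lemma \<theta>_one: "\<theta> \<one> = 1"
  using \<theta>_nz[of \<one>] \<theta>_mult[of \<one> \<one>] by simp

lemma \<theta>_inv: "h \<in> H \<Longrightarrow> \<theta> (inv h) = inverse (\<theta> h)"
  using \<theta>_mult[of h "inv h"] by (simp add: HG \<theta>_one inverse_unique)

lemma group_rep_I: "group_rep G I"
proof (rule group_rep_ind_rep[OF is_group H.subgroup_axioms group_rep_char_rep])
  show "Group.group (G\<lparr>carrier := H\<rparr>)" by (rule H.subgroup_is_group[OF is_group])
qed (auto simp: \<theta>_nz \<theta>_mult)

lemma I_simps: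
  "scal I = (\<lambda>c F x. c * F x)"
  "act I g F = (\<lambda>x. if x \<in> carrier G then F (inv g \<otimes> x) else 0)"
  by (simp_all add: ind_rep_def char_rep_def cong: if_cong)

lemma I_mem: "F \<in> vspace I \<longleftrightarrow> (\<forall>x. x \<notin> carrier G \<longrightarrow> F x = 0) \<and>
    (\<forall>x\<in>carrier G. \<forall>h\<in>H. F (x \<otimes> h) = inverse (\<theta> h) * F x)"
  by (auto simp: ind_rep_def char_rep_def \<theta>_inv)

lemma I_mult: "F \<in> vspace I \<Longrightarrow> x \<in> carrier G \<Longrightarrow> h \<in> H \<Longrightarrow> F (x \<otimes> h) = inverse (\<theta> h) * F x"
  by (simp add: I_mem)

definition \<theta>0 :: "'g \<Rightarrow> complex" where
  "\<theta>0 x = (if x \<in> H then \<theta> x else 0)"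

lemma \<theta>0_left: "h \<in> H \<Longrightarrow> x \<in> carrier G \<Longrightarrow> \<theta>0 (h \<otimes> x) = \<theta> h * \<theta>0 x"
proof -
  assume h: "h \<in> H" and x: "x \<in> carrier G"
  have "h \<otimes> x \<in> H \<longleftrightarrow> x \<in> H"
  proof
    assume "h \<otimes> x \<in> H"
    then have "inv h \<otimes> (h \<otimes> x) \<in> H" using h by simp
    then show "x \<in> H" using h x by (simp add: m_assoc[symmetric] HG)
  qed (use h in simp)
  then show ?thesis using h by (simp add: \<theta>0_def \<theta>_mult)
qed

text \<open>The element of the induced space that is supported on the coset r H and has the value 1
  at r.\<close>

definition delta :: "'g \<Rightarrow> 'g \<Rightarrow> complex" where
  "delta r x = (if x \<in> carrier G \<and> inv r \<otimes> x \<in> H then inverse (\<theta> (inv r \<otimes> x)) else 0)"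

lemma delta_in:
  assumes r: "r \<in> carrier G" shows "delta r \<in> vspace I"
proof -
  have "delta r (x \<otimes> h) = inverse (\<theta> h) * delta r x" if x: "x \<in> carrier G" and h: "h \<in> H" for x h
  proof -
    have a: "inv r \<otimes> (x \<otimes> h) = (inv r \<otimes> x) \<otimes> h" using r x h by (simp add: m_assoc HG)
    have "(inv r \<otimes> x) \<otimes> h \<in> H \<longleftrightarrow> inv r \<otimes> x \<in> H"
    proof
      assume "(inv r \<otimes> x) \<otimes> h \<in> H"
      then have "(inv r \<otimes> x) \<otimes> h \<otimes> inv h \<in> H" using h by simp
      then show "inv r \<otimes> x \<in> H" using r x h by (simp add: m_assoc HG)
    qed (use h in simp)
    then show ?thesis using x h by (simp add: delta_def a \<theta>_mult HG)
  qed
  then show ?thesis by (auto simp: I_mem) (simp add: delta_def)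
qed

lemma delta_nz_iff:
  "x \<in> carrier G \<Longrightarrow> delta r x \<noteq> 0 \<longleftrightarrow> inv r \<otimes> x \<in> H"
  using \<theta>_nz by (simp add: delta_def)

lemma delta_span:
  assumes P: "P \<subseteq> carrier G"
    and ex: "\<And>x. x \<in> carrier G \<Longrightarrow> \<exists>p\<in>P. inv p \<otimes> x \<in> H"
    and uniq: "\<And>x p p'. x \<in> carrier G \<Longrightarrow> p \<in> P \<Longrightarrow> p' \<in> P \<Longrightarrow> inv p \<otimes> x \<in> H \<Longrightarrow> inv p' \<otimes> x \<in> H \<Longrightarrow> p = p'"
  shows "vspace I \<subseteq> fun_space.span (delta ` P)"
proof
  fix F assume F: "F \<in> vspace I"
  have fin: "finite P" using P finG by (rule finite_subset)
  have "F = (\<Sum>p\<in>P. (\<lambda>x. F p * delta p x))"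
  proof
    fix x
    show "F x = (\<Sum>p\<in>P. (\<lambda>x. F p * delta p x)) x"
    proof (cases "x \<in> carrier G")
      case True
      obtain p where p: "p \<in> P" "inv p \<otimes> x \<in> H" using ex[OF True] by auto
      have pG: "p \<in> carrier G" using p(1) P by auto
      have "(\<Sum>p\<in>P. F p * delta p x) = (\<Sum>p'\<in>P. if p' = p then F p * delta p x else 0)"
      proof (rule sum.cong[OF refl])
        fix p' assume p': "p' \<in> P"
        show "F p' * delta p' x = (if p' = p then F p * delta p x else 0)"
        proof (cases "p' = p")
          case False
          then have "inv p' \<otimes> x \<notin> H" using uniq[OF True p' p(1) _ p(2)] by blast
          then show ?thesis using False by (simp add: delta_def)
        qed simp
      qed
      also have "\<dots> = F p * delta p x" using fin p(1) by simp
      also have "\<dots> = F (p \<otimes> (inv p \<otimes> x))"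
        using I_mult[OF F pG p(2)] p(2) True by (simp add: delta_def)
      also have "p \<otimes> (inv p \<otimes> x) = x" using pG True by (simp add: m_assoc[symmetric])
      finally show ?thesis by (simp only: sum_fun_apply)
    next
      case False
      have "(\<Sum>p\<in>P. (\<lambda>x. F p * delta p x)) x = 0"
        using False by (simp add: sum_fun_apply delta_def)
      then show ?thesis using False F by (simp add: I_mem)
    qed
  qed
  also have "\<dots> \<in> fun_space.span (delta ` P)"
    by (intro fun_space.span_sum fun_space.span_scale fun_space.span_base) auto
  finally show "F \<in> fun_space.span (delta ` P)" .
qed

text \<open>Operators \<open>F \<mapsto> (x \<mapsto> \<Sum>h. m h * F (x h))\<close>: since \<open>F\<close> is right equivariant, the kernel
  \<open>m\<close> may be replaced by its average over \<open>H\<close>.\<close>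

definition avg :: "('g \<Rightarrow> complex) \<Rightarrow> 'g \<Rightarrow> complex" where
  "avg m h = (\<Sum>b\<in>H. m (h \<otimes> b) * inverse (\<theta> b))"

lemma avg_kernel:
  assumes F: "F \<in> vspace I" and x: "x \<in> carrier G"
  shows "of_nat (card H) * (\<Sum>h\<in>carrier G. m h * F (x \<otimes> h)) = (\<Sum>h\<in>carrier G. avg m h * F (x \<otimes> h))"
proof -
  have "(\<Sum>h\<in>carrier G. m h * F (x \<otimes> h)) = (\<Sum>h\<in>carrier G. m (h \<otimes> b) * inverse (\<theta> b) * F (x \<otimes> h))"
    if b: "b \<in> H" for b
  proof -
    have "(\<Sum>h\<in>carrier G. m h * F (x \<otimes> h)) = (\<Sum>h\<in>carrier G. m (h \<otimes> b) * F (x \<otimes> (h \<otimes> b)))"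
      by (rule sum.reindex_bij_witness[of _ "\<lambda>h. h \<otimes> b" "\<lambda>h. h \<otimes> inv b"])
        (use b in \<open>auto simp: m_assoc HG\<close>)
    also have "\<dots> = (\<Sum>h\<in>carrier G. m (h \<otimes> b) * inverse (\<theta> b) * F (x \<otimes> h))"
    proof (rule sum.cong[OF refl])
      fix h assume h: "h \<in> carrier G"
      have "F (x \<otimes> (h \<otimes> b)) = inverse (\<theta> b) * F (x \<otimes> h)"
        using I_mult[OF F, of "x \<otimes> h" b] x h b by (simp add: m_assoc HG)
      then show "m (h \<otimes> b) * F (x \<otimes> (h \<otimes> b)) = m (h \<otimes> b) * inverse (\<theta> b) * F (x \<otimes> h)"
        by (simp only: mult.assoc)
    qed
    finally show ?thesis .
  qed
  then have "(\<Sum>b\<in>H. \<Sum>h\<in>carrier G. m h * F (x \<otimes> h)) =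
      (\<Sum>b\<in>H. \<Sum>h\<in>carrier G. m (h \<otimes> b) * inverse (\<theta> b) * F (x \<otimes> h))"
    by (rule sum.cong[OF refl])
  also have "\<dots> = (\<Sum>h\<in>carrier G. avg m h * F (x \<otimes> h))"
    by (subst sum.swap) (simp only: avg_def sum_distrib_right)
  finally show ?thesis by simp
qed

lemma avg_right:
  assumes h: "h \<in> carrier G" and b: "b \<in> H"
  shows "avg m (h \<otimes> b) = \<theta> b * avg m h"
  unfolding avg_def sum_distrib_left
proof (rule sum.reindex_bij_witness[of _ "\<lambda>c. inv b \<otimes> c" "\<lambda>c. b \<otimes> c"])
  fix c assume c: "c \<in> H"
  show "\<theta> b * (m (h \<otimes> (b \<otimes> c)) * inverse (\<theta> (b \<otimes> c))) = m (h \<otimes> b \<otimes> c) * inverse (\<theta> c)"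
    using h b c \<theta>_nz[OF b] by (simp add: m_assoc HG \<theta>_mult)
qed (use b in \<open>auto simp: m_assoc[symmetric] HG\<close>)

text \<open>For a class function, g may be replaced by its conjugate under x; with h = x^-1 g^-1 x
  the left translate g^-1 x becomes the right translate x h. Only in this form can the equivariance
  of F under H be exploited.\<close>

lemma class_sum_kernel:
  assumes f: "conj_invariant G f" and x: "x \<in> carrier G"
  shows "class_sum G I f F x = (\<Sum>h\<in>carrier G. f (inv h) * F (x \<otimes> h))"
proof -
  have "class_sum G I f F x = (\<Sum>g\<in>carrier G. f g * F (inv g \<otimes> x))"
    unfolding class_sum_def I_simps sum_fun_apply using x by simp
  also have "\<dots> = (\<Sum>h\<in>carrier G. f (inv h) * F (x \<otimes> h))"
  proof (rule sum.reindex_bij_witness[of _ "\<lambda>h. x \<otimes> inv h \<otimes> inv x" "\<lambda>g. inv x \<otimes> inv g \<otimes> x"])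
    fix g assume g: "g \<in> carrier G"
    have "f (inv (inv x \<otimes> inv g \<otimes> x)) = f g"
    proof -
      have "inv (inv x \<otimes> inv g \<otimes> x) = inv x \<otimes> g \<otimes> inv (inv x)"
        using g x by (simp add: inv_mult_group m_assoc)
      moreover have "f (inv x \<otimes> g \<otimes> inv (inv x)) = f g"
        using f g inv_closed[OF x] unfolding conj_invariant_def by blast
      ultimately show ?thesis by (simp only:)
    qed
    moreover have "x \<otimes> (inv x \<otimes> inv g \<otimes> x) = inv g \<otimes> x"
      using g x by (simp add: m_assoc[symmetric])
    ultimately show "f (inv (inv x \<otimes> inv g \<otimes> x)) * F (x \<otimes> (inv x \<otimes> inv g \<otimes> x)) = f g * F (inv g \<otimes> x)"
      by simp
  next
    fix g assume g: "g \<in> carrier G"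
    have "x \<otimes> inv (inv x \<otimes> inv g \<otimes> x) \<otimes> inv x = x \<otimes> (inv x \<otimes> (g \<otimes> x)) \<otimes> inv x"
      using g x by (simp add: inv_mult_group)
    also have "x \<otimes> (inv x \<otimes> (g \<otimes> x)) = g \<otimes> x"
      using g x by (simp add: m_assoc[symmetric])
    also have "g \<otimes> x \<otimes> inv x = g" using g x by (simp add: m_assoc)
    finally show "x \<otimes> inv (inv x \<otimes> inv g \<otimes> x) \<otimes> inv x = g" .
  next
    fix h assume h: "h \<in> carrier G"
    have "inv x \<otimes> inv (x \<otimes> inv h \<otimes> inv x) \<otimes> x = inv x \<otimes> (x \<otimes> (h \<otimes> inv x)) \<otimes> x"
      using h x by (simp add: inv_mult_group)
    also have "inv x \<otimes> (x \<otimes> (h \<otimes> inv x)) = h \<otimes> inv x"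
      using h x by (simp add: m_assoc[symmetric])
    also have "h \<otimes> inv x \<otimes> x = h" using h x by (simp add: m_assoc)
    finally show "inv x \<otimes> inv (x \<otimes> inv h \<otimes> inv x) \<otimes> x = h" .
  qed (use x in auto)
  finally show ?thesis .
qed

text \<open>For a class function, b h c may be replaced by its conjugate h c b, so averaging on the
  right yields equivariance on the left as well.\<close>

lemma avg_class_left:
  assumes f: "conj_invariant G f" and h: "h \<in> carrier G" and b: "b \<in> H"
  shows "avg (\<lambda>g. f (inv g)) (b \<otimes> h) = \<theta> b * avg (\<lambda>g. f (inv g)) h"
  unfolding avg_def sum_distrib_left
proof (rule sum.reindex_bij_witness[of _ "\<lambda>c. c \<otimes> inv b" "\<lambda>c. c \<otimes> b"])
  fix c assume c: "c \<in> H"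
  have "inv b \<otimes> inv c \<otimes> inv h \<in> carrier G" using b c h by (simp add: HG)
  then have "f (b \<otimes> (inv b \<otimes> inv c \<otimes> inv h) \<otimes> inv b) = f (inv b \<otimes> inv c \<otimes> inv h)"
    using f HG[OF b] unfolding conj_invariant_def by blast
  moreover have "b \<otimes> (inv b \<otimes> inv c \<otimes> inv h) \<otimes> inv b = inv (b \<otimes> h \<otimes> c)"
  proof -
    have "b \<otimes> (inv b \<otimes> inv c \<otimes> inv h) = inv c \<otimes> inv h"
      using b c h by (simp add: m_assoc[symmetric] HG)
    then show ?thesis using b c h by (simp add: inv_mult_group m_assoc HG)
  qed
  moreover have "inv b \<otimes> inv c \<otimes> inv h = inv (h \<otimes> (c \<otimes> b))"
    using b c h by (simp add: inv_mult_group m_assoc HG)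
  ultimately have "f (inv (b \<otimes> h \<otimes> c)) = f (inv (h \<otimes> (c \<otimes> b)))" by simp
  then show "\<theta> b * (f (inv (h \<otimes> (c \<otimes> b))) * inverse (\<theta> (c \<otimes> b))) = f (inv (b \<otimes> h \<otimes> c)) * inverse (\<theta> c)"
    using b c \<theta>_nz[OF b] by (simp add: \<theta>_mult)
qed (use b in \<open>auto simp: m_assoc HG\<close>)

lemma avg_one_class: "avg (\<lambda>g. f (inv g)) \<one> = (\<Sum>b\<in>H. f b * \<theta> b)"
  unfolding avg_def
  by (rule sum.reindex_bij_witness[of _ "\<lambda>b. inv b" "\<lambda>b. inv b"]) (auto simp: HG \<theta>_inv)

end

section \<open>The parabolic representations\<close>

text \<open>This reads off from \<open>chi_hat_decomposition\<close> that \<open>chi_hat1\<close> is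
  a representation.\<close>

lemma group_rep_summand:
  assumes VW: "group_rep G (V \<oplus>\<^sub>R W)" and W: "vector_space (scal W)"
  shows "group_rep G W"
proof -
  interpret S: group_rep G "V \<oplus>\<^sub>R W" by fact
  interpret W: vector_space "scal W" by fact
  have s: "vspace (V \<oplus>\<^sub>R W) = vspace V \<times> vspace W" "scal (V \<oplus>\<^sub>R W) c (v, w) = (scal V c v, scal W c w)"
    "act (V \<oplus>\<^sub>R W) g (v, w) = (act V g v, act W g w)" for c g v w
    by (simp_all add: rep_sum_def)
  have v0: "0 \<in> vspace V" "0 \<in> vspace W" using S.zero_in by (auto simp: s zero_prod_def)
  have "W.subspace (vspace W)"
    unfolding W.subspace_def
    using v0 S.add_in[of "(0, _)" "(0, _)"] S.scal_in[of "(0, _)"] by (auto simp: s)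
  then show ?thesis
    using S.act_closed[of _ "(0, _)"] S.act_add[of _ "(0, _)" "(0, _)"] S.act_scal[of _ "(0, _)"]
      S.act_one[of "(0, _)"] S.act_mult[of _ _ "(0, _)"] v0
    by unfold_locales (auto simp: s)
qed

lemma borel_m2: "m2 a b c d \<in> borel \<longleftrightarrow> c = 0 \<and> a \<noteq> 0 \<and> d \<noteq> 0"
  by (auto simp: borel_def carrier_GL2)

lemma borelE:
  assumes "g \<in> borel" obtains a b d where "g = m2 a b 0 d" "a \<noteq> 0" "d \<noteq> 0"
  using assms by (cases g rule: m2_cases) (auto simp: borel_m2)

lemma bruhat:
  assumes "c \<noteq> 0"
  shows "m2 a b c d = m2 1 (a / c) 0 1 ** m2 0 1 1 0 ** m2 c d 0 (- (a * d - b * c) / c)"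
  using assms by (simp add: field_simps)

locale principal = quad_ext +
  fixes \<psi>1 \<psi>2 :: "'a \<Rightarrow> complex"
  assumes \<psi>1: "\<psi>1 \<in> characters (mult_grp Fq)" and \<psi>2: "\<psi>2 \<in> characters (mult_grp Fq)"
begin

lemmas ch1 = charactersD[OF \<psi>1]
lemmas ch2 = charactersD[OF \<psi>2]

abbreviation "bc \<equiv> borel_char \<psi>1 \<psi>2"

lemma bc_m2: "bc (m2 a b c d) = \<psi>1 a * \<psi>2 d"
  by (simp add: borel_char_def)

sublocale B: ind_char GL2 borel bc
proof (intro ind_char.intro subgroup_borel GL2.is_group ind_char_axioms.intro)
  show "bc h \<noteq> 0" if "h \<in> borel" for h
    using that ch1(1) ch2(1) by (auto elim!: borelE simp: bc_m2)
  show "bc (h \<otimes>\<^bsub>GL2\<^esub> k) = bc h * bc k" if "h \<in> borel" "k \<in> borel" for h k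
    using that ch1(2) ch2(2) by (auto elim!: borelE simp: bc_m2 mult_GL2)
qed simp

lemma chi_hat_eq: "chi_hat \<psi>1 \<psi>2 = B.I"
  by (simp add: chi_hat_def)

text \<open>By the Bruhat decomposition such a kernel is determined on the group by two numbers, its
  values at the identity and at \<open>m2 0 1 1 0\<close>. Both averaged class functions and the
  averaged kernel of the embedding are of this kind.\<close>

definition biequi :: "('a^2^2 \<Rightarrow> complex) \<Rightarrow> bool" where
  "biequi \<Phi> \<longleftrightarrow> (\<forall>b\<in>borel. \<forall>h\<in>carrier GL2. \<Phi> (b ** h) = bc b * \<Phi> h \<and> \<Phi> (h ** b) = bc b * \<Phi> h)"

lemma wm_GL2: "m2 0 1 1 0 \<in> carrier GL2"
  by (simp add: carrier_GL2)

lemma biequi_on: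
  assumes "biequi \<Phi>" "h \<in> borel" shows "\<Phi> h = bc h * \<Phi> (mat 1)"
proof -
  have "mat 1 \<in> (carrier GL2 :: ('a^2^2) set)" by (simp add: carrier_GL2 det_I)
  then have "\<Phi> (h ** mat 1) = bc h * \<Phi> (mat 1)" using assms unfolding biequi_def by blast
  then show ?thesis by simp
qed

lemma biequi_off:
  assumes \<Phi>: "biequi \<Phi>" and h: "m2 a b c d \<in> carrier GL2" and c: "c \<noteq> 0"
  shows "\<Phi> (m2 a b c d) = \<psi>1 c * \<psi>2 (- (a * d - b * c) / c) * \<Phi> (m2 0 1 1 0)"
proof -
  let ?u = "m2 1 (a / c) 0 1" and ?w = "m2 0 1 1 0 :: 'a^2^2" and ?b = "m2 c d 0 (- (a * d - b * c) / c)"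
  have u: "?u \<in> borel" and b: "?b \<in> borel" using h c by (simp_all add: borel_m2 carrier_GL2)
  have uw: "?u ** ?w \<in> carrier GL2" by (simp add: carrier_GL2)
  have "\<Phi> (m2 a b c d) = \<Phi> (?u ** ?w ** ?b)" by (simp only: bruhat[OF c])
  also have "\<dots> = bc ?b * \<Phi> (?u ** ?w)" using \<Phi> b uw unfolding biequi_def by blast
  also have "\<Phi> (?u ** ?w) = bc ?u * \<Phi> ?w" using \<Phi> u wm_GL2 unfolding biequi_def by blast
  finally show ?thesis by (simp add: bc_m2 ch1 ch2)
qed

lemma biequi_avg:
  assumes "\<And>b h. b \<in> borel \<Longrightarrow> h \<in> carrier GL2 \<Longrightarrow> B.avg m (b ** h) = bc b * B.avg m h"
  shows "biequi (B.avg m)"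
  using assms B.avg_right unfolding biequi_def by (simp add: mult_GL2)

lemma sum_on_borel:
  assumes F: "F \<in> vspace B.I" and x: "x \<in> carrier GL2"
  shows "(\<Sum>h\<in>borel. bc h * F (x ** h)) = of_nat (card (borel :: ('a^2^2) set)) * F x"
proof -
  have "(\<Sum>h\<in>borel. bc h * F (x ** h)) = (\<Sum>h\<in>(borel :: ('a^2^2) set). F x)"
    using B.I_mult[OF F x] B.\<theta>_nz by (intro sum.cong) (auto simp: mult_GL2)
  then show ?thesis by simp
qed

lemma borel_nonempty: "(borel :: ('a^2^2) set) \<noteq> {}"
  using B.H.one_closed by blast

lemma card_borel: "of_nat (card (borel :: ('a^2^2) set)) \<noteq> (0::complex)"
  using borel_nonempty by simp

text \<open>Conjugating by the torus shows that \<open>\<Phi>\<close> vanishes on the big cell, so only \<open>B\<close> contributes.\<close>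

lemma kernel_principal:
  assumes ne: "\<psi>1 \<noteq> \<psi>2" and \<Phi>: "biequi \<Phi>" and F: "F \<in> vspace B.I" and x: "x \<in> carrier GL2"
  shows "(\<Sum>h\<in>carrier GL2. \<Phi> h * F (x ** h)) = of_nat (card (borel :: ('a^2^2) set)) * (\<Phi> (mat 1) * F x)"
proof -
  let ?w = "m2 0 1 1 0 :: 'a^2^2"
  obtain a where a: "\<psi>1 a \<noteq> \<psi>2 a" using ne by (auto simp: fun_eq_iff)
  then have a0: "a \<noteq> 0" using ch1(5) ch2(5) by auto
  have t: "m2 a 0 0 1 \<in> borel" "m2 1 0 0 a \<in> borel" using a0 by (simp_all add: borel_m2)
  have "\<Phi> (m2 a 0 0 1 ** ?w) = bc (m2 a 0 0 1) * \<Phi> ?w" "\<Phi> (?w ** m2 1 0 0 a) = bc (m2 1 0 0 a) * \<Phi> ?w"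
    using \<Phi> wm_GL2 t unfolding biequi_def by blast+
  then have tw: "\<Phi> (m2 a 0 0 1 ** ?w) = \<psi>1 a * \<Phi> ?w" "\<Phi> (?w ** m2 1 0 0 a) = \<psi>2 a * \<Phi> ?w"
    by (simp_all only: bc_m2 ch1 ch2 mult_1_left mult_1_right)
  have "\<psi>1 a * \<Phi> ?w = \<Phi> (m2 a 0 0 1 ** ?w)" by (rule tw(1)[symmetric])
  also have "m2 a 0 0 1 ** ?w = ?w ** m2 1 0 0 a" by simp
  also have "\<Phi> \<dots> = \<psi>2 a * \<Phi> ?w" by (rule tw(2))
  finally have w0: "\<Phi> ?w = 0" using a by simp
  have off: "\<Phi> h = 0" if "h \<in> carrier GL2" "h \<notin> borel" for h
  proof (rule m2_cases[of h])
    fix a b c d assume h: "h = m2 a b c d"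
    have "c \<noteq> 0"
    proof
      assume "c = 0"
      then have "h \<in> borel" using that(1) unfolding h borel_def by simp
      then show False using that(2) by blast
    qed
    from biequi_off[OF \<Phi> that(1)[unfolded h] this] show ?thesis unfolding h w0 by simp
  qed
  have "(\<Sum>h\<in>carrier GL2. \<Phi> h * F (x ** h)) = (\<Sum>h\<in>borel. \<Phi> h * F (x ** h))"
  proof (rule sum.mono_neutral_right)
    show "borel \<subseteq> (carrier GL2 :: ('a^2^2) set)" using B.HG by blast
    show "\<forall>h\<in>carrier GL2 - borel. \<Phi> h * F (x ** h) = 0" by (simp add: off)
  qed simp
  also have "\<dots> = (\<Sum>h\<in>borel. \<Phi> (mat 1) * (bc h * F (x ** h)))"
    by (intro sum.cong) (auto simp: biequi_on[OF \<Phi>])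
  also have "\<dots> = \<Phi> (mat 1) * (of_nat (card (borel :: ('a^2^2) set)) * F x)"
    unfolding sum_distrib_left[symmetric] sum_on_borel[OF F x] ..
  finally show ?thesis by (simp only: mult.left_commute)
qed

definition omega_chi :: "'a \<Rightarrow> 'a \<Rightarrow> complex" where
  "omega_chi d t = (\<Sum>b\<in>borel. cls d t b * bc b)"

definition phi_cls :: "'a \<Rightarrow> 'a \<Rightarrow> 'a^2^2 \<Rightarrow> complex" where
  "phi_cls d t = B.avg (\<lambda>g. cls d t (inv\<^bsub>GL2\<^esub> g))"

lemma biequi_phi_cls: "biequi (phi_cls d t)"
  unfolding phi_cls_def
  by (rule biequi_avg) (use B.avg_class_left[OF conj_invariant_cls] in \<open>simp add: mult_GL2\<close>)

lemma phi_cls_one: "phi_cls d t (mat 1) = omega_chi d t"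
  using B.avg_one_class[of "cls d t"] by (simp add: phi_cls_def omega_chi_def one_GL2)

lemma class_sum_phi_cls:
  assumes F: "F \<in> vspace B.I" and x: "x \<in> carrier GL2"
  shows "of_nat (card (borel :: ('a^2^2) set)) * class_sum GL2 B.I (cls d t) F x =
    (\<Sum>h\<in>carrier GL2. phi_cls d t h * F (x ** h))"
  using B.avg_kernel[OF F x] B.class_sum_kernel[OF conj_invariant_cls x]
  by (simp add: phi_cls_def mult_GL2)

lemma class_sum_I_outside: "x \<notin> carrier GL2 \<Longrightarrow> class_sum GL2 B.I f F x = 0"
  by (simp add: class_sum_def sum_fun_apply B.I_simps)

lemma class_sum_chi_hat:
  assumes ne: "\<psi>1 \<noteq> \<psi>2" and F: "F \<in> vspace (chi_hat \<psi>1 \<psi>2)"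
  shows "class_sum GL2 (chi_hat \<psi>1 \<psi>2) (cls d t) F = scal (chi_hat \<psi>1 \<psi>2) (omega_chi d t) F"
proof
  fix x
  have F': "F \<in> vspace B.I" using F by (simp add: chi_hat_eq)
  show "class_sum GL2 (chi_hat \<psi>1 \<psi>2) (cls d t) F x = scal (chi_hat \<psi>1 \<psi>2) (omega_chi d t) F x"
  proof (cases "x \<in> carrier GL2")
    case True
    have "of_nat (card (borel :: ('a^2^2) set)) * class_sum GL2 B.I (cls d t) F x =
        of_nat (card (borel :: ('a^2^2) set)) * (omega_chi d t * F x)"
      unfolding class_sum_phi_cls[OF F' True] kernel_principal[OF ne biequi_phi_cls F' True] phi_cls_one ..
    then show ?thesis using borel_nonempty by (simp add: chi_hat_eq B.I_simps(1))
  next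
    case False
    then show ?thesis using F' by (simp add: chi_hat_eq class_sum_I_outside B.I_mem B.I_simps(1))
  qed
qed

section \<open>Mapping a parabolic representation into the representation induced from C\<close>

definition cartan_functional :: "('a \<times> 'a \<Rightarrow> complex) \<Rightarrow> ('a^2^2 \<Rightarrow> complex) \<Rightarrow> complex" where
  "cartan_functional \<nu>0 F = (\<Sum>w\<in>UNIV - {(0, 0)}. \<nu>0 w * F (cm w))"

definition embed :: "('a \<times> 'a \<Rightarrow> complex) \<Rightarrow> ('a^2^2 \<Rightarrow> complex) \<Rightarrow> 'a^2^2 \<Rightarrow> complex" where
  "embed \<nu>0 = frob GL2 B.I (cartan_functional \<nu>0)"

lemma embed_apply:
  assumes x: "x \<in> carrier GL2"
  shows "embed \<nu>0 F x = (\<Sum>w\<in>UNIV - {(0, 0)}. \<nu>0 w * F (x ** cm w))"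
  using x by (auto simp: embed_def frob_def cartan_functional_def B.I_simps cm_GL2 mult_GL2 intro!: sum.cong)

lemma intertwiner_embed:
  assumes \<nu>0: "\<nu>0 \<in> characters Lx"
  shows "intertwiner GL2 (chi_hat \<psi>1 \<psi>2) (ind_rep GL2 (cartan \<eta>) (char_rep (cartan_char \<nu>0))) (embed \<nu>0)"
  unfolding embed_def chi_hat_eq
proof (rule intertwiner_frob[OF B.group_rep_I subgroup_cartan])
  let ?L = "UNIV - {(0, 0)} :: ('a \<times> 'a) set"
  show "cartan_functional \<nu>0 (v + w) = cartan_functional \<nu>0 v + cartan_functional \<nu>0 w" for v w
    by (simp add: cartan_functional_def distrib_left sum.distrib)
  show "cartan_functional \<nu>0 (scal B.I c v) = c * cartan_functional \<nu>0 v" for c v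
    unfolding cartan_functional_def B.I_simps sum_distrib_left by (simp only: mult.left_commute)
  show "cartan_functional \<nu>0 (act B.I h v) = cartan_char \<nu>0 h * cartan_functional \<nu>0 v"
    if h: "h \<in> cartan \<eta>" for h v
  proof -
    obtain u where u: "h = cm u" "u \<noteq> (0, 0)" using h by (auto simp: cartan_eq)
    have "cartan_functional \<nu>0 (act B.I h v) = (\<Sum>w\<in>?L. \<nu>0 w * v (cm (qinv u \<star> w)))"
      using u unfolding cartan_functional_def
      by (intro sum.cong) (auto simp: B.I_simps cm_GL2 mult_GL2 inv_cm cm_mult simp del: qm_simp)
    also have "\<dots> = (\<Sum>w\<in>?L. \<nu>0 u * (\<nu>0 w * v (cm w)))"
    proof (rule sum.reindex_bij_witness[of _ "\<lambda>w. u \<star> w" "\<lambda>w. qinv u \<star> w"])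
      show "\<nu>0 u * (\<nu>0 (qinv u \<star> w) * v (cm (qinv u \<star> w))) = \<nu>0 w * v (cm (qinv u \<star> w))" for w
        using charL(1)[OF \<nu>0 u(2)] by (simp add: charL(4,5)[OF \<nu>0] u(2))
    qed (use u(2) qinv_eq_0 in \<open>simp_all add: qm_assoc[symmetric] qm_qinv qm_comm[of "qinv u" u] qm_eq_0\<close>)
    finally show ?thesis by (simp only: u(1) cartan_char_cm cartan_functional_def sum_distrib_left)
  qed
qed

text \<open>The kernel of the composition of \<open>embed\<close> with its adjoint, up to normalisation.\<close>

definition mker :: "('a \<times> 'a \<Rightarrow> complex) \<Rightarrow> 'a^2^2 \<Rightarrow> complex" where
  "mker \<nu>0 h = (\<Sum>w\<in>UNIV - {(0, 0)}. \<nu>0 w * B.\<theta>0 (h ** cm (qinv w)))"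

text \<open>The kernel collects the pairs (b, w) with product h = \<open>b ** cm w\<close>.\<close>

lemma embed_adjoint:
  assumes F: "F \<in> vspace B.I" and x: "x \<in> carrier GL2"
  shows "(\<Sum>b\<in>borel. bc b * embed \<nu>0 F (x ** b)) = (\<Sum>h\<in>carrier GL2. mker \<nu>0 h * F (x ** h))"
proof -
  let ?L = "UNIV - {(0, 0)} :: ('a \<times> 'a) set"
  have xb: "x ** b \<in> carrier GL2" if "b \<in> borel" for b
    using that x B.HG GL2.m_closed by (metis mult_GL2)
  have "(\<Sum>b\<in>borel. bc b * embed \<nu>0 F (x ** b)) =
      (\<Sum>b\<in>borel. \<Sum>w\<in>?L. \<nu>0 w * (bc b * F (x ** b ** cm w)))"
    by (intro sum.cong) (auto simp: embed_apply xb sum_distrib_left mult.left_commute)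
  also have "\<dots> = (\<Sum>w\<in>?L. \<nu>0 w * (\<Sum>b\<in>borel. bc b * F (x ** b ** cm w)))"
    by (subst sum.swap) (simp only: sum_distrib_left)
  also have "\<dots> = (\<Sum>w\<in>?L. \<nu>0 w * (\<Sum>h\<in>carrier GL2. B.\<theta>0 (h ** cm (qinv w)) * F (x ** h)))"
  proof (rule sum.cong[OF refl])
    fix w :: "'a \<times> 'a" assume "w \<in> ?L"
    then have w: "w \<noteq> (0, 0)" by simp
    have 1: "h ** cm (qinv w) ** cm w = h" "h ** cm w ** cm (qinv w) = h" for h
      using w by (simp_all add: matrix_mul_assoc[symmetric] cm_mult qm_qinv qm_comm[of "qinv w"] cm_one)
    have closed: "h ** cm w \<in> carrier GL2" "h ** cm (qinv w) \<in> carrier GL2" if "h \<in> carrier GL2" for h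
      using that cm_GL2[OF w] cm_GL2[OF qinv_eq_0[OF w]] GL2.m_closed by (metis mult_GL2)+
    have "(\<Sum>b\<in>borel. bc b * F (x ** b ** cm w)) = (\<Sum>b\<in>carrier GL2. B.\<theta>0 b * F (x ** b ** cm w))"
    proof (rule sum.mono_neutral_cong_left)
      show "borel \<subseteq> (carrier GL2 :: ('a^2^2) set)" using B.HG by blast
    qed (simp_all add: B.\<theta>0_def)
    also have "\<dots> = (\<Sum>h\<in>carrier GL2. B.\<theta>0 (h ** cm (qinv w)) * F (x ** h))"
      by (rule sum.reindex_bij_witness[of _ "\<lambda>h. h ** cm (qinv w)" "\<lambda>b. b ** cm w"])
        (auto simp: 1 closed matrix_mul_assoc)
    finally show "\<nu>0 w * (\<Sum>b\<in>borel. bc b * F (x ** b ** cm w)) =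
        \<nu>0 w * (\<Sum>h\<in>carrier GL2. B.\<theta>0 (h ** cm (qinv w)) * F (x ** h))" by simp
  qed
  also have "\<dots> = (\<Sum>h\<in>carrier GL2. \<Sum>w\<in>?L. \<nu>0 w * B.\<theta>0 (h ** cm (qinv w)) * F (x ** h))"
    by (subst sum.swap) (simp only: sum_distrib_left mult.assoc)
  also have "\<dots> = (\<Sum>h\<in>carrier GL2. mker \<nu>0 h * F (x ** h))"
    by (simp only: mker_def sum_distrib_right)
  finally show ?thesis .
qed

lemma mker_left:
  assumes b: "b \<in> borel" and h: "h \<in> carrier GL2"
  shows "mker \<nu>0 (b ** h) = bc b * mker \<nu>0 h"
  unfolding mker_def sum_distrib_left
proof (rule sum.cong[OF refl])
  fix w :: "'a \<times> 'a" assume "w \<in> UNIV - {(0, 0)}"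
  then have "h ** cm (qinv w) \<in> carrier GL2"
    using h cm_GL2 qinv_eq_0 GL2.m_closed by (metis mult_GL2 Diff_iff insertCI)
  then have "B.\<theta>0 (b ** (h ** cm (qinv w))) = bc b * B.\<theta>0 (h ** cm (qinv w))"
    using B.\<theta>0_left[OF b] by (simp add: mult_GL2)
  then show "\<nu>0 w * B.\<theta>0 (b ** h ** cm (qinv w)) = bc b * (\<nu>0 w * B.\<theta>0 (h ** cm (qinv w)))"
    by (simp only: matrix_mul_assoc[symmetric] mult.left_commute)
qed

lemma biequi_mker: "biequi (B.avg (mker \<nu>0))"
proof (rule biequi_avg)
  fix b h :: "'a^2^2" assume b: "b \<in> borel" and h: "h \<in> carrier GL2"
  have "mker \<nu>0 (b ** h ** c) = bc b * mker \<nu>0 (h ** c)" if "c \<in> borel" for c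
  proof -
    have "h ** c \<in> carrier GL2" using h B.HG[OF that] GL2.m_closed by (metis mult_GL2)
    from mker_left[OF b this] show ?thesis by (simp only: matrix_mul_assoc)
  qed
  then show "B.avg (mker \<nu>0) (b ** h) = bc b * B.avg (mker \<nu>0) h"
    unfolding B.avg_def sum_distrib_left by (intro sum.cong) (auto simp: mult_GL2)
qed

text \<open>The Borel and the Cartan subgroup meet exactly in the q - 1 scalars, and each
  contributes 1 because \<psi>1 \<psi>2 agrees with \<nu>0 there.\<close>

lemma mker_one:
  assumes \<nu>0: "\<nu>0 \<in> characters Lx" and sharp: "\<And>x. \<psi>1 x * \<psi>2 x = \<nu>0 (x, 0)"
  shows "mker \<nu>0 (mat 1) = of_nat (CARD('a) - 1)"
proof -
  have "mker \<nu>0 (mat 1) = (\<Sum>w\<in>(\<lambda>z. (z, 0::'a)) ` (UNIV - {0::'a}). 1)"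
    unfolding mker_def
  proof (rule sum.mono_neutral_cong_right)
    show "\<forall>w\<in>UNIV - {(0, 0)} - (\<lambda>z. (z, 0)) ` (UNIV - {0}). \<nu>0 w * B.\<theta>0 (mat 1 ** cm (qinv w)) = 0"
    proof
      fix w :: "'a \<times> 'a" assume w: "w \<in> UNIV - {(0, 0)} - (\<lambda>z. (z, 0)) ` (UNIV - {0})"
      then have "snd w \<noteq> 0" by (cases w) (auto simp: image_iff)
      then have "snd (qinv w) \<noteq> 0" using w nrm_eq_0[of w] by (auto simp: qinv_def)
      then show "\<nu>0 w * B.\<theta>0 (mat 1 ** cm (qinv w)) = 0"
        by (simp add: B.\<theta>0_def cm_def borel_m2)
    qed
    show "\<nu>0 w * B.\<theta>0 (mat 1 ** cm (qinv w)) = 1" if w: "w \<in> (\<lambda>z. (z, 0::'a)) ` (UNIV - {0})" for w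
    proof -
      obtain z where z: "w = (z, 0)" "z \<noteq> 0" using w by auto
      then have "cm (qinv w) = m2 (inverse z) 0 0 (inverse z)"
        by (simp add: cm_def qinv_def nrm_simp power2_eq_square divide_inverse)
      then have "B.\<theta>0 (mat 1 ** cm (qinv w)) = inverse (\<psi>1 z * \<psi>2 z)"
        using z by (simp add: B.\<theta>0_def borel_m2 bc_m2 ch1 ch2)
      then show ?thesis using sharp charL(1)[OF \<nu>0] z by simp
    qed
  qed auto
  then show ?thesis by (simp add: card_image inj_on_def card_Diff_singleton)
qed

lemma avg_mker_one:
  assumes \<nu>0: "\<nu>0 \<in> characters Lx" and sharp: "\<And>x. \<psi>1 x * \<psi>2 x = \<nu>0 (x, 0)"
  shows "B.avg (mker \<nu>0) (mat 1) = of_nat (card (borel :: ('a^2^2) set)) * of_nat (CARD('a) - 1)"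
proof -
  have "mker \<nu>0 (mat 1 ** b) * inverse (bc b) = of_nat (CARD('a) - 1)" if "b \<in> borel" for b
    using mker_left[OF that, of "mat 1"] mker_one[OF assms] B.\<theta>_nz[OF that]
    by (simp add: carrier_GL2 det_I)
  then show ?thesis by (simp add: B.avg_def mult_GL2)
qed

lemma embed_kernel:
  assumes F: "F \<in> vspace B.I" and 0: "embed \<nu>0 F = 0" and x: "x \<in> carrier GL2"
  shows "(\<Sum>h\<in>carrier GL2. B.avg (mker \<nu>0) h * F (x ** h)) = 0"
  using B.avg_kernel[OF F x, of "mker \<nu>0"] embed_adjoint[OF F x, of \<nu>0] 0
  by (simp add: mult_GL2)

lemma embed_injective:
  assumes ne: "\<psi>1 \<noteq> \<psi>2" and \<nu>0: "\<nu>0 \<in> characters Lx" and sharp: "\<And>x. \<psi>1 x * \<psi>2 x = \<nu>0 (x, 0)"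
    and F: "F \<in> vspace (chi_hat \<psi>1 \<psi>2)" and 0: "embed \<nu>0 F = 0"
  shows "F = 0"
proof
  fix x
  have F': "F \<in> vspace B.I" using F by (simp add: chi_hat_eq)
  have q: "of_nat (CARD('a) - 1) \<noteq> (0::complex)" using card_ge_2[where 'a='a] by simp
  show "F x = 0 x"
  proof (cases "x \<in> carrier GL2")
    case True
    have "of_nat (card (borel :: ('a^2^2) set)) * (B.avg (mker \<nu>0) (mat 1) * F x) = 0"
      using kernel_principal[OF ne biequi_mker F' True] embed_kernel[OF F' 0 True] by simp
    then show ?thesis unfolding avg_mker_one[OF \<nu>0 sharp] using borel_nonempty q by simp
  next
    case False
    then show ?thesis using F' by (simp add: B.I_mem)
  qed
qed

text \<open>\<open>GL2 / B\<close> is the projective line, with \<open>None\<close> as the point at infinity.\<close>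

definition coset_rep :: "'a option \<Rightarrow> 'a^2^2" where
  "coset_rep t = (case t of None \<Rightarrow> m2 0 1 1 0 | Some t \<Rightarrow> m2 1 0 t 1)"

lemma coset_rep_GL2: "coset_rep t \<in> carrier GL2"
  by (cases t) (simp_all add: coset_rep_def carrier_GL2)

lemma delta_coset_rep: "B.delta (coset_rep s) (coset_rep t) \<noteq> 0 \<longleftrightarrow> s = t"
  unfolding B.delta_nz_iff[OF coset_rep_GL2] mult_GL2
  by (cases s; cases t) (auto simp: coset_rep_def inv_m2 borel_m2)

lemma independent_chi_hat:
  "\<exists>S \<subseteq> vspace (chi_hat \<psi>1 \<psi>2). finite S \<and> fun_space.independent S \<and> card S = CARD('a) + 1"
proof (intro exI conjI)
  let ?S = "(\<lambda>t. B.delta (coset_rep t)) ` UNIV"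
  have c: "card (UNIV :: 'a option set) = CARD('a) + 1"
    by (simp add: UNIV_option_conv card_image)
  have d: "B.delta (coset_rep t) (coset_rep t) \<noteq> 0" "s \<noteq> t \<Longrightarrow> B.delta (coset_rep s) (coset_rep t) = 0" for s t
    using delta_coset_rep by blast+
  show "?S \<subseteq> vspace (chi_hat \<psi>1 \<psi>2)" using B.delta_in[OF coset_rep_GL2] by (auto simp: chi_hat_eq)
  show "finite ?S" by simp
  show "fun_space.independent ?S" "card ?S = CARD('a) + 1"
    using independent_of_points[of UNIV "\<lambda>t. B.delta (coset_rep t)" coset_rep] d c by auto
qed

end

section \<open>Scalars of class sums on the parabolic representations\<close>

context principal
begin

text \<open>The upper triangular matrices in this class are the q - 1 nontrivial unipotents, on
  which the Borel character is 1.\<close>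

lemma omega_chi_unipotent: "omega_chi 1 2 = of_nat (CARD('a) - 1)"
proof -
  let ?S = "(\<lambda>\<beta>. m2 1 \<beta> 0 1) ` (UNIV - {0 :: 'a})"
  have "omega_chi 1 2 = (\<Sum>b\<in>?S. 1)"
    unfolding omega_chi_def
  proof (rule sum.mono_neutral_cong_right)
    show "?S \<subseteq> borel" by (auto simp: borel_m2)
    show "\<forall>b\<in>borel - ?S. cls 1 2 b * bc b = 0"
    proof
      fix b :: "'a^2^2" assume b: "b \<in> borel - ?S"
      then obtain x y z where xyz: "b = m2 x y 0 z" by (auto elim: borelE)
      show "cls 1 2 b * bc b = 0"
      proof (rule ccontr)
        assume "cls 1 2 b * bc b \<noteq> 0"
        then have c: "x * z = 1" "x + z = 2" "\<And>s. b \<noteq> mat s"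
          by (auto simp: cls_def xyz split: if_splits)
        then have z: "z = 2 - x" by (simp add: algebra_simps)
        \<comment> \<open>The characteristic polynomial is (X - 1)^2, and x is one of its
          roots.\<close>
        have "(x - 1) * (x - 1) = 1 - x * z" by (simp add: z algebra_simps)
        then have "x = 1" using c(1) by simp
        then have "b = m2 1 y 0 1" using xyz z by simp
        moreover have "y \<noteq> 0" using c(3)[of 1] calculation by (auto simp: mat_m2)
        ultimately show False using b by auto
      qed
    qed
    show "cls 1 2 b * bc b = 1" if "b \<in> ?S" for b
      using that by (auto simp: cls_def mat_m2 bc_m2 ch1 ch2)
  qed simp
  also have "\<dots> = of_nat (card ?S)" by simp
  also have "card ?S = CARD('a) - 1" by (simp add: card_image inj_on_def card_Diff_singleton)
  finally show ?thesis .
qed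

text \<open>The diagonal of an upper triangular matrix in this class is (a, 1) or (1, a), with q
  choices for the upper right entry. Taking 1 as the second eigenvalue lets the bare sum \<psi>1 a +
  \<psi>2 a appear.\<close>

lemma omega_chi_split:
  assumes a: "a \<noteq> 0" "a \<noteq> 1"
  shows "omega_chi a (a + 1) = of_nat CARD('a) * (\<psi>1 a + \<psi>2 a)"
proof -
  let ?S1 = "(\<lambda>\<beta>. m2 a \<beta> 0 1) ` UNIV" and ?S2 = "(\<lambda>\<beta>. m2 1 \<beta> 0 a) ` UNIV"
  have "omega_chi a (a + 1) = (\<Sum>b\<in>?S1 \<union> ?S2. bc b)"
    unfolding omega_chi_def
  proof (rule sum.mono_neutral_cong_right)
    show "?S1 \<union> ?S2 \<subseteq> borel" using a by (auto simp: borel_m2)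
    show "\<forall>b\<in>borel - (?S1 \<union> ?S2). cls a (a + 1) b * bc b = 0"
    proof
      fix b :: "'a^2^2" assume b: "b \<in> borel - (?S1 \<union> ?S2)"
      then obtain x y z where xyz: "b = m2 x y 0 z" by (auto elim: borelE)
      show "cls a (a + 1) b * bc b = 0"
      proof (rule ccontr)
        assume "cls a (a + 1) b * bc b \<noteq> 0"
        then have c: "x * z = a" "x + z = a + 1"
          by (auto simp: cls_def xyz split: if_splits)
        have z: "z = a + 1 - x" using c(2) by (simp add: algebra_simps)
        have "(x - a) * (x - 1) = a - x * z" by (simp add: z algebra_simps)
        then have "x = a \<or> x = 1" using c(1) by simp
        then show False using b xyz z by auto
      qed
    qed
    show "cls a (a + 1) b * bc b = bc b" if "b \<in> ?S1 \<union> ?S2" for b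
      using that a by (auto simp: cls_def mat_m2)
  qed simp
  also have "\<dots> = (\<Sum>b\<in>?S1. bc b) + (\<Sum>b\<in>?S2. bc b)"
    using a by (intro sum.union_disjoint) auto
  also have "(\<Sum>b\<in>?S1. bc b) = of_nat CARD('a) * \<psi>1 a"
    by (subst sum.reindex) (auto simp: inj_on_def bc_m2 ch2)
  also have "(\<Sum>b\<in>?S2. bc b) = of_nat CARD('a) * \<psi>2 a"
    by (subst sum.reindex) (auto simp: inj_on_def bc_m2 ch1)
  finally show ?thesis by (simp add: distrib_left)
qed

end

section \<open>The representations \<open>chi_hat1\<close>\<close>

locale steinberg = quad_ext +
  fixes \<psi> :: "'a \<Rightarrow> complex"
  assumes \<psi>: "\<psi> \<in> characters (mult_grp Fq)"
begin

lemmas ch = charactersD[OF \<psi>]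

sublocale P: principal \<eta> \<psi> \<psi>
  by unfold_locales (rule \<psi>)+

abbreviation "wm \<equiv> m2 0 1 1 0 :: 'a^2^2"

lemma chi_hat1_simps:
  "vspace (chi_hat1 \<psi>) = {F \<in> vspace P.B.I. (\<Sum>x\<in>carrier GL2. \<psi> (det x) * F x) = 0}"
  "scal (chi_hat1 \<psi>) = scal P.B.I" "act (chi_hat1 \<psi>) = act P.B.I"
  by (simp_all add: chi_hat1_def P.chi_hat_eq)

lemma group_rep_chi_hat1: "group_rep GL2 (chi_hat1 \<psi>)"
proof (rule group_rep_summand)
  show "group_rep GL2 (chi_hat0 \<psi> \<oplus>\<^sub>R chi_hat1 \<psi>)"
    using chi_hat_decomposition[OF \<psi>] by (simp add: rep_equiv_def)
  show "vector_space (scal (chi_hat1 \<psi>))"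
    unfolding chi_hat1_simps P.B.I_simps by (rule fun_space.vector_space_axioms)
qed

lemma psi_det_mult: "det g \<noteq> 0 \<Longrightarrow> det h \<noteq> 0 \<Longrightarrow> \<psi> (det (g ** h)) = \<psi> (det g) * \<psi> (det h)"
  for g h :: "'a^2^2"
  by (simp add: det_mul ch)

lemma bc_det: "b \<in> borel \<Longrightarrow> P.bc b = \<psi> (det b)"
  by (auto elim!: borelE simp: P.bc_m2 ch)

text \<open>For equal characters the lower left entry c drops out on the big cell: with D the
  determinant, \<psi> (c) \<psi> (- D / c) = \<psi> (- 1) \<psi> (D).\<close>

lemma biequi_det:
  assumes \<Phi>: "P.biequi \<Phi>" and h: "h \<in> carrier GL2" "h \<notin> borel"
  shows "\<Phi> h = \<psi> (- 1) * \<Phi> wm * \<psi> (det h)"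
proof (rule m2_cases[of h])
  fix a b c d assume e: "h = m2 a b c d"
  have c: "c \<noteq> 0"
  proof
    assume "c = 0"
    then have "h \<in> borel" using h(1) unfolding e borel_def by simp
    then show False using h(2) by blast
  qed
  have D: "a * d - b * c \<noteq> 0" using h(1) by (simp add: e carrier_GL2)
  have "\<psi> c * \<psi> (- (a * d - b * c) / c) = \<psi> (- 1 * (a * d - b * c))"
    using ch(2)[of c "- (a * d - b * c) / c"] c D by simp
  also have "\<dots> = \<psi> (- 1) * \<psi> (a * d - b * c)" using D by (intro ch(2)) auto
  finally show ?thesis
    using P.biequi_off[OF \<Phi> h(1)[unfolded e] c] by (simp add: e)
qed

text \<open>Translating by x changes the functional that defines \<open>chi_hat1\<close> only by the
  factor \<psi> (det x)^-1, so its kernel is preserved.\<close>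

lemma sum_det_translate:
  assumes F: "F \<in> vspace (chi_hat1 \<psi>)" and x: "x \<in> carrier GL2"
  shows "(\<Sum>h\<in>carrier GL2. \<psi> (det h) * F (x ** h)) = 0"
proof -
  let ?x = "inv\<^bsub>GL2\<^esub> x"
  have x0: "det x \<noteq> 0" "\<psi> (det x) \<noteq> 0" using x ch(1) by (auto simp: carrier_GL2)
  have xx: "x ** (?x ** h) = h" "?x ** (x ** h) = h" for h
    using GL2.r_inv[OF x] GL2.l_inv[OF x] by (simp_all add: matrix_mul_assoc mult_GL2 one_GL2)
  have "\<psi> (det x) * (\<Sum>h\<in>carrier GL2. \<psi> (det h) * F (x ** h)) =
      (\<Sum>h\<in>carrier GL2. \<psi> (det (x ** h)) * F (x ** h))"
    unfolding sum_distrib_left using x0 by (intro sum.cong) (auto simp: psi_det_mult carrier_GL2)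
  also have "\<dots> = (\<Sum>h\<in>carrier GL2. \<psi> (det h) * F h)"
    by (rule sum.reindex_bij_witness[of _ "\<lambda>h. ?x ** h" "\<lambda>h. x ** h"])
      (use x in \<open>auto simp: xx det_mul carrier_GL2 det_inv_GL2\<close>)
  also have "\<dots> = 0" using F by (simp add: chi_hat1_simps)
  finally show ?thesis using x0 by simp
qed

text \<open>Off \<open>B\<close> the kernel is a multiple of \<open>\<psi> \<circ> det\<close>, which acts as \<open>0\<close>.\<close>

lemma kernel_steinberg:
  assumes \<Phi>: "P.biequi \<Phi>" and F: "F \<in> vspace (chi_hat1 \<psi>)" and x: "x \<in> carrier GL2"
  shows "(\<Sum>h\<in>carrier GL2. \<Phi> h * F (x ** h)) =
    of_nat (card (borel :: ('a^2^2) set)) * ((\<Phi> (mat 1) - \<psi> (- 1) * \<Phi> wm) * F x)"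
proof -
  define \<kappa> where "\<kappa> = \<psi> (- 1) * \<Phi> wm"
  have F': "F \<in> vspace P.B.I" using F by (simp add: chi_hat1_simps)
  have "(\<Sum>h\<in>carrier GL2. \<Phi> h * F (x ** h)) =
      (\<Sum>h\<in>carrier GL2. \<kappa> * (\<psi> (det h) * F (x ** h)) +
        (if h \<in> borel then (\<Phi> (mat 1) - \<kappa>) * (P.bc h * F (x ** h)) else 0))"
  proof (rule sum.cong[OF refl])
    fix h :: "'a^2^2" assume h: "h \<in> carrier GL2"
    show "\<Phi> h * F (x ** h) = \<kappa> * (\<psi> (det h) * F (x ** h)) +
        (if h \<in> borel then (\<Phi> (mat 1) - \<kappa>) * (P.bc h * F (x ** h)) else 0)"
    proof (cases "h \<in> borel")
      case True
      then show ?thesis by (simp add: P.biequi_on[OF \<Phi> True] bc_det algebra_simps)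
    next
      case False
      then show ?thesis by (simp add: biequi_det[OF \<Phi> h False] \<kappa>_def)
    qed
  qed
  also have "\<dots> = \<kappa> * (\<Sum>h\<in>carrier GL2. \<psi> (det h) * F (x ** h)) +
      (\<Sum>h\<in>carrier GL2. if h \<in> borel then (\<Phi> (mat 1) - \<kappa>) * (P.bc h * F (x ** h)) else 0)"
    by (simp only: sum.distrib sum_distrib_left)
  also have "(\<Sum>h\<in>carrier GL2. \<psi> (det h) * F (x ** h)) = 0" by (rule sum_det_translate[OF F x])
  also have "(\<Sum>h\<in>carrier GL2. if h \<in> borel then (\<Phi> (mat 1) - \<kappa>) * (P.bc h * F (x ** h)) else 0) =
      (\<Sum>h\<in>borel. (\<Phi> (mat 1) - \<kappa>) * (P.bc h * F (x ** h)))"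
  proof (rule sum.mono_neutral_cong_right)
    show "borel \<subseteq> (carrier GL2 :: ('a^2^2) set)" using P.B.HG by blast
  qed simp_all
  also have "\<dots> = (\<Phi> (mat 1) - \<kappa>) * (of_nat (card (borel :: ('a^2^2) set)) * F x)"
    unfolding sum_distrib_left[symmetric] P.sum_on_borel[OF F' x] ..
  finally show ?thesis unfolding \<kappa>_def[symmetric] by simp
qed

definition omega_chi1 :: "'a \<Rightarrow> 'a \<Rightarrow> complex" where
  "omega_chi1 d t = P.omega_chi d t - \<psi> (- 1) * P.phi_cls d t wm"

lemma class_sum_chi_hat1:
  assumes F: "F \<in> vspace (chi_hat1 \<psi>)"
  shows "class_sum GL2 (chi_hat1 \<psi>) (cls d t) F = scal (chi_hat1 \<psi>) (omega_chi1 d t) F"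
proof
  fix x
  have F': "F \<in> vspace P.B.I" using F by (simp add: chi_hat1_simps)
  have e: "class_sum GL2 (chi_hat1 \<psi>) (cls d t) F = class_sum GL2 P.B.I (cls d t) F"
    by (simp add: class_sum_def chi_hat1_simps)
  show "class_sum GL2 (chi_hat1 \<psi>) (cls d t) F x = scal (chi_hat1 \<psi>) (omega_chi1 d t) F x"
  proof (cases "x \<in> carrier GL2")
    case True
    have "of_nat (card (borel :: ('a^2^2) set)) * class_sum GL2 P.B.I (cls d t) F x =
        of_nat (card (borel :: ('a^2^2) set)) * (omega_chi1 d t * F x)"
      unfolding P.class_sum_phi_cls[OF F' True] kernel_steinberg[OF P.biequi_phi_cls F True]
        P.phi_cls_one omega_chi1_def ..
    then show ?thesis using P.borel_nonempty by (simp add: e chi_hat1_simps(2) P.B.I_simps(1))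
  next
    case False
    then show ?thesis using F'
      by (simp add: e P.class_sum_I_outside P.B.I_mem chi_hat1_simps(2) P.B.I_simps(1))
  qed
qed

text \<open>The trace of \<open>b ** wm\<close> is the upper right entry of b, and its determinant
  is minus the product of the diagonal of b. So t fixes the former, d fixes the latter, and the
  first diagonal entry stays free, which gives q - 1 matrices.\<close>

lemma phi_cls_wm:
  assumes d: "d \<noteq> 0"
  shows "\<psi> (- 1) * P.phi_cls d t wm = of_nat (CARD('a) - 1) * \<psi> d"
proof -
  let ?S = "(\<lambda>\<alpha>. m2 \<alpha> t 0 (- d / \<alpha>)) ` (UNIV - {0})"
  have inv_wm: "inv\<^bsub>GL2\<^esub> wm = wm" by (simp add: inv_m2)
  have "P.phi_cls d t wm = (\<Sum>b\<in>borel. cls d t (b ** wm) * P.bc b)"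
    unfolding P.phi_cls_def P.B.avg_def
  proof (rule sum.reindex_bij_witness[of _ "\<lambda>b. inv\<^bsub>GL2\<^esub> b" "\<lambda>b. inv\<^bsub>GL2\<^esub> b"])
    fix b :: "'a^2^2" assume b: "b \<in> borel"
    then have bG: "b \<in> carrier GL2" by (rule P.B.HG)
    have "inv\<^bsub>GL2\<^esub> (wm \<otimes>\<^bsub>GL2\<^esub> b) = inv\<^bsub>GL2\<^esub> b ** wm"
      using GL2.inv_mult_group[OF P.wm_GL2 bG] by (simp only: inv_wm mult_GL2)
    then show "cls d t (inv\<^bsub>GL2\<^esub> b ** wm) * P.bc (inv\<^bsub>GL2\<^esub> b) =
        cls d t (inv\<^bsub>GL2\<^esub> (wm \<otimes>\<^bsub>GL2\<^esub> b)) * inverse (P.bc b)"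
      by (simp only: P.B.\<theta>_inv[OF b])
  qed (auto simp: P.B.HG)
  also have "\<dots> = (\<Sum>b\<in>?S. \<psi> (- 1) * \<psi> d)"
  proof (rule sum.mono_neutral_cong_right)
    show "?S \<subseteq> borel" using d by (auto simp: borel_m2)
    show "\<forall>b\<in>borel - ?S. cls d t (b ** wm) * P.bc b = 0"
    proof
      fix b :: "'a^2^2" assume b: "b \<in> borel - ?S"
      then obtain x y z where xyz: "b = m2 x y 0 z" "x \<noteq> 0" by (auto elim: borelE)
      show "cls d t (b ** wm) * P.bc b = 0"
      proof (rule ccontr)
        assume "cls d t (b ** wm) * P.bc b \<noteq> 0"
        then have c: "- (x * z) = d" "y = t" by (auto simp: cls_def xyz split: if_splits)
        then have "z = - d / x" using xyz(2) by (simp flip: c(1))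
        then show False using b xyz c by auto
      qed
    qed
    show "cls d t (b ** wm) * P.bc b = \<psi> (- 1) * \<psi> d" if b: "b \<in> ?S" for b
    proof -
      obtain x where x: "b = m2 x t 0 (- d / x)" "x \<noteq> 0" using b by blast
      have "\<psi> x * \<psi> (- d / x) = \<psi> (- 1 * d)" using ch(2)[of x "- d / x"] x d by simp
      also have "\<dots> = \<psi> (- 1) * \<psi> d" using d by (intro ch(2)) auto
      finally show ?thesis using x d by (simp add: cls_def mat_m2 P.bc_m2)
    qed
  qed simp
  also have "\<dots> = of_nat (card ?S) * (\<psi> (- 1) * \<psi> d)" by simp
  also have "card ?S = CARD('a) - 1" by (simp add: card_image inj_on_def card_Diff_singleton)
  finally have e: "P.phi_cls d t wm = of_nat (CARD('a) - 1) * (\<psi> (- 1) * \<psi> d)" .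
  have "\<psi> (- 1) * \<psi> (- 1) = 1" using ch(2)[of "- 1" "- 1"] ch(3) by simp
  then have "\<psi> (- 1) * (of_nat (CARD('a) - 1) * (\<psi> (- 1) * \<psi> d)) = of_nat (CARD('a) - 1) * \<psi> d"
    by (metis mult.assoc mult.left_commute mult_1_left)
  then show ?thesis unfolding e .
qed

lemma omega_chi1_unipotent: "omega_chi1 1 2 = 0"
  unfolding omega_chi1_def using phi_cls_wm[of 1 2] P.omega_chi_unipotent ch(3) by simp

lemma omega_chi1_split:
  assumes "a \<noteq> 0" "a \<noteq> 1"
  shows "omega_chi1 a (a + 1) = of_nat (CARD('a) + 1) * \<psi> a"
proof -
  have "of_nat (CARD('a) - 1) = (of_nat CARD('a) - 1 :: complex)"
    using card_ge_2[where 'a='a] by (simp add: of_nat_diff)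
  then show ?thesis
    unfolding omega_chi1_def phi_cls_wm[OF assms(1)] P.omega_chi_split[OF assms] by (simp add: algebra_simps)
qed

lemma norm_character: "(\<lambda>w. \<psi> (nrm \<eta> w)) \<in> characters Lx"
  unfolding characters_def
  using ch(1,2,5) by (auto simp: carrier_Lx mult_Lx nrm_mult nrm_eq_0 simp del: qm_simp) (simp add: nrm_simp ch)

lemma sum_over_norm_character:
  assumes \<nu>0: "\<nu>0 \<in> indecomposables \<eta>"
  shows "(\<Sum>w\<in>UNIV - {(0, 0)}. \<nu>0 w * inverse (\<psi> (nrm \<eta> w))) = 0"
proof -
  have c: "\<nu>0 \<in> characters Lx" and nd: "\<not> decomposable \<eta> \<nu>0"
    using \<nu>0 by (auto simp: indecomposables_def)
  have "\<nu>0 \<noteq> (\<lambda>w. \<psi> (nrm \<eta> w))"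
    using nd \<psi> unfolding decomposable_def by blast
  then have "(\<Sum>w\<in>carrier Lx. \<nu>0 w / \<psi> (nrm \<eta> w)) = 0"
    using L.sum_characters_div[OF c norm_character] by simp
  then show ?thesis by (simp only: carrier_Lx divide_inverse)
qed

text \<open>Replacing h by \<open>h ** cm w\<close> factors the double sum. One factor is the sum of
  \<nu>0 over \<psi> composed with the norm, which vanishes by orthogonality since an indecomposable
  \<nu>0 is not of that form.\<close>

lemma mker_sum:
  assumes \<nu>0: "\<nu>0 \<in> indecomposables \<eta>"
  shows "(\<Sum>h\<in>carrier GL2. inverse (\<psi> (det h)) * P.mker \<nu>0 h) = 0"
proof -
  let ?L = "UNIV - {(0, 0)} :: ('a \<times> 'a) set"
  have "(\<Sum>h\<in>carrier GL2. inverse (\<psi> (det h)) * P.mker \<nu>0 h) =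
      (\<Sum>w\<in>?L. \<Sum>h\<in>carrier GL2. \<nu>0 w * (inverse (\<psi> (det h)) * P.B.\<theta>0 (h ** cm (qinv w))))"
    unfolding P.mker_def sum_distrib_left by (subst sum.swap) (simp only: mult.left_commute)
  also have "\<dots> = (\<Sum>w\<in>?L. \<nu>0 w * inverse (\<psi> (nrm \<eta> w)) *
      (\<Sum>h\<in>carrier GL2. inverse (\<psi> (det h)) * P.B.\<theta>0 h))"
  proof (rule sum.cong[OF refl])
    fix w :: "'a \<times> 'a" assume "w \<in> ?L"
    then have w: "w \<noteq> (0, 0)" by simp
    have n: "nrm \<eta> w \<noteq> 0" using w by (simp add: nrm_eq_0)
    have 1: "h ** cm (qinv w) ** cm w = h" "h ** cm w ** cm (qinv w) = h" for h
      using w by (simp_all add: matrix_mul_assoc[symmetric] cm_mult qm_qinv qm_comm[of "qinv w"] cm_one)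
    have "(\<Sum>h\<in>carrier GL2. inverse (\<psi> (det h)) * P.B.\<theta>0 (h ** cm (qinv w))) =
        (\<Sum>h\<in>carrier GL2. inverse (\<psi> (det (h ** cm w))) * P.B.\<theta>0 h)"
      by (rule sum.reindex_bij_witness[of _ "\<lambda>h. h ** cm w" "\<lambda>h. h ** cm (qinv w)"])
        (use n qinv_eq_0[OF w] in \<open>simp_all add: 1 carrier_GL2 det_mul det_cm nrm_eq_0 w\<close>)
    also have "\<dots> = inverse (\<psi> (nrm \<eta> w)) * (\<Sum>h\<in>carrier GL2. inverse (\<psi> (det h)) * P.B.\<theta>0 h)"
      unfolding sum_distrib_left using n
      by (intro sum.cong) (auto simp: psi_det_mult det_cm carrier_GL2)
    finally show "(\<Sum>h\<in>carrier GL2. \<nu>0 w * (inverse (\<psi> (det h)) * P.B.\<theta>0 (h ** cm (qinv w)))) =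
        \<nu>0 w * inverse (\<psi> (nrm \<eta> w)) * (\<Sum>h\<in>carrier GL2. inverse (\<psi> (det h)) * P.B.\<theta>0 h)"
      by (simp only: sum_distrib_left[symmetric] mult.assoc)
  qed
  also have "\<dots> = 0"
    unfolding sum_distrib_right[symmetric] sum_over_norm_character[OF \<nu>0] by simp
  finally show ?thesis .
qed

text \<open>If the scalar vanished, the averaged kernel would be a multiple of \<open>\<psi> \<circ> det\<close>. Pairing it
  with the inverse of \<open>\<psi> \<circ> det\<close> gives \<open>0\<close> because \<open>\<nu>0\<close> is indecomposable.\<close>

lemma avg_mker_nz:
  assumes \<nu>0: "\<nu>0 \<in> indecomposables \<eta>" and sharp: "\<And>x. \<psi> x * \<psi> x = \<nu>0 (x, 0)"
  shows "P.B.avg (P.mker \<nu>0) (mat 1) - \<psi> (- 1) * P.B.avg (P.mker \<nu>0) wm \<noteq> 0"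
proof
  let ?\<Phi> = "P.B.avg (P.mker \<nu>0)"
  define \<kappa> where "\<kappa> = \<psi> (- 1) * ?\<Phi> wm"
  assume "?\<Phi> (mat 1) - \<psi> (- 1) * ?\<Phi> wm = 0"
  then have k: "?\<Phi> (mat 1) = \<kappa>" by (simp add: \<kappa>_def)
  have \<nu>0c: "\<nu>0 \<in> characters Lx" using \<nu>0 by (simp add: indecomposables_def)
  have \<Phi>: "?\<Phi> h = \<kappa> * \<psi> (det h)" if "h \<in> carrier GL2" for h
    using biequi_det[OF P.biequi_mker that, of \<nu>0] P.biequi_on[OF P.biequi_mker, of h \<nu>0] k bc_det[of h]
    by (cases "h \<in> borel") (auto simp: \<kappa>_def)
  have nz: "\<psi> (det h) \<noteq> 0" if "h \<in> carrier GL2" for h :: "'a^2^2"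
    using that ch(1) by (simp add: carrier_GL2)
  have "of_nat (card (carrier GL2 :: ('a^2^2) set)) * \<kappa> = (\<Sum>h\<in>carrier GL2. inverse (\<psi> (det h)) * ?\<Phi> h)"
  proof -
    have "(\<Sum>h\<in>carrier GL2. inverse (\<psi> (det h)) * ?\<Phi> h) = (\<Sum>h\<in>(carrier GL2 :: ('a^2^2) set). \<kappa>)"
      using nz by (intro sum.cong) (auto simp: \<Phi>)
    then show ?thesis by simp
  qed
  also have "\<dots> = (\<Sum>b\<in>borel. \<Sum>h\<in>carrier GL2. inverse (\<psi> (det h)) * (P.mker \<nu>0 (h ** b) * inverse (P.bc b)))"
    unfolding P.B.avg_def sum_distrib_left mult_GL2 by (rule sum.swap)
  also have "\<dots> = (\<Sum>b\<in>(borel :: ('a^2^2) set). 0)"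
  proof (rule sum.cong[OF refl])
    fix b :: "'a^2^2" assume b: "b \<in> borel"
    let ?b = "inv\<^bsub>GL2\<^esub> b"
    have bG: "b \<in> carrier GL2" using b by (rule P.B.HG)
    have bb: "h ** b ** ?b = h" "h ** ?b ** b = h" for h
      using GL2.r_inv[OF bG] GL2.l_inv[OF bG] by (simp_all add: matrix_mul_assoc[symmetric] mult_GL2 one_GL2)
    have "(\<Sum>h\<in>carrier GL2. inverse (\<psi> (det h)) * (P.mker \<nu>0 (h ** b) * inverse (P.bc b))) =
        (\<Sum>h\<in>carrier GL2. inverse (\<psi> (det h)) * P.mker \<nu>0 h)"
    proof (rule sum.reindex_bij_witness[of _ "\<lambda>h. h ** ?b" "\<lambda>h. h ** b"])
      fix h :: "'a^2^2" assume h: "h \<in> carrier GL2"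
      show "inverse (\<psi> (det (h ** b))) * P.mker \<nu>0 (h ** b) =
          inverse (\<psi> (det h)) * (P.mker \<nu>0 (h ** b) * inverse (P.bc b))"
        using h bG by (simp add: psi_det_mult carrier_GL2 bc_det[OF b])
      show "h ** b \<in> carrier GL2" using h bG by (simp add: carrier_GL2 det_mul)
      show "h ** ?b \<in> carrier GL2" using h bG by (simp add: carrier_GL2 det_mul det_inv_GL2)
    qed (simp_all add: bb)
    then show "(\<Sum>h\<in>carrier GL2. inverse (\<psi> (det h)) * (P.mker \<nu>0 (h ** b) * inverse (P.bc b))) = 0"
      using mker_sum[OF \<nu>0] by simp
  qed
  finally have "of_nat (card (carrier GL2 :: ('a^2^2) set)) * \<kappa> = 0" by simp
  moreover have "card (carrier GL2 :: ('a^2^2) set) \<noteq> 0"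
    using GL2.one_closed by (metis card_eq_0_iff empty_iff finite)
  \<comment> \<open>This contradicts \<open>avg_mker_one\<close>, by which the value at the identity
    is the order of the Borel subgroup times q - 1.\<close>
  ultimately have "?\<Phi> (mat 1) = 0" using k by simp
  then show False
    using P.avg_mker_one[OF \<nu>0c sharp] P.borel_nonempty card_ge_2[where 'a='a] by simp
qed

lemma intertwiner_embed1:
  assumes "\<nu>0 \<in> characters Lx"
  shows "intertwiner GL2 (chi_hat1 \<psi>) (ind_rep GL2 (cartan \<eta>) (char_rep (cartan_char \<nu>0))) (P.embed \<nu>0)"
  using P.intertwiner_embed[OF assms] unfolding intertwiner_def
  by (simp add: chi_hat1_simps P.chi_hat_eq)

lemma embed_injective1:
  assumes \<nu>0: "\<nu>0 \<in> indecomposables \<eta>" and sharp: "\<And>x. \<psi> x * \<psi> x = \<nu>0 (x, 0)"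
    and F: "F \<in> vspace (chi_hat1 \<psi>)" and 0: "P.embed \<nu>0 F = 0"
  shows "F = 0"
proof
  fix x
  have F': "F \<in> vspace P.B.I" using F by (simp add: chi_hat1_simps)
  show "F x = 0 x"
  proof (cases "x \<in> carrier GL2")
    case True
    have "of_nat (card (borel :: ('a^2^2) set)) *
        ((P.B.avg (P.mker \<nu>0) (mat 1) - \<psi> (- 1) * P.B.avg (P.mker \<nu>0) wm) * F x) = 0"
      using kernel_steinberg[OF P.biequi_mker F True, of \<nu>0] P.embed_kernel[OF F' 0 True] by simp
    then have "F x = 0"
      using P.card_borel avg_mker_nz[OF \<nu>0 sharp] by (simp only: mult_eq_0_iff) blast
    then show ?thesis by simp
  next
    case False
    then show ?thesis using F' by (simp add: P.B.I_mem)
  qed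
qed

text \<open>The defining functional is nonzero on every \<open>delta\<close>, so subtracting a
  multiple of the one at infinity moves each of the q others into \<open>chi_hat1\<close>. The
  correction vanishes at the finite points of the projective line, where the q functions are still
  told apart by evaluation.\<close>

lemma independent_chi_hat1:
  "\<exists>S \<subseteq> vspace (chi_hat1 \<psi>). finite S \<and> fun_space.independent S \<and> card S = CARD('a)"
proof -
  interpret R: group_rep GL2 P.B.I by (rule P.B.group_rep_I)
  define \<sigma> where "\<sigma> F = (\<Sum>x\<in>carrier GL2. \<psi> (det x) * F x)" for F
  have \<sigma>_nz: "\<sigma> (P.B.delta r) \<noteq> 0" if r: "r \<in> carrier GL2" for r
  proof -
    have r0: "\<psi> (det r) \<noteq> 0" using r ch(1) by (simp add: carrier_GL2)
    let ?S = "{x \<in> carrier GL2. inv\<^bsub>GL2\<^esub> r ** x \<in> borel}"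
    have "\<sigma> (P.B.delta r) = (\<Sum>x\<in>?S. \<psi> (det r))"
      unfolding \<sigma>_def
    proof (rule sum.mono_neutral_cong_right)
      show "\<psi> (det x) * P.B.delta r x = \<psi> (det r)" if x: "x \<in> ?S" for x
      proof -
        have xG: "x \<in> carrier GL2" using x by simp
        have x0: "\<psi> (det x) \<noteq> 0" using xG ch(1) by (simp add: carrier_GL2)
        have "P.bc (inv\<^bsub>GL2\<^esub> r ** x) = inverse (\<psi> (det r)) * \<psi> (det x)"
          using x xG r by (simp add: bc_det psi_det_mult det_inv_GL2 carrier_GL2 ch)
        then show ?thesis using x x0 by (simp add: P.B.delta_def mult_GL2)
      qed
    qed (auto simp: P.B.delta_def mult_GL2)
    also have "\<dots> = of_nat (card ?S) * \<psi> (det r)" by simp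
    finally have e: "\<sigma> (P.B.delta r) = of_nat (card ?S) * \<psi> (det r)" .
    have "r \<in> ?S" using r P.B.H.one_closed GL2.l_inv[OF r] by (simp add: mult_GL2)
    then have "?S \<noteq> {}" by blast
    then have "card ?S \<noteq> 0" by (simp only: card_eq_0_iff finite simp_thms)
    then show ?thesis unfolding e using r0 by simp
  qed
  define c where "c t = \<sigma> (P.B.delta (P.coset_rep (Some t))) / \<sigma> (P.B.delta (P.coset_rep None))" for t
  define E where "E t = P.B.delta (P.coset_rep (Some t)) + scal P.B.I (- c t) (P.B.delta (P.coset_rep None))" for t
  have E_apply: "E t x = P.B.delta (P.coset_rep (Some t)) x - c t * P.B.delta (P.coset_rep None) x" for t x
    by (simp add: E_def P.B.I_simps)
  have E_in: "E t \<in> vspace (chi_hat1 \<psi>)" for t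
  proof -
    have "E t \<in> vspace P.B.I"
      unfolding E_def by (intro R.add_in R.scal_in P.B.delta_in P.coset_rep_GL2)
    moreover have "\<sigma> (E t) = \<sigma> (P.B.delta (P.coset_rep (Some t))) - c t * \<sigma> (P.B.delta (P.coset_rep None))"
      unfolding \<sigma>_def E_apply sum_distrib_left
      by (simp add: right_diff_distrib sum_subtractf mult.left_commute)
    then have "\<sigma> (E t) = 0" using \<sigma>_nz[OF P.coset_rep_GL2] by (simp add: c_def)
    ultimately show ?thesis by (simp add: chi_hat1_simps \<sigma>_def)
  qed
  have d: "P.B.delta (P.coset_rep s) (P.coset_rep t) \<noteq> 0 \<longleftrightarrow> s = t" for s t
    by (rule P.delta_coset_rep)
  have "E t (P.coset_rep (Some t)) \<noteq> 0" "s \<noteq> t \<Longrightarrow> E s (P.coset_rep (Some t)) = 0" for s t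
    using d[of None "Some t"] d[of "Some t" "Some t"] d[of "Some s" "Some t"] by (auto simp: E_apply)
  then have "fun_space.independent (E ` UNIV) \<and> card (E ` UNIV) = CARD('a)"
    using independent_of_points[of UNIV E "\<lambda>t. P.coset_rep (Some t)"] by auto
  then show ?thesis using E_in by (intro exI[of _ "E ` UNIV"]) auto
qed

end

section \<open>Assembling the decomposition\<close>

text \<open>The number \<open>n\<close> is a lower bound for the dimension;
  \<open>equiv_of_constituents\<close> plays it off against the size of a spanning set of W.\<close>

definition constituent ::
  "('g, 'm) monoid_scheme \<Rightarrow> ('g, 'w::ab_group_add) rep \<Rightarrow> ('z \<Rightarrow> 'g \<Rightarrow> complex) \<Rightarrow>
    ('g, 'v::ab_group_add) rep \<Rightarrow> ('z \<Rightarrow> complex) \<Rightarrow> nat \<Rightarrow> bool" where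
  "constituent G W f V \<omega> n \<longleftrightarrow> group_rep G V \<and>
     (\<exists>T. intertwiner G V W T \<and> (\<forall>v\<in>vspace V. T v = 0 \<longrightarrow> v = 0)) \<and>
     (\<forall>z. \<forall>v\<in>vspace V. class_sum G V (f z) v = scal V (\<omega> z) v) \<and>
     (\<exists>S\<subseteq>vspace V. finite S \<and> \<not> module.dependent (scal V) S \<and> card S = n)"

lemma (in group_rep) subspace_image:
  assumes W: "group_rep G W" and T: "intertwiner G V W T"
  shows "module.subspace (scal W) (T ` vspace V)"
proof -
  interpret W: group_rep G W by fact
  note D = intertwinerD[OF T]
  show ?thesis
    unfolding W.V.subspace_def
  proof (intro conjI ballI allI)
    show "0 \<in> T ` vspace V" using intertwiner_zero[OF T] zero_in by (metis imageI)
    show "x + y \<in> T ` vspace V" if xy: "x \<in> T ` vspace V" "y \<in> T ` vspace V" for x y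
    proof -
      obtain v w where "x = T v" "y = T w" "v \<in> vspace V" "w \<in> vspace V" using xy by blast
      then show ?thesis using D(2)[of v w] add_in[of v w] by (metis imageI)
    qed
    show "scal W c x \<in> T ` vspace V" if x: "x \<in> T ` vspace V" for c x
    proof -
      obtain v where "x = T v" "v \<in> vspace V" using x by blast
      then show ?thesis using D(3)[of v c] scal_in[of v c] by (metis imageI)
    qed
  qed
qed

lemma constituent_image:
  assumes V: "constituent G W f V \<omega> n" and W: "group_rep G W"
  shows "\<exists>T B. intertwiner G V W T \<and> (\<forall>v\<in>vspace V. T v = 0 \<longrightarrow> v = 0) \<and>
    module.subspace (scal W) (T ` vspace V) \<and> B \<subseteq> T ` vspace V \<and> finite B \<and>
    \<not> module.dependent (scal W) B \<and> card B = n \<and> T ` vspace V \<subseteq> vspace W \<and>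
    (\<forall>z. \<forall>w\<in>T ` vspace V. class_sum G W (f z) w = scal W (\<omega> z) w)"
proof -
  obtain T S where VV: "group_rep G V" and T: "intertwiner G V W T"
    and ker: "\<And>v. v \<in> vspace V \<Longrightarrow> T v = 0 \<Longrightarrow> v = 0"
    and cl: "\<And>z v. v \<in> vspace V \<Longrightarrow> class_sum G V (f z) v = scal V (\<omega> z) v"
    and S: "S \<subseteq> vspace V" "finite S" "\<not> module.dependent (scal V) S" "card S = n"
    using V unfolding constituent_def by blast
  interpret V: group_rep G V by fact
  have "class_sum G W (f z) (T v) = scal W (\<omega> z) (T v)" if "v \<in> vspace V" for z v
    using V.intertwiner_class_sum[OF T that, of "f z"] cl[OF that] intertwinerD(3)[OF T that] by simp
  then show ?thesis
    using T ker S V.independent_image[OF W T ker S(1,2,3)] V.subspace_image[OF W T]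
      intertwinerD(1)[OF T]
    by (intro exI[of _ T] exI[of _ "T ` S"]) auto
qed

text \<open>The three families have index sets of different types; indexing the scalars by the
  disjoint sum makes one application of \<open>eigenspaces_independent\<close> serve all of them. It
  yields both the injectivity of the summed map and the independence of the union of the image
  bases.\<close>

lemma equiv_of_constituents:
  fixes W :: "('g, 'w::ab_group_add) rep" and f :: "'z \<Rightarrow> 'g \<Rightarrow> complex"
    and V1 :: "'i \<Rightarrow> ('g, 'u::ab_group_add) rep" and V2 :: "'j \<Rightarrow> ('g, 'v::ab_group_add) rep"
    and V3 :: "'k \<Rightarrow> ('g, 'x::ab_group_add) rep"
  assumes W: "group_rep G W" and fin: "finite I1" "finite I2" "finite I3"
    and V1: "\<And>i. i \<in> I1 \<Longrightarrow> constituent G W f (V1 i) (\<omega> (Inl i)) n1"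
    and V2: "\<And>i. i \<in> I2 \<Longrightarrow> constituent G W f (V2 i) (\<omega> (Inr (Inl i))) n2"
    and V3: "\<And>i. i \<in> I3 \<Longrightarrow> constituent G W f (V3 i) (\<omega> (Inr (Inr i))) n3"
    and vs: "\<And>i. vector_space (scal (V1 i))" "\<And>i. vector_space (scal (V2 i))"
      "\<And>i. vector_space (scal (V3 i))"
    and sep: "\<And>k l. k \<in> I1 <+> I2 <+> I3 \<Longrightarrow> l \<in> I1 <+> I2 <+> I3 \<Longrightarrow> k \<noteq> l \<Longrightarrow> \<exists>z. \<omega> k z \<noteq> \<omega> l z"
    and D: "finite D" "vspace W \<subseteq> module.span (scal W) D"
      "card D \<le> card I1 * n1 + card I2 * n2 + card I3 * n3"
  shows "rep_equiv G W (direct_sum I1 V1 \<oplus>\<^sub>R direct_sum I2 V2 \<oplus>\<^sub>R direct_sum I3 V3)"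
proof -
  interpret W: group_rep G W by fact
  let ?K = "I1 <+> I2 <+> I3"
  let ?M = "direct_sum I1 V1 \<oplus>\<^sub>R direct_sum I2 V2 \<oplus>\<^sub>R direct_sum I3 V3"
  define good where "good B A \<omega>' n \<longleftrightarrow> W.V.subspace A \<and> B \<subseteq> A \<and> finite B \<and> W.V.independent B \<and>
    card B = n \<and> A \<subseteq> vspace W \<and> (\<forall>z. \<forall>w\<in>A. class_sum G W (f z) w = scal W (\<omega>' z) w)"
    for B A and \<omega>' :: "'z \<Rightarrow> complex" and n :: nat
  have "\<forall>i\<in>I1. \<exists>T B. intertwiner G (V1 i) W T \<and> (\<forall>v\<in>vspace (V1 i). T v = 0 \<longrightarrow> v = 0) \<and>
      good B (T ` vspace (V1 i)) (\<omega> (Inl i)) n1"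
    using constituent_image[OF V1 W] unfolding good_def by blast
  then obtain T1 B1 where 1: "\<And>i. i \<in> I1 \<Longrightarrow> intertwiner G (V1 i) W (T1 i)"
      "\<And>i v. i \<in> I1 \<Longrightarrow> v \<in> vspace (V1 i) \<Longrightarrow> T1 i v = 0 \<Longrightarrow> v = 0"
      "\<And>i. i \<in> I1 \<Longrightarrow> good (B1 i) (T1 i ` vspace (V1 i)) (\<omega> (Inl i)) n1"
    by metis
  have "\<forall>i\<in>I2. \<exists>T B. intertwiner G (V2 i) W T \<and> (\<forall>v\<in>vspace (V2 i). T v = 0 \<longrightarrow> v = 0) \<and>
      good B (T ` vspace (V2 i)) (\<omega> (Inr (Inl i))) n2"
    using constituent_image[OF V2 W] unfolding good_def by blast
  then obtain T2 B2 where 2: "\<And>i. i \<in> I2 \<Longrightarrow> intertwiner G (V2 i) W (T2 i)"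
      "\<And>i v. i \<in> I2 \<Longrightarrow> v \<in> vspace (V2 i) \<Longrightarrow> T2 i v = 0 \<Longrightarrow> v = 0"
      "\<And>i. i \<in> I2 \<Longrightarrow> good (B2 i) (T2 i ` vspace (V2 i)) (\<omega> (Inr (Inl i))) n2"
    by metis
  have "\<forall>i\<in>I3. \<exists>T B. intertwiner G (V3 i) W T \<and> (\<forall>v\<in>vspace (V3 i). T v = 0 \<longrightarrow> v = 0) \<and>
      good B (T ` vspace (V3 i)) (\<omega> (Inr (Inr i))) n3"
    using constituent_image[OF V3 W] unfolding good_def by blast
  then obtain T3 B3 where 3: "\<And>i. i \<in> I3 \<Longrightarrow> intertwiner G (V3 i) W (T3 i)"
      "\<And>i v. i \<in> I3 \<Longrightarrow> v \<in> vspace (V3 i) \<Longrightarrow> T3 i v = 0 \<Longrightarrow> v = 0"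
      "\<And>i. i \<in> I3 \<Longrightarrow> good (B3 i) (T3 i ` vspace (V3 i)) (\<omega> (Inr (Inr i))) n3"
    by metis
  have gr1: "group_rep G (V1 i)" if "i \<in> I1" for i
    using V1[OF that] by (simp add: constituent_def)
  have gr2: "group_rep G (V2 i)" if "i \<in> I2" for i
    using V2[OF that] by (simp add: constituent_def)
  have gr3: "group_rep G (V3 i)" if "i \<in> I3" for i
    using V3[OF that] by (simp add: constituent_def)
  have M: "group_rep G ?M"
    by (intro group_rep_rep_sum group_rep_direct_sum W.G.is_group gr1 gr2 gr3 vs)
  interpret M: group_rep G ?M by (rule M)
  define T where "T = (\<lambda>(m1, m'). (\<Sum>i\<in>I1. T1 i (m1 i)) +
      (\<lambda>(m2, m3). (\<Sum>i\<in>I2. T2 i (m2 i)) + (\<Sum>i\<in>I3. T3 i (m3 i))) m')"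
  have T: "intertwiner G ?M W T"
    unfolding T_def
    by (intro intertwiner_rep_sum[OF W] intertwiner_direct_sum[OF W] fin 1(1) 2(1) 3(1))
  have finK: "finite ?K" using fin by simp
  define A where "A k = (case k of Inl i \<Rightarrow> T1 i ` vspace (V1 i)
      | Inr (Inl i) \<Rightarrow> T2 i ` vspace (V2 i) | Inr (Inr i) \<Rightarrow> T3 i ` vspace (V3 i))" for k
  define B where "B k = (case k of Inl i \<Rightarrow> B1 i | Inr (Inl i) \<Rightarrow> B2 i | Inr (Inr i) \<Rightarrow> B3 i)" for k
  define n where "n k = (case k of Inl i \<Rightarrow> n1 | Inr (Inl i) \<Rightarrow> n2 | Inr (Inr i) \<Rightarrow> n3)" for k :: "'i + 'j + 'k"
  have good: "good (B k) (A k) (\<omega> k) (n k)" if "k \<in> ?K" for k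
    using that 1(3) 2(3) 3(3) by (auto simp: A_def B_def n_def)
  have indep: "a k = 0" if "\<And>k. k \<in> ?K \<Longrightarrow> a k \<in> A k" "(\<Sum>k\<in>?K. a k) = 0" "k \<in> ?K" for a k
  proof (rule W.eigenspaces_independent[OF finK, where f = f and \<omega> = \<omega>])
    show "a i \<in> vspace W" if "i \<in> ?K" for i
      using good[OF that] \<open>\<And>k. k \<in> ?K \<Longrightarrow> a k \<in> A k\<close>[OF that] unfolding good_def by blast
    show "class_sum G W (f z) (a i) = scal W (\<omega> i z) (a i)" if "i \<in> ?K" for i z
      using good[OF that] \<open>\<And>k. k \<in> ?K \<Longrightarrow> a k \<in> A k\<close>[OF that] unfolding good_def by blast
  qed (use that sep in blast)+
  have sumK: "(\<Sum>k\<in>?K. h k) = (\<Sum>i\<in>I1. h (Inl i)) + ((\<Sum>i\<in>I2. h (Inr (Inl i))) + (\<Sum>i\<in>I3. h (Inr (Inr i))))"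
    for h :: "'i + 'j + 'k \<Rightarrow> _ :: comm_monoid_add"
    using fin by (simp add: sum.Plus)
  have ker: "v = 0" if v: "v \<in> vspace ?M" and Tv: "T v = 0" for v
  proof -
    obtain m1 m2 m3 where m: "v = (m1, m2, m3)" by (cases v)
    have m1: "i \<in> I1 \<Longrightarrow> m1 i \<in> vspace (V1 i)" "i \<notin> I1 \<Longrightarrow> m1 i = 0" for i
      using v by (auto simp: m rep_sum_def direct_sum_def)
    have m2: "i \<in> I2 \<Longrightarrow> m2 i \<in> vspace (V2 i)" "i \<notin> I2 \<Longrightarrow> m2 i = 0" for i
      using v by (auto simp: m rep_sum_def direct_sum_def)
    have m3: "i \<in> I3 \<Longrightarrow> m3 i \<in> vspace (V3 i)" "i \<notin> I3 \<Longrightarrow> m3 i = 0" for i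
      using v by (auto simp: m rep_sum_def direct_sum_def)
    define a where "a k = (case k of Inl i \<Rightarrow> T1 i (m1 i)
      | Inr (Inl i) \<Rightarrow> T2 i (m2 i) | Inr (Inr i) \<Rightarrow> T3 i (m3 i))" for k
    have a: "a k \<in> A k" if "k \<in> ?K" for k
      using that m1(1) m2(1) m3(1) by (auto simp: a_def A_def)
    have "(\<Sum>k\<in>?K. a k) = 0" using Tv by (simp add: sumK a_def T_def m)
    then have z: "a k = 0" if "k \<in> ?K" for k using indep[OF a _ that] by blast
    have "m1 i = 0" for i
    proof (cases "i \<in> I1")
      case True
      then have "a (Inl i) = 0" by (intro z) auto
      then have "T1 i (m1 i) = 0" by (simp only: a_def sum.case)
      from 1(2)[OF True m1(1)[OF True] this] show ?thesis .
    qed (rule m1(2))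
    then have m10: "m1 = 0" by (simp add: fun_eq_iff)
    have "m2 i = 0" for i
    proof (cases "i \<in> I2")
      case True
      then have "a (Inr (Inl i)) = 0" by (intro z) auto
      then have "T2 i (m2 i) = 0" by (simp only: a_def sum.case)
      from 2(2)[OF True m2(1)[OF True] this] show ?thesis .
    qed (rule m2(2))
    then have m20: "m2 = 0" by (simp add: fun_eq_iff)
    have "m3 i = 0" for i
    proof (cases "i \<in> I3")
      case True
      then have "a (Inr (Inr i)) = 0" by (intro z) auto
      then have "T3 i (m3 i) = 0" by (simp only: a_def sum.case)
      from 3(2)[OF True m3(1)[OF True] this] show ?thesis .
    qed (rule m3(2))
    then have m30: "m3 = 0" by (simp add: fun_eq_iff)
    show ?thesis by (simp add: m m10 m20 m30 zero_prod_def)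
  qed
  define BB where "BB = (\<Union>k\<in>?K. B k)"
  have BB: "W.V.independent BB" "card BB = (\<Sum>k\<in>?K. card (B k))"
    unfolding BB_def
    by (rule W.V.independent_Union_subspaces[OF finK, of A B]; use good indep in \<open>force simp: good_def\<close>)+
  have "(\<Sum>k\<in>?K. card (B k)) = (\<Sum>k\<in>?K. n k)"
    using good by (intro sum.cong) (auto simp: good_def)
  also have "\<dots> = card I1 * n1 + card I2 * n2 + card I3 * n3"
    by (simp add: sumK n_def)
  finally have cardBB: "card D \<le> card BB" using D(3) BB(2) by simp
  have R: "W.V.subspace (T ` vspace ?M)" by (rule M.subspace_image[OF W T])
  have BA: "A k \<subseteq> T ` vspace ?M" if k: "k \<in> ?K" for k
  proof
    fix w assume w: "w \<in> A k"
    have z1: "(\<lambda>i. 0) \<in> vspace (direct_sum I1 V1)" "(\<lambda>i. 0) \<in> vspace (direct_sum I2 V2)"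
      "(\<lambda>i. 0) \<in> vspace (direct_sum I3 V3)"
      using group_rep.zero_in[OF gr1] group_rep.zero_in[OF gr2] group_rep.zero_in[OF gr3]
      by (auto simp: direct_sum_def)
    have t0: "i \<in> I1 \<Longrightarrow> T1 i 0 = 0" "i' \<in> I2 \<Longrightarrow> T2 i' 0 = 0" "i'' \<in> I3 \<Longrightarrow> T3 i'' 0 = 0" for i i' i''
      using group_rep.intertwiner_zero[OF gr1 1(1)] group_rep.intertwiner_zero[OF gr2 2(1)]
        group_rep.intertwiner_zero[OF gr3 3(1)] by blast+
    consider i v where "k = Inl i" "i \<in> I1" "v \<in> vspace (V1 i)" "w = T1 i v"
      | i v where "k = Inr (Inl i)" "i \<in> I2" "v \<in> vspace (V2 i)" "w = T2 i v"
      | i v where "k = Inr (Inr i)" "i \<in> I3" "v \<in> vspace (V3 i)" "w = T3 i v"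
      using w k by (auto simp: A_def)
    then show "w \<in> T ` vspace ?M"
    proof cases
      case (1 i v)
      have "T ((\<lambda>j. if j = i then v else 0), (\<lambda>j. 0), (\<lambda>j. 0)) = (\<Sum>j\<in>I1. if j = i then w else 0)"
        unfolding T_def using t0 1 by (auto intro!: sum.cong)
      then have "T ((\<lambda>j. if j = i then v else 0), (\<lambda>j. 0), (\<lambda>j. 0)) = w" using 1 fin by simp
      moreover have "((\<lambda>j. if j = i then v else 0), (\<lambda>j. 0), (\<lambda>j. 0)) \<in> vspace ?M"
        using 1 z1 by (auto simp: rep_sum_def direct_sum_def)
      ultimately show ?thesis by (metis imageI)
    next
      case (2 i v)
      have "T ((\<lambda>j. 0), (\<lambda>j. if j = i then v else 0), (\<lambda>j. 0)) = (\<Sum>j\<in>I2. if j = i then w else 0)"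
        unfolding T_def using t0 2 by (auto intro!: sum.cong)
      then have "T ((\<lambda>j. 0), (\<lambda>j. if j = i then v else 0), (\<lambda>j. 0)) = w" using 2 fin by simp
      moreover have "((\<lambda>j. 0), (\<lambda>j. if j = i then v else 0), (\<lambda>j. 0)) \<in> vspace ?M"
        using 2 z1 by (auto simp: rep_sum_def direct_sum_def)
      ultimately show ?thesis by (metis imageI)
    next
      case (3 i v)
      have "T ((\<lambda>j. 0), (\<lambda>j. 0), (\<lambda>j. if j = i then v else 0)) = (\<Sum>j\<in>I3. if j = i then w else 0)"
        unfolding T_def using t0 3 by (auto intro!: sum.cong)
      then have "T ((\<lambda>j. 0), (\<lambda>j. 0), (\<lambda>j. if j = i then v else 0)) = w" using 3 fin by simp
      moreover have "((\<lambda>j. 0), (\<lambda>j. 0), (\<lambda>j. if j = i then v else 0)) \<in> vspace ?M"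
        using 3 z1 by (auto simp: rep_sum_def direct_sum_def)
      ultimately show ?thesis by (metis imageI)
    qed
  qed
  have BBR: "BB \<subseteq> T ` vspace ?M"
    unfolding BB_def
  proof (rule UN_least)
    show "B k \<subseteq> T ` vspace ?M" if k: "k \<in> ?K" for k
      using BA[OF k] good[OF k] unfolding good_def by blast
  qed
  have "vspace W \<subseteq> W.V.span BB"
  proof (rule ccontr)
    assume "\<not> vspace W \<subseteq> W.V.span BB"
    then obtain w where w: "w \<in> vspace W" "w \<notin> W.V.span BB" by blast
    \<comment> \<open>A vector outside the span would enlarge BB to an independent set with more
      elements than the spanning set D.\<close>
    have ind: "W.V.independent (insert w BB)" by (rule W.V.independent_insertI[OF w(2) BB(1)])
    have "BB \<subseteq> vspace W" using BBR intertwinerD(1)[OF T] by blast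
    then have "insert w BB \<subseteq> W.V.span D" using w(1) D(2) by blast
    then have c: "finite (insert w BB)" "card (insert w BB) \<le> card D"
      using W.V.independent_span_bound[OF D(1) ind] by auto
    have "w \<notin> BB" using w(2) W.V.span_base by blast
    then show False using c cardBB by simp
  qed
  also have "W.V.span BB \<subseteq> T ` vspace ?M" by (rule W.V.span_minimal[OF BBR R])
  finally have "rep_equiv G ?M W" by (intro rep_equiv_of_intertwiner[OF M W T ker])
  then show ?thesis by (rule rep_equiv_sym)
qed

section \<open>Counting characters\<close>

context group
begin

lemma finite_characters:
  assumes "finite (carrier G)" shows "finite (characters G)"
proof (rule finite_subset)
  show "characters G \<subseteq> {f. \<forall>x. (x \<in> carrier G \<longrightarrow> f x \<in> {z. z ^ Coset.order G = 1}) \<and> (x \<notin> carrier G \<longrightarrow> f x = 0)}"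
  proof
    fix \<theta> assume \<theta>: "\<theta> \<in> characters G"
    note c = charactersD_group[OF \<theta> is_group]
    have "\<theta> x ^ Coset.order G = 1" if "x \<in> carrier G" for x
      using c(6)[OF that, of "Coset.order G"] pow_order_eq_1[OF that] c(3) by simp
    then show "\<theta> \<in> {f. \<forall>x. (x \<in> carrier G \<longrightarrow> f x \<in> {z. z ^ Coset.order G = 1}) \<and> (x \<notin> carrier G \<longrightarrow> f x = 0)}"
      using c(4) by simp
  qed
  show "finite {f. \<forall>x. (x \<in> carrier G \<longrightarrow> f x \<in> {z::complex. z ^ Coset.order G = 1}) \<and> (x \<notin> carrier G \<longrightarrow> f x = 0)}"
    using assms by (intro finite_set_of_finite_funs finite_nth_roots) (simp_all add: order_gt_0_iff_finite)
qed

text \<open>On a cyclic group the value at the generator can be any root of unity of the group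
  order, so each of the n solutions of \<zeta>^n = c comes from a character. The case n = q - 1, c =
  1 counts all characters of the base field; n = q + 1 counts extensions.\<close>

lemma card_roots_le_card_characters:
  assumes fin: "finite (carrier G)" and g: "g \<in> carrier G"
    and gen: "\<And>x. x \<in> carrier G \<Longrightarrow> \<exists>k::nat. x = g [^] k"
    and n: "n > 0" "c \<noteq> 0" and pow: "\<And>\<zeta>. \<zeta> ^ n = c \<Longrightarrow> \<zeta> ^ Coset.order G = 1"
    and Y: "\<And>\<theta>. \<theta> \<in> characters G \<Longrightarrow> \<theta> g ^ n = c \<Longrightarrow> \<theta> \<in> Y" "Y \<subseteq> characters G"
  shows "n \<le> card Y"
proof -
  have finY: "finite Y" using finite_characters[OF fin] Y(2) by (rule rev_finite_subset)
  have "{\<zeta>. \<zeta> ^ n = c} \<subseteq> (\<lambda>\<theta>. \<theta> g) ` Y"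
  proof
    fix \<zeta> assume "\<zeta> \<in> {\<zeta>. \<zeta> ^ n = c}"
    then have \<zeta>: "\<zeta> ^ n = c" by simp
    obtain \<theta> where "\<theta> \<in> characters G" "\<theta> g = \<zeta>"
      using cyclic_character_exists[OF fin g gen pow[OF \<zeta>]] by blast
    then show "\<zeta> \<in> (\<lambda>\<theta>. \<theta> g) ` Y" using Y(1) \<zeta> by blast
  qed
  then have "card {\<zeta>. \<zeta> ^ n = c} \<le> card ((\<lambda>\<theta>. \<theta> g) ` Y)" using finY by (intro card_mono) auto
  also have "\<dots> \<le> card Y" by (rule card_image_le[OF finY])
  finally show ?thesis using card_nth_roots[OF n(2,1)] by simp
qed

end

context quad_ext
begin

sublocale F: Group.group "mult_grp (Fq :: 'a ring)" by (rule group_mult_Fq)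

lemma order_Fq: "Coset.order (mult_grp (Fq :: 'a ring)) = CARD('a) - 1"
  by (simp add: Coset.order_def mult_grp_Fq card_Diff_singleton)

lemma power_card_minus_one: "x \<noteq> 0 \<Longrightarrow> x ^ (CARD('a) - 1) = (1::'a)"
  using F.pow_order_eq_1[of x] by (simp add: order_Fq pow_mult_Fq mult_grp_Fq)

lemma card_characters_Fq: "CARD('a) - 1 \<le> card (characters (mult_grp (Fq :: 'a ring)))"
proof (rule F.card_roots_le_card_characters[where g = \<eta> and c = 1])
  show fin: "finite (carrier (mult_grp (Fq :: 'a ring)))" by simp
  show \<eta>: "\<eta> \<in> carrier (mult_grp Fq)" using \<eta>_nz by (simp add: mult_grp_Fq)
  show "\<exists>k::nat. x = \<eta> [^]\<^bsub>mult_grp Fq\<^esub> k" if "x \<in> carrier (mult_grp Fq)" for x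
  proof -
    have "F.ord \<eta> \<noteq> 0" using F.ord_ge_1[OF fin \<eta>] by simp
    then have "x \<in> {\<eta> [^]\<^bsub>mult_grp Fq\<^esub> k | k. k \<in> (UNIV :: nat set)}"
      using that F.generate_pow_nat[OF \<eta>] gen by simp
    then show ?thesis by blast
  qed
qed (use card_ge_2[where 'a='a] in \<open>auto simp: order_Fq\<close>)

lemma Lx_generator:
  obtains g where "g \<in> carrier Lx" "\<And>x. x \<in> carrier Lx \<Longrightarrow> \<exists>k::nat. x = g [^]\<^bsub>Lx\<^esub> k"
proof -
  have "finite (carrier (Fq2 \<eta>))" by simp
  from field.finite_field_mult_group_has_gen[OF field_Fq2 this]
  obtain g where g: "g \<in> carrier Lx" "carrier Lx = {g [^]\<^bsub>Fq2 \<eta>\<^esub> i | i::nat. i \<in> UNIV}" by blast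
  have gen: "\<exists>k::nat. x = g [^]\<^bsub>Lx\<^esub> k" if "x \<in> carrier Lx" for x
    using that unfolding g(2) Multiplicative_Group.nat_pow_mult_of by blast
  show ?thesis by (rule that[OF g(1) gen])
qed

text \<open>For a generator g the power g^(q + 1) generates the multiplicative group of the base
  field, so a character restricts like \<nu>0 as soon as it agrees with \<nu>0 at this
  power.\<close>

lemma card_extensions:
  assumes \<nu>0: "\<nu>0 \<in> characters Lx"
  shows "CARD('a) + 1 \<le> card {\<nu> \<in> characters Lx. sharp \<nu> = sharp \<nu>0}"
proof -
  obtain g where g: "g \<in> carrier Lx" and gen: "\<And>x. x \<in> carrier Lx \<Longrightarrow> \<exists>k::nat. x = g [^]\<^bsub>Lx\<^esub> k"
    by (rule Lx_generator) (rule that)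
  note c0 = charactersD_group[OF \<nu>0 group_Lx]
  have fin: "finite (carrier Lx)" by simp
  show ?thesis
  proof (rule L.card_roots_le_card_characters[OF fin g gen, where c = "\<nu>0 g ^ (CARD('a) + 1)"])
    show "\<zeta> ^ Coset.order Lx = 1" if \<zeta>: "\<zeta> ^ (CARD('a) + 1) = \<nu>0 g ^ (CARD('a) + 1)" for \<zeta>
    proof -
      have "\<zeta> ^ Coset.order Lx = (\<zeta> ^ (CARD('a) + 1)) ^ (CARD('a) - 1)"
        unfolding order_Lx power_mult[symmetric] by (simp only: mult.commute)
      also have "\<dots> = \<nu>0 g ^ Coset.order Lx"
        unfolding \<zeta> order_Lx power_mult[symmetric] by (simp only: mult.commute)
      also have "\<dots> = 1" using c0(6)[OF g] L.pow_order_eq_1[OF g] c0(3) by metis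
      finally show ?thesis .
    qed
    show "\<theta> \<in> {\<nu> \<in> characters Lx. sharp \<nu> = sharp \<nu>0}"
      if \<theta>: "\<theta> \<in> characters Lx" "\<theta> g ^ (CARD('a) + 1) = \<nu>0 g ^ (CARD('a) + 1)" for \<theta>
    proof -
      note c = charactersD_group[OF \<theta>(1) group_Lx]
      have "sharp \<theta> x = sharp \<nu>0 x" for x
      proof (cases "x = 0")
        case True
        then show ?thesis using charL(2)[OF \<theta>(1)] charL(2)[OF \<nu>0] by (simp add: sharp_def)
      next
        case False
        then have "(x, 0) \<in> carrier Lx" by (simp add: carrier_Lx)
        then obtain k :: nat where k: "(x, 0) = g [^]\<^bsub>Lx\<^esub> k" using gen by blast
        \<comment> \<open>From x^(q - 1) = 1 the order (q - 1) (q + 1) of g divides k (q - 1), hence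
          q + 1 divides k.\<close>
        have "g [^]\<^bsub>Lx\<^esub> (k * (CARD('a) - 1)) = \<one>\<^bsub>Lx\<^esub>"
          unfolding L.nat_pow_pow[OF g, symmetric] k[symmetric] pow_Lx one_Lx
          using power_card_minus_one[OF False] by simp
        then have "L.ord g dvd k * (CARD('a) - 1)" using L.pow_eq_id[OF g] by simp
        moreover have "L.ord g = Coset.order Lx"
          by (rule L.ord_generator[OF fin g gen])
        ultimately have "(CARD('a) - 1) * (CARD('a) + 1) dvd (CARD('a) - 1) * k"
          by (simp only: order_Lx mult.commute)
        then have "CARD('a) + 1 dvd k"
          using card_ge_2[where 'a='a] by (subst (asm) nat_mult_dvd_cancel_disj) auto
        then obtain m where m: "k = (CARD('a) + 1) * m" by (auto simp: dvd_def)
        have "\<theta> (x, 0) = (\<theta> g ^ (CARD('a) + 1)) ^ m"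
          unfolding k c(6)[OF g] m by (simp only: power_mult)
        also have "\<dots> = \<nu>0 (x, 0)"
          unfolding \<theta>(2) k c0(6)[OF g] m by (simp only: power_mult)
        finally show ?thesis by (simp add: sharp_def)
      qed
      then show ?thesis using \<theta>(1) by auto
    qed
  qed (use c0(1)[OF g] in auto)
qed

lemma finite_chars: "finite (characters (mult_grp (Fq :: 'a ring)))" "finite (characters Lx)"
  by (rule F.finite_characters L.finite_characters; simp)+

definition square_roots :: "('a \<times> 'a \<Rightarrow> complex) \<Rightarrow> ('a \<Rightarrow> complex) set" where
  "square_roots \<nu>0 = {\<psi> \<in> characters (mult_grp Fq). (\<lambda>x. \<psi> x ^ 2) = sharp \<nu>0}"

lemma square_root_mult:
  assumes "\<psi> \<in> square_roots \<nu>0" shows "\<psi> x * \<psi> x = \<nu>0 (x, 0)"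
  using assms by (auto simp: square_roots_def fun_eq_iff sharp_def power2_eq_square)

lemma finite_index_sets:
  "finite (square_roots \<nu>0)" "finite (principal_pairs \<nu>0 :: ('a \<Rightarrow> complex) set set)"
  "finite (cuspidal_pairs \<eta> \<nu>0)"
proof -
  show "finite (square_roots \<nu>0)"
    unfolding square_roots_def using finite_chars(1) by (rule rev_finite_subset) auto
  show "finite (principal_pairs \<nu>0 :: ('a \<Rightarrow> complex) set set)"
    by (rule finite_subset[of _ "Pow (characters (mult_grp Fq))"])
      (auto simp: principal_pairs_def finite_chars)
  show "finite (cuspidal_pairs \<eta> \<nu>0)"
    by (rule finite_subset[of _ "Pow (characters Lx)"])
      (auto simp: cuspidal_pairs_def finite_chars indecomposables_def bar_character)
qed

text \<open>Each \<psi> has the partner \<open>sharp\<close> \<nu>0 / \<psi>. It is either its own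
  partner, hence a square root, or lies in a pair, and a pair has at most two elements.\<close>

lemma card_principal_pairs:
  assumes \<nu>0: "\<nu>0 \<in> characters Lx"
  shows "CARD('a) - 1 \<le> card (square_roots \<nu>0) + 2 * card (principal_pairs \<nu>0 :: ('a \<Rightarrow> complex) set set)"
proof -
  let ?X = "characters (mult_grp (Fq :: 'a ring))" and ?PP = "principal_pairs \<nu>0 :: ('a \<Rightarrow> complex) set set"
  have "?X \<subseteq> square_roots \<nu>0 \<union> \<Union> ?PP"
  proof
    fix \<psi> assume \<psi>: "\<psi> \<in> ?X"
    note c = charactersD[OF \<psi>]
    define \<phi> where "\<phi> x = sharp \<nu>0 x / \<psi> x" for x
    have m: "\<psi> x * \<phi> x = sharp \<nu>0 x" for x
      using c(1)[of x] charL(2)[OF \<nu>0] by (cases "x = 0") (auto simp: \<phi>_def sharp_def)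
    have \<phi>: "\<phi> \<in> ?X"
      unfolding characters_def mult_grp_Fq
      using c charL(1,2)[OF \<nu>0] charL(4)[OF \<nu>0, of "(_, 0)" "(_, 0)"]
      by (auto simp: \<phi>_def sharp_def)
    show "\<psi> \<in> square_roots \<nu>0 \<union> \<Union> ?PP"
    proof (cases "\<psi> = \<phi>")
      case True
      then have "\<psi> x ^ 2 = sharp \<nu>0 x" for x using m[of x] by (simp add: power2_eq_square)
      then show ?thesis using \<psi> by (auto simp: square_roots_def)
    next
      case False
      then have "{\<psi>, \<phi>} \<in> ?PP"
        unfolding principal_pairs_def using \<psi> \<phi> m by (intro CollectI exI[of _ \<psi>] exI[of _ \<phi>]) auto
      then show ?thesis by blast
    qed
  qed
  moreover have PPX: "\<Union> ?PP \<subseteq> ?X" by (auto simp: principal_pairs_def)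
  ultimately have "card ?X \<le> card (square_roots \<nu>0 \<union> \<Union> ?PP)"
    using finite_index_sets(1) finite_chars by (intro card_mono) (auto intro: finite_subset)
  also have "\<dots> \<le> card (square_roots \<nu>0) + card (\<Union> ?PP)" by (rule card_Un_le)
  also have "card (\<Union> ?PP) \<le> (\<Sum>P\<in>?PP. card P)" by (rule card_Union_le_sum_card)
  also have "\<dots> \<le> (\<Sum>P\<in>?PP. 2)"
  proof (rule sum_mono)
    fix P assume "P \<in> ?PP"
    then obtain \<psi>1 \<psi>2 where "P = {\<psi>1, \<psi>2}" by (auto simp: principal_pairs_def)
    then show "card P \<le> 2" by (simp add: card_insert_if)
  qed
  finally show ?thesis using card_characters_Fq by simp
qed

text \<open>A decomposable extension of \<open>sharp\<close> \<nu>0 comes from a square root \<psi>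
  since the norm of x in the base field is x^2. The summand 2 accounts for \<nu>0 and
  \<open>bar\<close> \<nu>0, and all other extensions lie in pairs.\<close>

lemma card_cuspidal_pairs:
  assumes \<nu>0: "\<nu>0 \<in> characters Lx"
  shows "CARD('a) + 1 \<le> card (square_roots \<nu>0) + 2 + 2 * card (cuspidal_pairs \<eta> \<nu>0)"
proof -
  let ?Y = "{\<nu> \<in> characters Lx. sharp \<nu> = sharp \<nu>0}" and ?CP = "cuspidal_pairs \<eta> \<nu>0"
  let ?D = "(\<lambda>\<psi> w. \<psi> (nrm \<eta> w)) ` square_roots \<nu>0"
  have "?Y \<subseteq> ?D \<union> {\<nu>0, bar \<nu>0} \<union> \<Union> ?CP"
  proof
    fix \<nu> assume "\<nu> \<in> ?Y"
    then have \<nu>: "\<nu> \<in> characters Lx" "sharp \<nu> = sharp \<nu>0" by auto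
    show "\<nu> \<in> ?D \<union> {\<nu>0, bar \<nu>0} \<union> \<Union> ?CP"
    proof (cases "decomposable \<eta> \<nu>")
      case True
      then obtain \<psi> where \<psi>: "\<psi> \<in> characters (mult_grp Fq)"
        "\<And>w. w \<in> carrier Lx \<Longrightarrow> \<nu> w = \<psi> (nrm \<eta> w)" unfolding decomposable_def by blast
      note c = charactersD[OF \<psi>(1)]
      have e: "\<nu> w = \<psi> (nrm \<eta> w)" for w
        using \<psi>(2)[of w] charL(2)[OF \<nu>(1)] c(5)
        by (cases "w = (0, 0)") (auto simp: carrier_Lx nrm_simp)
      have "\<psi> x ^ 2 = sharp \<nu>0 x" for x
        using c(2)[of x x] c(5) unfolding \<nu>(2)[symmetric]
        by (cases "x = 0") (auto simp: sharp_def e nrm_simp power2_eq_square)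
      then have "\<psi> \<in> square_roots \<nu>0" using \<psi>(1) by (auto simp: square_roots_def)
      moreover have "\<nu> = (\<lambda>w. \<psi> (nrm \<eta> w))" using e by auto
      ultimately show ?thesis by blast
    next
      case False
      then have i: "\<nu> \<in> indecomposables \<eta>" using \<nu>(1) by (simp add: indecomposables_def)
      show ?thesis
      proof (cases "\<nu> = \<nu>0 \<or> \<nu> = bar \<nu>0")
        case False
        then have "{\<nu>, bar \<nu>} \<in> ?CP" unfolding cuspidal_pairs_def using i \<nu>(2) by blast
        then show ?thesis by blast
      qed auto
    qed
  qed
  moreover have "\<Union> ?CP \<subseteq> characters Lx"
    by (auto simp: cuspidal_pairs_def indecomposables_def bar_character)
  ultimately have "card ?Y \<le> card (?D \<union> {\<nu>0, bar \<nu>0} \<union> \<Union> ?CP)"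
    using finite_index_sets(1) finite_chars by (intro card_mono) (auto intro: finite_subset)
  also have "\<dots> \<le> card ?D + card {\<nu>0, bar \<nu>0} + card (\<Union> ?CP)"
    using card_Un_le[of "?D \<union> {\<nu>0, bar \<nu>0}" "\<Union> ?CP"] card_Un_le[of ?D "{\<nu>0, bar \<nu>0}"] by linarith
  also have "card ?D \<le> card (square_roots \<nu>0)" by (rule card_image_le[OF finite_index_sets(1)])
  also have "card {\<nu>0, bar \<nu>0} \<le> 2" by (simp add: card_insert_if)
  also have "card (\<Union> ?CP) \<le> (\<Sum>P\<in>?CP. card P)" by (rule card_Union_le_sum_card)
  also have "\<dots> \<le> (\<Sum>P\<in>?CP. 2)"
  proof (rule sum_mono)
    fix P assume "P \<in> ?CP"
    then obtain \<nu> where "P = {\<nu>, bar \<nu>}" by (auto simp: cuspidal_pairs_def)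
    then show "card P \<le> 2" by (simp add: card_insert_if)
  qed
  finally show ?thesis using card_extensions[OF \<nu>0] by simp
qed

lemma dimension_count:
  assumes \<nu>0: "\<nu>0 \<in> characters Lx"
  shows "(CARD('a) - 1) * CARD('a) \<le> card (square_roots \<nu>0) * CARD('a) +
    card (principal_pairs \<nu>0 :: ('a \<Rightarrow> complex) set set) * (CARD('a) + 1) +
    card (cuspidal_pairs \<eta> \<nu>0) * (CARD('a) - 1)"
proof -
  define s where "s = card (square_roots \<nu>0)"
  define p where "p = card (principal_pairs \<nu>0 :: ('a \<Rightarrow> complex) set set)"
  define c where "c = card (cuspidal_pairs \<eta> \<nu>0)"
  obtain k where k: "CARD('a) = k + 1" using card_ge_2[where 'a='a] by (metis add.commute le_Suc_ex add_2_eq_Suc' Suc_eq_plus1)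
  have p: "k \<le> s + 2 * p" and c: "k \<le> s + 2 * c"
    using card_principal_pairs[OF \<nu>0] card_cuspidal_pairs[OF \<nu>0] by (simp_all add: s_def p_def c_def k)
  \<comment> \<open>The two counts are weighted with the dimensions q + 1 = k + 2 and q - 1 = k of
    the summands that they count; the square roots then receive 2 (k + 1) = 2 q in total.\<close>
  have "k * (k + 2) \<le> (s + 2 * p) * (k + 2)" by (rule mult_le_mono1[OF p])
  moreover have "k * k \<le> (s + 2 * c) * k" by (rule mult_le_mono1[OF c])
  ultimately have "2 * (k * (k + 1)) \<le> 2 * (s * (k + 1) + p * (k + 2) + c * k)"
    by (simp add: algebra_simps)
  then show ?thesis unfolding s_def[symmetric] p_def[symmetric] c_def[symmetric] k by simp
qed

section \<open>The decomposition\<close>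

lemma ind_char_cartan:
  assumes "\<nu>0 \<in> characters Lx" shows "ind_char GL2 (cartan \<eta>) (cartan_char \<nu>0)"
proof (intro ind_char.intro subgroup_cartan GL2.is_group ind_char_axioms.intro)
  show "cartan_char \<nu>0 h \<noteq> 0" if h: "h \<in> cartan \<eta>" for h
  proof -
    obtain w where "h = cm w" "w \<noteq> (0, 0)" using h unfolding cartan_eq by blast
    then show ?thesis by (simp only: cartan_char_cm charL(1)[OF assms] not_False_eq_True)
  qed
  show "cartan_char \<nu>0 (h \<otimes>\<^bsub>GL2\<^esub> k) = cartan_char \<nu>0 h * cartan_char \<nu>0 k"
    if "h \<in> cartan \<eta>" "k \<in> cartan \<eta>" for h k
    using that by (auto simp: cartan_eq cartan_char_cm mult_GL2 cm_mult charL(4)[OF assms] simp del: qm_simp)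
qed simp

text \<open>The matrices with second row \<open>(0, 1)\<close> form a transversal of the Cartan subgroup: its
  elements are determined by their second row.\<close>

lemma cartan_induced_span:
  assumes \<nu>0: "\<nu>0 \<in> characters Lx"
  shows "\<exists>D. finite D \<and> card D \<le> (CARD('a) - 1) * CARD('a) \<and>
    vspace (ind_rep GL2 (cartan \<eta>) (char_rep (cartan_char \<nu>0))) \<subseteq> fun_space.span D"
proof -
  interpret C: ind_char GL2 "cartan \<eta>" "cartan_char \<nu>0" by (rule ind_char_cartan[OF \<nu>0])
  define P where "P = (\<lambda>(a, b). m2 a b 0 1) ` ((UNIV - {0 :: 'a}) \<times> (UNIV :: 'a set))"
  have P: "P \<subseteq> carrier GL2" by (auto simp: P_def carrier_GL2)
  have row: "x $ 2 $ 1 = snd w \<and> x $ 2 $ 2 = fst w" if "p \<in> P" "x = p ** cm w" for p x w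
    using that by (auto simp: P_def cm_def)
  have dec: "\<exists>w. w \<noteq> (0, 0) \<and> x = p ** cm w" if x: "x \<in> carrier GL2" and p: "p \<in> P" "inv\<^bsub>GL2\<^esub> p \<otimes>\<^bsub>GL2\<^esub> x \<in> cartan \<eta>" for x p
  proof -
    obtain w where w: "inv\<^bsub>GL2\<^esub> p \<otimes>\<^bsub>GL2\<^esub> x = cm w" "w \<noteq> (0, 0)" using p(2) by (auto simp: cartan_eq)
    have "p \<in> carrier GL2" using p(1) P by blast
    then have "x = p \<otimes>\<^bsub>GL2\<^esub> (inv\<^bsub>GL2\<^esub> p \<otimes>\<^bsub>GL2\<^esub> x)" using x by (simp add: GL2.m_assoc[symmetric])
    from this[unfolded w(1), unfolded mult_GL2] w(2) show ?thesis by (intro exI[of _ w] conjI)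
  qed
  have "vspace C.I \<subseteq> fun_space.span (C.delta ` P)"
  proof (rule C.delta_span[OF P])
    fix x :: "'a^2^2" assume x: "x \<in> carrier GL2"
    show "\<exists>p\<in>P. inv\<^bsub>GL2\<^esub> p \<otimes>\<^bsub>GL2\<^esub> x \<in> cartan \<eta>"
    proof (rule m2_cases[of x])
      fix a b c d assume e: "x = m2 a b c d"
      have D: "a * d - b * c \<noteq> 0" using x by (simp add: e carrier_GL2)
      \<comment> \<open>The second row of \<open>cm (d, c)\<close> is that of x, namely (c, d), so
        dividing by it on the right leaves the second row (0, 1).\<close>
      then have w: "(d, c) \<noteq> (0, 0)" by auto
      define y where "y = x ** cm (qinv (d, c))"
      have n: "nrm \<eta> (d, c) \<noteq> 0" using w nrm_eq_0 by blast
      have "y $ 2 $ 1 = 0" "y $ 2 $ 2 = 1"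
      proof -
        show "y $ 2 $ 1 = 0" by (simp add: y_def e cm_def qinv_def)
        have "y $ 2 $ 2 = (d\<^sup>2 - \<eta> * c\<^sup>2) / nrm \<eta> (d, c)"
          by (simp add: y_def e cm_def qinv_def power2_eq_square diff_divide_distrib mult_ac)
        then show "y $ 2 $ 2 = 1" using n by (simp add: nrm_simp)
      qed
      then have y: "y = m2 (y $ 1 $ 1) (y $ 1 $ 2) 0 1" using m2_eta[of y] by simp
      have yG: "y \<in> carrier GL2"
        using x n w by (simp add: y_def carrier_GL2 det_mul det_cm nrm_qinv)
      then have "det (m2 (y $ 1 $ 1) (y $ 1 $ 2) 0 1) \<noteq> 0" using y by (simp add: carrier_GL2)
      then have "y \<in> P" unfolding P_def by (subst y) (force simp: image_iff)
      moreover have "inv\<^bsub>GL2\<^esub> y \<otimes>\<^bsub>GL2\<^esub> x = cm (d, c)"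
      proof -
        have "y ** cm (d, c) = x"
          using w by (simp add: y_def matrix_mul_assoc[symmetric] cm_mult qm_qinv qm_comm[of "qinv (d, c)"] cm_one del: qm_simp)
        then have "x = y \<otimes>\<^bsub>GL2\<^esub> cm (d, c)" by (simp add: mult_GL2)
        then show ?thesis using yG cm_GL2[OF w] by (simp add: GL2.m_assoc[symmetric])
      qed
      ultimately show ?thesis using w by (auto simp: cartan_eq)
    qed
    fix p p' assume p: "p \<in> P" "p' \<in> P" "inv\<^bsub>GL2\<^esub> p \<otimes>\<^bsub>GL2\<^esub> x \<in> cartan \<eta>" "inv\<^bsub>GL2\<^esub> p' \<otimes>\<^bsub>GL2\<^esub> x \<in> cartan \<eta>"
    obtain w w' where w: "w \<noteq> (0, 0)" "x = p ** cm w" "x = p' ** cm w'"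
      using dec[OF x p(1,3)] dec[OF x p(2,4)] by blast
    have "w = w'" using row[OF p(1) w(2)] row[OF p(2) w(3)] by (simp add: prod_eq_iff)
    then have "p ** cm w ** cm (qinv w) = p' ** cm w ** cm (qinv w)" using w by simp
    then show "p = p'" using w(1) by (simp add: matrix_mul_assoc[symmetric] cm_mult qm_qinv cm_one)
  qed
  moreover have "card (C.delta ` P) \<le> (CARD('a) - 1) * CARD('a)"
  proof -
    have "card (C.delta ` P) \<le> card P" by (rule card_image_le) simp
    also have "\<dots> \<le> card ((UNIV - {0 :: 'a}) \<times> (UNIV :: 'a set))" unfolding P_def by (rule card_image_le) simp
    also have "\<dots> = (CARD('a) - 1) * CARD('a)" by (simp add: card_cartesian_product card_Diff_singleton)
    finally show ?thesis .
  qed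
  ultimately show ?thesis by (intro exI[of _ "C.delta ` P"]) auto
qed

abbreviation "target \<nu>0 \<equiv> ind_rep GL2 (cartan \<eta>) (char_rep (cartan_char \<nu>0))"

abbreviation "cl \<equiv> (\<lambda>(d, t). cls d t) :: 'a \<times> 'a \<Rightarrow> 'a^2^2 \<Rightarrow> complex"

text \<open>Along with the constituent, the scalars used for separation are recorded:
  \<open>(1, 2)\<close> distinguishes the kinds, and \<open>(a, a + 1)\<close> recovers
  \<psi>.\<close>

lemma constituent_chi_hat1:
  assumes \<nu>0: "\<nu>0 \<in> indecomposables \<eta>" and \<psi>: "\<psi> \<in> square_roots \<nu>0"
  shows "\<exists>\<omega>. constituent GL2 (target \<nu>0) cl (chi_hat1 \<psi>) \<omega> CARD('a) \<and> \<omega> (1, 2) = 0 \<and>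
    (\<forall>a. a \<noteq> 0 \<longrightarrow> a \<noteq> 1 \<longrightarrow> \<omega> (a, a + 1) = of_nat (CARD('a) + 1) * \<psi> a)"
proof -
  interpret S: steinberg \<eta> \<psi> using \<psi> by unfold_locales (simp add: square_roots_def)
  have "constituent GL2 (target \<nu>0) cl (chi_hat1 \<psi>) (\<lambda>(d, t). S.omega_chi1 d t) CARD('a)"
    unfolding constituent_def
  proof (intro conjI)
    show "group_rep GL2 (chi_hat1 \<psi>)" by (rule S.group_rep_chi_hat1)
    show "\<exists>T. intertwiner GL2 (chi_hat1 \<psi>) (target \<nu>0) T \<and> (\<forall>v\<in>vspace (chi_hat1 \<psi>). T v = 0 \<longrightarrow> v = 0)"
      using S.intertwiner_embed1 S.embed_injective1[OF \<nu>0 square_root_mult[OF \<psi>]] \<nu>0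
      unfolding indecomposables_def by blast
    show "\<forall>z. \<forall>v\<in>vspace (chi_hat1 \<psi>). class_sum GL2 (chi_hat1 \<psi>) (cl z) v =
        scal (chi_hat1 \<psi>) (case z of (d, t) \<Rightarrow> S.omega_chi1 d t) v"
      using S.class_sum_chi_hat1 by auto
    show "\<exists>S\<subseteq>vspace (chi_hat1 \<psi>). finite S \<and> \<not> module.dependent (scal (chi_hat1 \<psi>)) S \<and> card S = CARD('a)"
      using S.independent_chi_hat1 by (simp add: S.chi_hat1_simps(2) S.P.B.I_simps(1))
  qed
  then show ?thesis using S.omega_chi1_unipotent S.omega_chi1_split
    by (intro exI[of _ "\<lambda>(d, t). S.omega_chi1 d t"]) auto
qed

lemma constituent_chi_hat:
  assumes \<nu>0: "\<nu>0 \<in> indecomposables \<eta>"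
    and \<psi>: "\<psi>1 \<in> characters (mult_grp Fq)" "\<psi>2 \<in> characters (mult_grp Fq)" "\<psi>1 \<noteq> \<psi>2"
      "\<And>x. \<psi>1 x * \<psi>2 x = \<nu>0 (x, 0)"
  shows "\<exists>\<omega>. constituent GL2 (target \<nu>0) cl (chi_hat \<psi>1 \<psi>2) \<omega> (CARD('a) + 1) \<and>
    \<omega> (1, 2) = of_nat (CARD('a) - 1) \<and>
    (\<forall>a. a \<noteq> 0 \<longrightarrow> a \<noteq> 1 \<longrightarrow> \<omega> (a, a + 1) = of_nat CARD('a) * (\<psi>1 a + \<psi>2 a))"
proof -
  interpret S: principal \<eta> \<psi>1 \<psi>2 using \<psi> by unfold_locales
  have "constituent GL2 (target \<nu>0) cl (chi_hat \<psi>1 \<psi>2) (\<lambda>(d, t). S.omega_chi d t) (CARD('a) + 1)"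
    unfolding constituent_def
  proof (intro conjI)
    show "group_rep GL2 (chi_hat \<psi>1 \<psi>2)" by (rule group_rep_chi_hat[OF \<psi>(1,2)])
    have c: "\<nu>0 \<in> characters Lx" using \<nu>0 by (simp add: indecomposables_def)
    show "\<exists>T. intertwiner GL2 (chi_hat \<psi>1 \<psi>2) (target \<nu>0) T \<and> (\<forall>v\<in>vspace (chi_hat \<psi>1 \<psi>2). T v = 0 \<longrightarrow> v = 0)"
      using S.intertwiner_embed[OF c] S.embed_injective[OF \<psi>(3) c \<psi>(4)] by blast
    show "\<forall>z. \<forall>v\<in>vspace (chi_hat \<psi>1 \<psi>2). class_sum GL2 (chi_hat \<psi>1 \<psi>2) (cl z) v =
        scal (chi_hat \<psi>1 \<psi>2) (case z of (d, t) \<Rightarrow> S.omega_chi d t) v"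
      using S.class_sum_chi_hat[OF \<psi>(3)] by auto
    show "\<exists>S\<subseteq>vspace (chi_hat \<psi>1 \<psi>2). finite S \<and> \<not> module.dependent (scal (chi_hat \<psi>1 \<psi>2)) S \<and> card S = CARD('a) + 1"
      using S.independent_chi_hat unfolding S.chi_hat_eq S.B.I_simps(1) .
  qed
  then show ?thesis using S.omega_chi_unipotent S.omega_chi_split
    by (intro exI[of _ "\<lambda>(d, t). S.omega_chi d t"]) auto
qed

text \<open>The sum counts the elements of the class. That it is a natural number fixes the sign of
  the cuspidal scalars, and its positivity allows it to be cancelled.\<close>

lemma class_size:
  "\<exists>m. (\<Sum>g\<in>carrier GL2. cls d t g) = of_nat m \<and> (\<forall>g\<in>carrier GL2. cls d t g \<noteq> 0 \<longrightarrow> m > 0)"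
  for d t :: 'a
proof -
  let ?S = "{g \<in> carrier GL2. cls d t g \<noteq> 0}"
  have "(\<Sum>g\<in>carrier GL2. cls d t g) = (\<Sum>g\<in>?S. 1)"
    by (rule sum.mono_neutral_cong_right) (auto simp: cls_def split: if_splits)
  then have "(\<Sum>g\<in>carrier GL2. cls d t g) = of_nat (card ?S)" by simp
  moreover have "card ?S > 0" if "g \<in> carrier GL2" "cls d t g \<noteq> 0" for g
    using that by (auto simp: card_gt_0_iff)
  ultimately show ?thesis by blast
qed

end

context add_char
begin

lemma constituent_cusp:
  assumes \<nu>0: "\<nu>0 \<in> indecomposables \<eta>"
    and \<nu>: "\<nu> \<in> indecomposables \<eta>" "sharp \<nu> = sharp \<nu>0" "\<nu> \<noteq> \<nu>0" "bar \<nu> \<noteq> \<nu>0"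
  shows "\<exists>\<omega>. constituent GL2 (target \<nu>0) cl (cusp_rep \<eta> \<xi> \<nu>) \<omega> (CARD('a) - 1) \<and>
    (\<exists>m>0. \<omega> (1, 2) = - (of_nat m / of_nat (CARD('a) - 1))) \<and>
    (\<forall>c. snd c \<noteq> 0 \<longrightarrow> \<omega> (nrm \<eta> c, trc \<eta> c) =
      - (\<Sum>g\<in>carrier GL2. cls (nrm \<eta> c) (trc \<eta> c) g) / of_nat (CARD('a) - 1) * (\<nu> c + bar \<nu> c))"
proof -
  interpret S: cuspidal \<eta> \<xi> \<nu> using \<nu>(1) by unfold_locales
  have "constituent GL2 (target \<nu>0) cl (cusp_rep \<eta> \<xi> \<nu>) (\<lambda>(d, t). S.omega_cusp d t) (CARD('a) - 1)"
    unfolding constituent_def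
  proof (intro conjI)
    show "group_rep GL2 (cusp_rep \<eta> \<xi> \<nu>)" by (rule S.group_rep_cusp)
    have c: "\<nu>0 \<in> characters Lx" using \<nu>0 by (simp add: indecomposables_def)
    show "\<exists>T. intertwiner GL2 (cusp_rep \<eta> \<xi> \<nu>) (target \<nu>0) T \<and> (\<forall>v\<in>vspace (cusp_rep \<eta> \<xi> \<nu>). T v = 0 \<longrightarrow> v = 0)"
      by (rule S.cusp_embeds[OF c \<nu>(2,3,4)])
    show "\<forall>z. \<forall>v\<in>vspace (cusp_rep \<eta> \<xi> \<nu>). class_sum GL2 (cusp_rep \<eta> \<xi> \<nu>) (cl z) v =
        scal (cusp_rep \<eta> \<xi> \<nu>) (case z of (d, t) \<Rightarrow> S.omega_cusp d t) v"
      using S.class_sum_cusp by auto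
    show "\<exists>S\<subseteq>vspace (cusp_rep \<eta> \<xi> \<nu>). finite S \<and> \<not> module.dependent (scal (cusp_rep \<eta> \<xi> \<nu>)) S \<and> card S = CARD('a) - 1"
      using S.independent_dl S.dl_in unfolding S.cusp_simps(2)
      by (intro exI[of _ "S.dl ` (UNIV - {0})"]) auto
  qed
  moreover have "\<exists>m>0. S.omega_cusp 1 2 = - (of_nat m / of_nat (CARD('a) - 1))"
  proof -
    obtain m where m: "(\<Sum>g\<in>carrier GL2. cls (1::'a) 2 g) = of_nat m" "\<forall>g\<in>carrier GL2. cls (1::'a) 2 g \<noteq> 0 \<longrightarrow> m > 0"
      using class_size by blast
    have "m2 1 1 0 1 \<in> (carrier GL2 :: ('a^2^2) set)" "cls (1::'a) 2 (m2 1 1 0 1) \<noteq> 0"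
      by (simp_all add: carrier_GL2 cls_def mat_m2)
    then have "m > 0" using m(2) by blast
    \<comment> \<open>The only eigenvalue of a unipotent matrix is 1, where \<nu> is 1; so the
      scalar is minus the class size over q - 1.\<close>
    moreover have "{u. nrm \<eta> u = 1 \<and> trc \<eta> u = 2} = {(1, 0)}"
      using S.norm_trace_split[of _ 1 1] by (auto simp: nrm_simp trc_simp)
    then have "S.omega_cusp 1 2 = - (of_nat m / of_nat (CARD('a) - 1))"
      by (simp add: S.omega_cusp_def m(1) S.nu)
    ultimately show ?thesis by blast
  qed
  moreover have "S.omega_cusp (nrm \<eta> c) (trc \<eta> c) =
      - (\<Sum>g\<in>carrier GL2. cls (nrm \<eta> c) (trc \<eta> c) g) / of_nat (CARD('a) - 1) * (\<nu> c + bar \<nu> c)"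
    if c: "snd c \<noteq> 0" for c
    unfolding S.omega_cusp_def using S.sum_same_norm_trace[OF c] by simp
  ultimately show ?thesis by (intro exI[of _ "\<lambda>(d, t). S.omega_cusp d t"]) auto
qed

end

context add_char
begin

lemma decomposition:
  assumes \<nu>0: "\<nu>0 \<in> indecomposables \<eta>"
    and p: "\<And>P. P \<in> principal_pairs \<nu>0 \<Longrightarrow> {fst (p P), snd (p P)} = P"
    and r: "\<And>N. N \<in> cuspidal_pairs \<eta> \<nu>0 \<Longrightarrow> r N \<in> N"
  shows "rep_equiv GL2 (target \<nu>0) (direct_sum (square_roots \<nu>0) chi_hat1 \<oplus>\<^sub>R
     direct_sum (principal_pairs \<nu>0) (\<lambda>P. chi_hat (fst (p P)) (snd (p P))) \<oplus>\<^sub>R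
     direct_sum (cuspidal_pairs \<eta> \<nu>0) (\<lambda>N. cusp_rep \<eta> \<xi> (r N)))"
proof -
  let ?q = "CARD('a)"
  have c0: "\<nu>0 \<in> characters Lx" using \<nu>0 by (simp add: indecomposables_def)
  interpret C: ind_char GL2 "cartan \<eta>" "cartan_char \<nu>0" by (rule ind_char_cartan[OF c0])
  have qnz: "of_nat (?q - 1) \<noteq> (0::complex)" using card_ge_2[where 'a='a] by simp
  \<comment> \<open>Either ordering that \<open>p\<close> may choose satisfies the conditions, since
    they are symmetric in the two characters.\<close>
  have pair: "fst (p P) \<in> characters (mult_grp Fq)" "snd (p P) \<in> characters (mult_grp Fq)"
    "fst (p P) \<noteq> snd (p P)" "fst (p P) x * snd (p P) x = \<nu>0 (x, 0)"
    if P: "P \<in> principal_pairs \<nu>0" for P x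
  proof -
    obtain \<psi>1 \<psi>2 where \<psi>: "P = {\<psi>1, \<psi>2}" "\<psi>1 \<in> characters (mult_grp Fq)"
      "\<psi>2 \<in> characters (mult_grp Fq)" "\<psi>1 \<noteq> \<psi>2" "(\<lambda>x. \<psi>1 x * \<psi>2 x) = sharp \<nu>0"
      using P unfolding principal_pairs_def by blast
    have m: "\<psi>1 x * \<psi>2 x = \<nu>0 (x, 0)" using fun_cong[OF \<psi>(5), of x] by (simp add: sharp_def)
    have "fst (p P) = \<psi>1 \<and> snd (p P) = \<psi>2 \<or> fst (p P) = \<psi>2 \<and> snd (p P) = \<psi>1"
      using p[OF P] unfolding \<psi>(1) by (auto simp: doubleton_eq_iff)
    then show "fst (p P) \<in> characters (mult_grp Fq)" "snd (p P) \<in> characters (mult_grp Fq)"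
      "fst (p P) \<noteq> snd (p P)" "fst (p P) x * snd (p P) x = \<nu>0 (x, 0)"
      using \<psi>(2,3,4) m by (auto simp: mult.commute)
  qed
  have rep: "r N \<in> indecomposables \<eta>" "sharp (r N) = sharp \<nu>0" "r N \<noteq> \<nu>0" "bar (r N) \<noteq> \<nu>0"
    "{r N, bar (r N)} = N" if N: "N \<in> cuspidal_pairs \<eta> \<nu>0" for N
  proof -
    obtain \<nu> where \<nu>: "N = {\<nu>, bar \<nu>}" "\<nu> \<in> indecomposables \<eta>" "sharp \<nu> = sharp \<nu>0" "\<nu> \<noteq> \<nu>0" "\<nu> \<noteq> bar \<nu>0"
      using N unfolding cuspidal_pairs_def by blast
    have ne: "bar \<nu> \<noteq> \<nu>0" using \<nu>(5) bar_bar[of \<nu>] by auto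
    have "r N = \<nu> \<or> r N = bar \<nu>" using r[OF N] unfolding \<nu>(1) by blast
    then show "r N \<in> indecomposables \<eta>" "sharp (r N) = sharp \<nu>0" "r N \<noteq> \<nu>0" "bar (r N) \<noteq> \<nu>0"
      "{r N, bar (r N)} = N"
      using \<nu>(2,3,4) ne bar_indecomposable[OF \<nu>(2)] sharp_bar[of \<nu>] unfolding \<nu>(1) by (elim disjE; simp; blast?)+
  qed
  obtain o1 where o1: "\<And>\<psi>. \<psi> \<in> square_roots \<nu>0 \<Longrightarrow> constituent GL2 (target \<nu>0) cl (chi_hat1 \<psi>) (o1 \<psi>) ?q"
      "\<And>\<psi>. \<psi> \<in> square_roots \<nu>0 \<Longrightarrow> o1 \<psi> (1, 2) = 0"
      "\<And>\<psi> a. \<psi> \<in> square_roots \<nu>0 \<Longrightarrow> a \<noteq> 0 \<Longrightarrow> a \<noteq> 1 \<Longrightarrow> o1 \<psi> (a, a + 1) = of_nat (?q + 1) * \<psi> a"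
    using constituent_chi_hat1[OF \<nu>0] by metis
  obtain o2 where o2: "\<And>P. P \<in> principal_pairs \<nu>0 \<Longrightarrow>
        constituent GL2 (target \<nu>0) cl (chi_hat (fst (p P)) (snd (p P))) (o2 P) (?q + 1)"
      "\<And>P. P \<in> principal_pairs \<nu>0 \<Longrightarrow> o2 P (1, 2) = of_nat (?q - 1)"
      "\<And>P a. P \<in> principal_pairs \<nu>0 \<Longrightarrow> a \<noteq> 0 \<Longrightarrow> a \<noteq> 1 \<Longrightarrow>
        o2 P (a, a + 1) = of_nat ?q * (fst (p P) a + snd (p P) a)"
    using constituent_chi_hat[OF \<nu>0 pair] by metis
  obtain o3 where o3: "\<And>N. N \<in> cuspidal_pairs \<eta> \<nu>0 \<Longrightarrow>
        constituent GL2 (target \<nu>0) cl (cusp_rep \<eta> \<xi> (r N)) (o3 N) (?q - 1)"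
      "\<And>N. N \<in> cuspidal_pairs \<eta> \<nu>0 \<Longrightarrow> \<exists>m>0. o3 N (1, 2) = - (of_nat m / of_nat (?q - 1))"
      "\<And>N c. N \<in> cuspidal_pairs \<eta> \<nu>0 \<Longrightarrow> snd c \<noteq> 0 \<Longrightarrow> o3 N (nrm \<eta> c, trc \<eta> c) =
        - (\<Sum>g\<in>carrier GL2. cls (nrm \<eta> c) (trc \<eta> c) g) / of_nat (?q - 1) * (r N c + bar (r N) c)"
    using constituent_cusp[OF \<nu>0 rep(1-4)] by metis
  \<comment> \<open>On the unipotent class the cuspidal scalar is negative, while the other two
    kinds give 0 and q - 1.\<close>
  have o3_12: "o3 N (1, 2) \<noteq> 0" "o3 N (1, 2) \<noteq> of_nat (?q - 1)" if N: "N \<in> cuspidal_pairs \<eta> \<nu>0" for N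
  proof -
    obtain m where m: "m > 0" "o3 N (1, 2) = - (of_nat m / of_nat (?q - 1))" using o3(2)[OF N] by blast
    show "o3 N (1, 2) \<noteq> 0" unfolding m(2) using m(1) qnz by simp
    show "o3 N (1, 2) \<noteq> of_nat (?q - 1)"
    proof
      assume "o3 N (1, 2) = of_nat (?q - 1)"
      then have "of_nat m / of_nat (?q - 1) = (- of_nat (?q - 1) :: complex)"
        unfolding m(2) by (simp only: minus_equation_iff[of "of_nat m / of_nat (?q - 1)"])
      then have "of_nat m = (- of_nat (?q - 1) * of_nat (?q - 1) :: complex)"
        using qnz by (simp only: divide_eq_eq simp_thms if_True)
      then have "of_nat (m + (?q - 1) * (?q - 1)) = (0::complex)"
        by (simp only: of_nat_add of_nat_mult mult_minus_left left_minus)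
      then show False using m(1) unfolding of_nat_eq_0_iff by simp
    qed
  qed
  define \<omega> where "\<omega> = case_sum o1 (case_sum o2 o3)"
  \<comment> \<open>Characters agree at 0 and at 1, so a point where two of them differ always
    provides a class with distinct eigenvalues a and 1.\<close>
  have sep1: "\<exists>z. o1 \<psi> z \<noteq> o1 \<psi>' z" if \<psi>: "\<psi> \<in> square_roots \<nu>0" "\<psi>' \<in> square_roots \<nu>0" "\<psi> \<noteq> \<psi>'" for \<psi> \<psi>'
  proof -
    obtain a where a: "\<psi> a \<noteq> \<psi>' a" using \<psi>(3) by (auto simp: fun_eq_iff)
    have "\<psi> \<in> characters (mult_grp Fq)" "\<psi>' \<in> characters (mult_grp Fq)"
      using \<psi> by (auto simp: square_roots_def)
    then have "a \<noteq> 0" "a \<noteq> 1" using a charactersD(3,5) by metis+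
    then have "o1 \<psi> (a, a + 1) \<noteq> o1 \<psi>' (a, a + 1)"
      unfolding o1(3)[OF \<psi>(1) \<open>a \<noteq> 0\<close> \<open>a \<noteq> 1\<close>] o1(3)[OF \<psi>(2) \<open>a \<noteq> 0\<close> \<open>a \<noteq> 1\<close>]
      using a by (simp only: mult_cancel_left of_nat_eq_0_iff) simp
    then show ?thesis by blast
  qed
  \<comment> \<open>The scalars give the equality of the sums for a different from 1; at a = 1 both
    sums are 2.\<close>
  have sep2: "P = P'" if P: "P \<in> principal_pairs \<nu>0" "P' \<in> principal_pairs \<nu>0" and e: "\<And>z. o2 P z = o2 P' z" for P P'
  proof -
    have "{fst (p P), snd (p P)} = {fst (p P'), snd (p P')}"
    proof (rule F.two_characters_sum_eq)
      show "fst (p P) a + snd (p P) a = fst (p P') a + snd (p P') a" if "a \<in> carrier (mult_grp Fq)" for a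
      proof (cases "a = 1")
        case True
        show ?thesis
          unfolding True charactersD(3)[OF pair(1)[OF P(1)]] charactersD(3)[OF pair(2)[OF P(1)]]
            charactersD(3)[OF pair(1)[OF P(2)]] charactersD(3)[OF pair(2)[OF P(2)]] ..
      next
        case False
        have "a \<noteq> 0" using that by (simp add: mult_grp_Fq)
        from o2(3)[OF P(1) this False] o2(3)[OF P(2) this False] e[of "(a, a + 1)"] show ?thesis by simp
      qed
    qed (use pair P in simp_all)
    then show ?thesis using p[OF P(1)] p[OF P(2)] by simp
  qed
  \<comment> \<open>On the base field r N and r N' agree because both restrict to
    \<open>sharp\<close> \<nu>0; elsewhere the scalar of the class of \<open>cm c\<close> determines
    the sum with the conjugate.\<close>
  have sep3: "N = N'" if N: "N \<in> cuspidal_pairs \<eta> \<nu>0" "N' \<in> cuspidal_pairs \<eta> \<nu>0" and e: "\<And>z. o3 N z = o3 N' z" for N N'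
  proof -
    have ch: "r N \<in> characters Lx" "r N' \<in> characters Lx"
      using rep(1)[OF N(1)] rep(1)[OF N(2)] by (simp_all add: indecomposables_def)
    have "{r N, bar (r N)} = {r N', bar (r N')}"
    proof (rule L.two_characters_sum_eq)
      show "r N c + bar (r N) c = r N' c + bar (r N') c" if c: "c \<in> carrier Lx" for c
      proof (cases "snd c = 0")
        case True
        have "r N c = r N' c"
          using fun_cong[OF rep(2)[OF N(1)], of "fst c"] fun_cong[OF rep(2)[OF N(2)], of "fst c"] True
          by (cases c) (simp add: sharp_def)
        moreover have "conjg c = c" using True by (cases c) simp
        ultimately show ?thesis by (simp add: bar_def)
      next
        case False
        let ?s = "(\<Sum>g\<in>carrier GL2. cls (nrm \<eta> c) (trc \<eta> c) g)"
        have "cm c \<in> carrier GL2" using c by (intro cm_GL2) (simp add: carrier_Lx)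
        moreover have "cls (nrm \<eta> c) (trc \<eta> c) (cm c) \<noteq> 0"
          using False by (simp add: cls_def det_cm trace_cm) (simp add: cm_def mat_m2)
        ultimately have "?s \<noteq> 0"
          using class_size[of "nrm \<eta> c" "trc \<eta> c"] by (metis of_nat_eq_0_iff less_numeral_extra(3))
        then have "- ?s / of_nat (?q - 1) \<noteq> 0" using qnz by (simp only: divide_eq_0_iff neg_equal_0_iff_equal simp_thms)
        moreover have "- ?s / of_nat (?q - 1) * (r N c + bar (r N) c) = - ?s / of_nat (?q - 1) * (r N' c + bar (r N') c)"
          using o3(3)[OF N(1) False] o3(3)[OF N(2) False] e[of "(nrm \<eta> c, trc \<eta> c)"] by (simp only:)
        ultimately show ?thesis by (simp only: mult_cancel_left simp_thms)
      qed
    qed (use ch bar_character in simp_all)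
    then show ?thesis using rep(5)[OF N(1)] rep(5)[OF N(2)] by simp
  qed
  have sep: "\<exists>z. \<omega> k z \<noteq> \<omega> l z"
    if kl: "k \<in> square_roots \<nu>0 <+> principal_pairs \<nu>0 <+> cuspidal_pairs \<eta> \<nu>0"
      "l \<in> square_roots \<nu>0 <+> principal_pairs \<nu>0 <+> cuspidal_pairs \<eta> \<nu>0" "k \<noteq> l" for k l
  proof -
    have a12: "\<omega> (Inl \<psi>) (1, 2) \<noteq> \<omega> (Inr (Inl P)) (1, 2)" if "\<psi> \<in> square_roots \<nu>0" "P \<in> principal_pairs \<nu>0" for \<psi> P
      using o1(2)[OF that(1)] o2(2)[OF that(2)] qnz by (simp add: \<omega>_def)
    have a13: "\<omega> (Inl \<psi>) (1, 2) \<noteq> \<omega> (Inr (Inr N)) (1, 2)" if "\<psi> \<in> square_roots \<nu>0" "N \<in> cuspidal_pairs \<eta> \<nu>0" for \<psi> N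
      using o1(2)[OF that(1)] o3_12(1)[OF that(2)] by (simp add: \<omega>_def)
    have a23: "\<omega> (Inr (Inl P)) (1, 2) \<noteq> \<omega> (Inr (Inr N)) (1, 2)" if "P \<in> principal_pairs \<nu>0" "N \<in> cuspidal_pairs \<eta> \<nu>0" for P N
      using o2(2)[OF that(1)] o3_12(2)[OF that(2)] by (simp add: \<omega>_def)
    have b1: "\<exists>z. \<omega> (Inl \<psi>) z \<noteq> \<omega> (Inl \<psi>') z" if "\<psi> \<in> square_roots \<nu>0" "\<psi>' \<in> square_roots \<nu>0" "\<psi> \<noteq> \<psi>'" for \<psi> \<psi>'
      using sep1[OF that] by (simp add: \<omega>_def)
    have b2: "\<exists>z. \<omega> (Inr (Inl P)) z \<noteq> \<omega> (Inr (Inl P')) z" if "P \<in> principal_pairs \<nu>0" "P' \<in> principal_pairs \<nu>0" "P \<noteq> P'" for P P'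
      using sep2[OF that(1,2)] that(3) unfolding \<omega>_def sum.case by blast
    have b3: "\<exists>z. \<omega> (Inr (Inr N)) z \<noteq> \<omega> (Inr (Inr N')) z" if "N \<in> cuspidal_pairs \<eta> \<nu>0" "N' \<in> cuspidal_pairs \<eta> \<nu>0" "N \<noteq> N'" for N N'
      using sep3[OF that(1,2)] that(3) unfolding \<omega>_def sum.case by blast
    consider \<psi> where "k = Inl \<psi>" "\<psi> \<in> square_roots \<nu>0" | P where "k = Inr (Inl P)" "P \<in> principal_pairs \<nu>0"
      | N where "k = Inr (Inr N)" "N \<in> cuspidal_pairs \<eta> \<nu>0" using kl(1) by blast
    then show ?thesis
    proof cases
      case k: (1 \<psi>)
      consider \<psi>' where "l = Inl \<psi>'" "\<psi>' \<in> square_roots \<nu>0" | P where "l = Inr (Inl P)" "P \<in> principal_pairs \<nu>0"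
        | N where "l = Inr (Inr N)" "N \<in> cuspidal_pairs \<eta> \<nu>0" using kl(2) by blast
      then show ?thesis
        by cases (use b1[of \<psi>] a12[of \<psi>] a13[of \<psi>] k kl(3) in blast)+
    next
      case k: (2 P)
      consider \<psi>' where "l = Inl \<psi>'" "\<psi>' \<in> square_roots \<nu>0" | P' where "l = Inr (Inl P')" "P' \<in> principal_pairs \<nu>0"
        | N where "l = Inr (Inr N)" "N \<in> cuspidal_pairs \<eta> \<nu>0" using kl(2) by blast
      then show ?thesis
        by cases (use b2[of P] a12[of _ P] a23[of P] k kl(3) in \<open>metis\<close>)+
    next
      case k: (3 N)
      consider \<psi>' where "l = Inl \<psi>'" "\<psi>' \<in> square_roots \<nu>0" | P where "l = Inr (Inl P)" "P \<in> principal_pairs \<nu>0"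
        | N' where "l = Inr (Inr N')" "N' \<in> cuspidal_pairs \<eta> \<nu>0" using kl(2) by blast
      then show ?thesis
        by cases (use b3[of N] a13[of _ N] a23[of _ N] k kl(3) in \<open>metis\<close>)+
    qed
  qed
  obtain D where D: "finite D" "card D \<le> (?q - 1) * ?q" "vspace (target \<nu>0) \<subseteq> fun_space.span D"
    using cartan_induced_span[OF c0] by blast
  show ?thesis
  proof (rule equiv_of_constituents[where f = cl and \<omega> = \<omega> and D = D])
    show "group_rep GL2 (target \<nu>0)" by (rule C.group_rep_I)
    show "constituent GL2 (target \<nu>0) cl (chi_hat1 \<psi>) (\<omega> (Inl \<psi>)) ?q" if "\<psi> \<in> square_roots \<nu>0" for \<psi>
      using o1(1)[OF that] by (simp add: \<omega>_def)
    show "constituent GL2 (target \<nu>0) cl (chi_hat (fst (p P)) (snd (p P))) (\<omega> (Inr (Inl P))) (?q + 1)"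
      if "P \<in> principal_pairs \<nu>0" for P
      using o2(1)[OF that] by (simp add: \<omega>_def)
    show "constituent GL2 (target \<nu>0) cl (cusp_rep \<eta> \<xi> (r N)) (\<omega> (Inr (Inr N))) (?q - 1)"
      if "N \<in> cuspidal_pairs \<eta> \<nu>0" for N
      using o3(1)[OF that] by (simp add: \<omega>_def)
    show "vector_space (scal (chi_hat1 \<psi>))" for \<psi> :: "'a \<Rightarrow> complex"
    proof -
      have "scal (chi_hat1 \<psi>) = (\<lambda>c F x. c * F x)"
        by (simp add: chi_hat1_def chi_hat_def ind_rep_def char_rep_def)
      then show ?thesis using fun_space.vector_space_axioms by simp
    qed
    show "vector_space (scal (chi_hat (fst (p P)) (snd (p P))))" for P
    proof -
      have "scal (chi_hat (fst (p P)) (snd (p P))) = (\<lambda>c F x. c * F x)"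
        by (simp add: chi_hat_def ind_rep_def char_rep_def)
      then show ?thesis using fun_space.vector_space_axioms by simp
    qed
    show "vector_space (scal (cusp_rep \<eta> \<xi> (r N)))" for N
    proof -
      have "scal (cusp_rep \<eta> \<xi> (r N)) = (\<lambda>c F x. c * F x)" by (simp add: cusp_rep_def)
      then show ?thesis using fun_space.vector_space_axioms by simp
    qed
    show "vspace (target \<nu>0) \<subseteq> module.span (scal (target \<nu>0)) D"
      using D(3) unfolding C.I_simps(1) .
    show "card D \<le> card (square_roots \<nu>0) * ?q + card (principal_pairs \<nu>0) * (?q + 1) +
        card (cuspidal_pairs \<eta> \<nu>0) * (?q - 1)"
      using D(2) dimension_count[OF c0] by linarith
  qed (use D(1) finite_index_sets sep in auto)
qed

end

theorem theorem6p4: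
  fixes \<eta> :: "'a::{field,finite}"
    and \<xi> :: "'a \<Rightarrow> complex"
    and \<nu>0 :: "'a \<times> 'a \<Rightarrow> complex"
    and p :: "('a \<Rightarrow> complex) set \<Rightarrow> ('a \<Rightarrow> complex) \<times> ('a \<Rightarrow> complex)"
    and r :: "('a \<times> 'a \<Rightarrow> complex) set \<Rightarrow> 'a \<times> 'a \<Rightarrow> complex"
  assumes "odd CARD('a)"
    and "\<eta> \<in> carrier (mult_grp Fq)" and "generate (mult_grp Fq) {\<eta>} = carrier (mult_grp Fq)"
    and "\<xi> \<in> characters (add_monoid Fq)" and "\<exists>x. \<xi> x \<noteq> 1"
    and "\<nu>0 \<in> indecomposables \<eta>"
    and "\<And>P. P \<in> principal_pairs \<nu>0 \<Longrightarrow> {fst (p P), snd (p P)} = P"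
    and "\<And>N. N \<in> cuspidal_pairs \<eta> \<nu>0 \<Longrightarrow> r N \<in> N"
  shows "rep_equiv GL2 (ind_rep GL2 (cartan \<eta>) (char_rep (cartan_char \<nu>0)))
    (direct_sum {\<psi> \<in> characters (mult_grp Fq). (\<lambda>x. \<psi> x ^ 2) = sharp \<nu>0} chi_hat1 \<oplus>\<^sub>R
     direct_sum (principal_pairs \<nu>0) (\<lambda>P. chi_hat (fst (p P)) (snd (p P))) \<oplus>\<^sub>R
     direct_sum (cuspidal_pairs \<eta> \<nu>0) (\<lambda>N. cusp_rep \<eta> \<xi> (r N)))"
proof -
  interpret add_char \<eta> \<xi>
    using assms(1-5) by unfold_locales (auto simp: mult_grp_Fq)
  show ?thesis
    using decomposition[OF assms(6-8)] unfolding square_roots_def .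
qed

end
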